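(* Let $d\ge1$ and consider the controlled Schrödinger equation $$i\partial_t\psi(t,x)=\Big(-\tfrac12\Delta+u_0(t)\tfrac{|x|^2}{2}+\sum_{j=1}^d u_j(t)x_j\Big)\psi(t,x),\qquad \psi(0)=\psi_0\in L^2(\mathbb{R}^d,\mathbb{C}),$$ with piecewise constant controls $u=(u_0,\dots,u_d)$. Let $\psi_0\in L^2(\mathbb{R}^d,\mathbb{C})$. Then every state of the family $$\Big\{e^{is\Delta}e^{i(\alpha|x|^2+p\cdot x)}\sigma^{d/2}\psi_0(\sigma x+\beta)\ :\ s,\alpha\in\mathbb{R},\ p,\beta\in\mathbb{R}^d,\ \sigma>0\Big\}$$ is small-time approximately reachable from $\psi_0$ for this equation.
   Context: For every $(u_0,\dots,u_d)\in\mathbb{R}^{d+1}$ the operator $-\frac12\Delta+u_0\frac{|x|^2}{2}+\sum_j u_jx_j$ is essentially self-adjoint on $C^\infty_c(\mathbb{R}^d,\mathbb{C})$, so for any piecewise constant control $u$ on $[0,t]$ there is a unique mild solution $\psi(t,u,\psi_0)$ (obtained by composing the unitary groups on the intervals of constancy). A state $\psi_1\in L^2(\mathbb{R}^d,\mathbb{C})$ is small-time approximately reachable from $\psi_0$ if for every $\varepsilon>0$ there exist $\tau\in[0,\varepsilon]$, a piecewise constant control $u:[0,\tau]\to\mathbb{R}^{d+1}$ and a phase $\theta\in[0,2\pi)$ such that $\|\psi(\tau,u,\psi_0)-e^{i\theta}\psi_1\|_{L^2}<\varepsilon$. *)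

theory Defs
  imports "HOL-Analysis.Analysis"
begin

text \<open>Representatives of elements of L2(R^d, C); d = CARD('n).\<close>

definition L2 :: "(real^'n \<Rightarrow> complex) \<Rightarrow> bool" where
  "L2 f \<longleftrightarrow> f \<in> borel_measurable lborel \<and> integrable lborel (\<lambda>x. (cmod (f x))^2)"

definition L2norm :: "(real^'n \<Rightarrow> complex) \<Rightarrow> real" where
  "L2norm f = sqrt (\<integral>x. (cmod (f x))^2 \<partial>lborel)"

definition ae_eq :: "(real^'n \<Rightarrow> complex) \<Rightarrow> (real^'n \<Rightarrow> complex) \<Rightarrow> bool" where
  "ae_eq f g \<longleftrightarrow> (AE x in lborel. f x = g x)"

fun dpar :: "'n list \<Rightarrow> (real^'n \<Rightarrow> complex) \<Rightarrow> real^'n \<Rightarrow> complex" where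
  "dpar [] \<phi> = \<phi>"
| "dpar (j # js) \<phi> = (\<lambda>x. vector_derivative (\<lambda>t. dpar js \<phi> (x + t *\<^sub>R axis j 1)) (at 0))"

definition smooth_cs :: "(real^'n \<Rightarrow> complex) \<Rightarrow> bool" where
  "smooth_cs \<phi> \<longleftrightarrow> compact (closure {x. \<phi> x \<noteq> 0})
     \<and> (\<forall>js. continuous_on UNIV (dpar js \<phi>))
     \<and> (\<forall>js j x. (\<lambda>t. dpar js \<phi> (x + t *\<^sub>R axis j 1)) differentiable (at 0))"

definition laplacian :: "(real^'n \<Rightarrow> complex) \<Rightarrow> real^'n \<Rightarrow> complex" where
  "laplacian \<phi> x = (\<Sum>j\<in>UNIV. dpar [j, j] \<phi> x)"

definition schrod_op :: "real \<times> (real^'n) \<Rightarrow> (real^'n \<Rightarrow> complex) \<Rightarrow> real^'n \<Rightarrow> complex" where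
  "schrod_op c \<phi> x = - (1/2) * laplacian \<phi> x
      + complex_of_real (fst c * (norm x)^2 / 2) * \<phi> x
      + complex_of_real (snd c \<bullet> x) * \<phi> x"

definition unitary_group :: "(real \<Rightarrow> (real^'n \<Rightarrow> complex) \<Rightarrow> (real^'n \<Rightarrow> complex)) \<Rightarrow> bool" where
  "unitary_group U \<longleftrightarrow>
     (\<forall>t f. L2 f \<longrightarrow> L2 (U t f) \<and> L2norm (U t f) = L2norm f)
   \<and> (\<forall>t f g a b. L2 f \<and> L2 g \<longrightarrow>
        ae_eq (U t (\<lambda>x. a * f x + b * g x)) (\<lambda>x. a * U t f x + b * U t g x))
   \<and> (\<forall>f. L2 f \<longrightarrow> ae_eq (U 0 f) f)
   \<and> (\<forall>s t f. L2 f \<longrightarrow> ae_eq (U (s + t) f) (U s (U t f)))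
   \<and> (\<forall>f. L2 f \<longrightarrow> ((\<lambda>t. L2norm (\<lambda>x. U t f x - f x)) \<longlongrightarrow> 0) (at 0))"

text \<open>U is the unitary group whose generator extends A on C_c^infinity, i.e.
  d/dt U(t) phi at t=0 equals A phi in L2 for every test function phi.
  For an operator essentially self-adjoint on C_c^infinity (as here), this determines
  U uniquely (Stone's theorem); e.g. U t = exp(-itH) corresponds to A = -i H.\<close>

definition generates :: "(real \<Rightarrow> (real^'n \<Rightarrow> complex) \<Rightarrow> (real^'n \<Rightarrow> complex))
    \<Rightarrow> ((real^'n \<Rightarrow> complex) \<Rightarrow> (real^'n \<Rightarrow> complex)) \<Rightarrow> bool" where
  "generates U A \<longleftrightarrow> unitary_group U \<and>
     (\<forall>\<phi>. smooth_cs \<phi> \<longrightarrow>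
        ((\<lambda>t. L2norm (\<lambda>x. (U t \<phi> x - \<phi> x) / complex_of_real t - A \<phi> x)) \<longlongrightarrow> 0) (at 0))"

text \<open>Solution for a piecewise constant control given as a list of (duration, value) pieces,
  composing the propagators P c t = exp(-i t H_c).\<close>

fun evolve :: "(real \<times> (real^'n) \<Rightarrow> real \<Rightarrow> (real^'n \<Rightarrow> complex) \<Rightarrow> (real^'n \<Rightarrow> complex))
    \<Rightarrow> (real \<times> (real \<times> (real^'n))) list \<Rightarrow> (real^'n \<Rightarrow> complex) \<Rightarrow> (real^'n \<Rightarrow> complex)" where
  "evolve P [] f = f"
| "evolve P ((t, c) # cs) f = evolve P cs (P c t f)"

definition small_time_reachable ::
  "(real \<times> (real^'n) \<Rightarrow> real \<Rightarrow> (real^'n \<Rightarrow> complex) \<Rightarrow> (real^'n \<Rightarrow> complex))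
    \<Rightarrow> (real^'n \<Rightarrow> complex) \<Rightarrow> (real^'n \<Rightarrow> complex) \<Rightarrow> bool" where
  "small_time_reachable P \<psi>0 \<psi>1 \<longleftrightarrow>
    (\<forall>\<epsilon>>0. \<exists>cs \<theta>. (\<forall>(t, c) \<in> set cs. 0 \<le> t) \<and> sum_list (map fst cs) \<le> \<epsilon>
        \<and> 0 \<le> \<theta> \<and> \<theta> < 2 * pi
        \<and> L2norm (\<lambda>x. evolve P cs \<psi>0 x - exp (\<i> * complex_of_real \<theta>) * \<psi>1 x) < \<epsilon>)"

end

theory Submission
  imports Defs
begin

text \<open>
  An abstract unitary group is compared with an explicit curve \<phi>(t) by Duhamel's estimate: if
  \<phi>' - A \<phi> is small in L2, then \<phi>(t) stays close to the evolution of \<phi>(0). All curves needed here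
  consist of Gaussians, which lie in the closure of the generator on test functions (cut them off),
  and the Gaussian wave packets exp (-|x|^2/2 + i \<xi>.x) span a dense subspace of L2.

  Controls of size 1/\<tau> during time \<tau> give, as \<tau> tends to 0, first the multiplications by
  exp (i (\<alpha> |x|^2 + p.x)); conjugating the free flow by exp (i p.x / \<tau>) gives the translations, and
  conjugating the flow of an inverted oscillator of strength 1/\<tau>^2 by a quadratic phase of size 1/\<tau>
  gives the dilations. Dilations compress an oscillator flow of any positive angle into
  arbitrarily small time, and the free flow of any time s, positive or negative, is an oscillator
  flow followed by a dilation and a quadratic phase.\<close>

subsection \<open>The space of square integrable functions\<close>

text \<open>The propagators are given only through their derivative at time 0 on test functions, not
  through a kernel, so every relation between flows is read off from explicit solutions. Gaussians
  supply these because the Hamiltonians are isotropic polynomials of degree two: time derivative and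
  generator both turn a Gaussian into a quadratic polynomial times the same Gaussian, and an
  evolution equation becomes a system for the parameters \<open>a\<close>, \<open>B\<close>,
  \<open>c\<close>.

  A momentum of size 1/\<tau> moves a state by a finite distance in time \<tau>, but its kinetic
  energy contributes a phase of size 1/\<tau>, which has no limit. Hence all limits are taken up to
  a phase depending on \<tau>. It has to be common to all states, since otherwise nothing would
  extend from wave packets to their linear combinations.

  The kinetic term always runs forward. Negative s are nevertheless within reach because the
  oscillator flow is periodic up to a phase, so that a backward rotation is also a forward
  one.\<close>

lemma L2_measurable [measurable_dest]: "L2 f \<Longrightarrow> f \<in> borel_measurable borel"
  unfolding L2_def by simp

lemma L2I_bound:
  fixes f :: "real^'n \<Rightarrow> complex"
  assumes "f \<in> borel_measurable borel" "integrable lborel (\<lambda>x. (w x)\<^sup>2)" "\<And>x. cmod (f x) \<le> w x"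
  shows "L2 f"
  unfolding L2_def
proof
  show "f \<in> borel_measurable lborel" using assms(1) by simp
  show "integrable lborel (\<lambda>x. (cmod (f x))\<^sup>2)"
    by (rule Bochner_Integration.integrable_bound[OF assms(2)]) (use assms(1,3) in \<open>auto intro!: power_mono\<close>)
qed

lemma L2norm_nonneg [simp]: "0 \<le> L2norm f"
  unfolding L2norm_def by simp

lemma L2norm_zero [simp]: "L2norm (\<lambda>x. 0) = 0"
  by (simp add: L2norm_def)

lemma L2norm_sq: "(L2norm f)\<^sup>2 = (\<integral>x. (cmod (f x))\<^sup>2 \<partial>lborel)"
  unfolding L2norm_def by (simp add: integral_nonneg_AE)

lemma L2_cmult [intro]: "L2 f \<Longrightarrow> L2 (\<lambda>x. c * f x)"
  unfolding L2_def by (auto simp: norm_mult power_mult_distrib)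

lemma L2_add [intro]:
  assumes "L2 f" "L2 g" shows "L2 (\<lambda>x. f x + g x)"
  unfolding L2_def
proof
  note [measurable] = assms[THEN L2_measurable]
  show "(\<lambda>x. f x + g x) \<in> borel_measurable lborel" by simp
  have "(cmod (f x + g x))\<^sup>2 \<le> 2 * (cmod (f x))\<^sup>2 + 2 * (cmod (g x))\<^sup>2" for x
  proof -
    have "(cmod (f x + g x))\<^sup>2 \<le> (cmod (f x) + cmod (g x))\<^sup>2"
      by (intro power_mono norm_triangle_ineq) auto
    also have "\<dots> \<le> 2 * (cmod (f x))\<^sup>2 + 2 * (cmod (g x))\<^sup>2"
      using sum_squares_bound[of "cmod (f x)" "cmod (g x)"] by (simp add: power2_sum)
    finally show ?thesis .
  qed
  note bnd = this
  have "integrable lborel (\<lambda>x. 2 * (cmod (f x))\<^sup>2 + 2 * (cmod (g x))\<^sup>2)"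
    using assms by (simp add: L2_def)
  then show "integrable lborel (\<lambda>x. (cmod (f x + g x))\<^sup>2)"
    by (rule Bochner_Integration.integrable_bound) (use bnd in auto)
qed

lemma L2_diff [intro]: "L2 f \<Longrightarrow> L2 g \<Longrightarrow> L2 (\<lambda>x. f x - g x)"
  using L2_add[of f "\<lambda>x. -1 * g x"] L2_cmult[of g "-1"] by simp

lemma L2_divide [intro]: "L2 f \<Longrightarrow> L2 (\<lambda>x. f x / c)"
  using L2_cmult[of f "1/c"] by simp

lemma L2norm_cmult: "L2norm (\<lambda>x. c * f x) = cmod c * L2norm f"
  unfolding L2norm_def by (simp add: norm_mult power_mult_distrib real_sqrt_mult)

lemma L2norm_divide: "L2norm (\<lambda>x. f x / c) = L2norm f / cmod c"
  using L2norm_cmult[of "1/c" f] by (simp add: norm_divide)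

lemma L2norm_minus_commute: "L2norm (\<lambda>x. f x - g x) = L2norm (\<lambda>x. g x - f x)"
  unfolding L2norm_def by (simp add: norm_minus_commute)

text \<open>Integrate the pointwise bound (u + v)^2 \<le> (1 + s) u^2 + (1 + 1/s) v^2
  and optimise the parameter s.\<close>

lemma L2norm_triangle:
  assumes "L2 f" "L2 g" shows "L2norm (\<lambda>x. f x + g x) \<le> L2norm f + L2norm g"
proof -
  let ?F = "L2norm f" and ?G = "L2norm g"
  have pw: "(L2norm (\<lambda>x. f x + g x))\<^sup>2 \<le> (1 + s) * ?F\<^sup>2 + (1 + 1/s) * ?G\<^sup>2" if s: "s > 0" for s
  proof -
    have "(cmod (f x + g x))\<^sup>2 \<le> (1 + s) * (cmod (f x))\<^sup>2 + (1 + 1/s) * (cmod (g x))\<^sup>2" for x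
    proof -
      have "(cmod (f x + g x))\<^sup>2 \<le> (cmod (f x) + cmod (g x))\<^sup>2"
        by (intro power_mono norm_triangle_ineq) auto
      moreover have "0 \<le> (s * cmod (f x) - cmod (g x))\<^sup>2 / s" using s by simp
      then have "2 * cmod (f x) * cmod (g x) \<le> s * (cmod (f x))\<^sup>2 + (cmod (g x))\<^sup>2 / s"
        using s by (simp add: power2_diff field_simps power2_eq_square)
      ultimately show ?thesis by (simp add: power2_sum algebra_simps)
    qed
    moreover have "integrable lborel (\<lambda>x. (cmod (f x + g x))\<^sup>2)"
      "integrable lborel (\<lambda>x. (cmod (f x))\<^sup>2)" "integrable lborel (\<lambda>x. (cmod (g x))\<^sup>2)"
      using assms L2_add[OF assms] by (auto simp: L2_def)
    ultimately have "(\<integral>x. (cmod (f x + g x))\<^sup>2 \<partial>lborel)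
        \<le> (\<integral>x. (1 + s) * (cmod (f x))\<^sup>2 + (1 + 1/s) * (cmod (g x))\<^sup>2 \<partial>lborel)"
      by (intro integral_mono) auto
    also have "\<dots> = (1 + s) * ?F\<^sup>2 + (1 + 1/s) * ?G\<^sup>2"
      using assms by (simp add: L2norm_sq L2_def)
    finally show ?thesis by (simp add: L2norm_sq)
  qed
  \<comment> \<open>The optimal parameter is s = ?G / ?F; adding e to both norms keeps it positive
    and finite when one of them vanishes.\<close>
  have le: "L2norm (\<lambda>x. f x + g x) \<le> (?F + e) + (?G + e)" if e: "e > 0" for e
  proof (rule power2_le_imp_le)
    let ?s = "(?G + e) / (?F + e)"
    have s: "?s > 0" using e by (simp add: add_nonneg_pos)
    have F: "?F + e > 0" and G: "?G + e > 0" using e by (simp_all add: add_nonneg_pos)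
    have "(L2norm (\<lambda>x. f x + g x))\<^sup>2 \<le> (1 + ?s) * ?F\<^sup>2 + (1 + 1/?s) * ?G\<^sup>2" by (rule pw[OF s])
    also have "\<dots> \<le> (1 + ?s) * (?F + e)\<^sup>2 + (1 + 1/?s) * (?G + e)\<^sup>2"
      using s e by (intro add_mono mult_left_mono power_mono) (auto simp: add_nonneg_nonneg)
    also have "\<dots> = ((?F + e) + (?G + e))\<^sup>2"
      using F G by (simp add: divide_simps power2_eq_square) (simp add: algebra_simps)
    finally show "(L2norm (\<lambda>x. f x + g x))\<^sup>2 \<le> ((?F + e) + (?G + e))\<^sup>2" .
  qed (use e in auto)
  have "L2norm (\<lambda>x. f x + g x) \<le> ?F + ?G + e" if "e > 0" for e
    using le[of "e / 2"] that by simp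
  then show ?thesis by (rule field_le_epsilon)
qed

lemma L2norm_triangle3:
  assumes "L2 f" "L2 g" "L2 h"
  shows "L2norm (\<lambda>x. f x - h x) \<le> L2norm (\<lambda>x. f x - g x) + L2norm (\<lambda>x. g x - h x)"
  using L2norm_triangle[of "\<lambda>x. f x - g x" "\<lambda>x. g x - h x"] assms by (simp add: L2_diff)

lemma L2norm_diff_ge:
  assumes "L2 f" "L2 g"
  shows "\<bar>L2norm f - L2norm g\<bar> \<le> L2norm (\<lambda>x. f x - g x)"
  using L2norm_triangle[of "\<lambda>x. f x - g x" g] L2norm_triangle[of "\<lambda>x. g x - f x" f] assms
  by (simp add: L2_diff L2norm_minus_commute[of f g])

lemma L2norm_mono:
  assumes "L2 g" "f \<in> borel_measurable borel" "\<And>x. cmod (f x) \<le> cmod (g x)"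
  shows "L2norm f \<le> L2norm g"
proof -
  have "L2 f" by (rule L2I_bound[where w="\<lambda>x. cmod (g x)"]) (use assms in \<open>auto simp: L2_def\<close>)
  then show ?thesis
    unfolding L2norm_def using assms
    by (intro real_sqrt_le_mono integral_mono power_mono) (auto simp: L2_def)
qed

lemma L2norm_eq_0_iff:
  assumes "L2 f" "L2 g"
  shows "L2norm (\<lambda>x. f x - g x) = 0 \<longleftrightarrow> ae_eq f g"
proof -
  have "integrable lborel (\<lambda>x. (cmod (f x - g x))\<^sup>2)" using L2_diff[OF assms] by (simp add: L2_def)
  from integral_nonneg_eq_0_iff_AE[OF this] show ?thesis
    unfolding L2norm_def ae_eq_def by simp
qed

lemma L2norm_cong_ae:
  assumes "ae_eq f g" "L2 f" "L2 g"
  shows "L2norm f = L2norm g"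
  using L2norm_diff_ge[OF assms(2,3)] assms(1) L2norm_eq_0_iff[OF assms(2,3)] by simp

lemma L2_dominated_convergence:
  fixes f :: "real^'n \<Rightarrow> complex"
  assumes "\<And>n. F n \<in> borel_measurable borel" "f \<in> borel_measurable borel"
    and w: "integrable lborel (\<lambda>x. (w x)\<^sup>2)" and F: "\<And>n x. cmod (F n x) \<le> w x"
    and lim: "\<And>x. (\<lambda>n. F n x) \<longlonglongrightarrow> f x"
  shows "(\<lambda>n. L2norm (\<lambda>x. F n x - f x)) \<longlonglongrightarrow> 0"
proof -
  have fw: "cmod (f x) \<le> w x" for x
    using F by (intro LIMSEQ_le_const2[OF tendsto_norm[OF lim]]) auto
  have "(\<lambda>n. \<integral>x. (cmod (F n x - f x))\<^sup>2 \<partial>lborel) \<longlonglongrightarrow> (\<integral>x. 0 \<partial>(lborel :: (real^'n) measure))"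
  proof (rule integral_dominated_convergence[where w="\<lambda>x. 4 * (w x)\<^sup>2"])
    show "AE x in lborel. (\<lambda>n. (cmod (F n x - f x))\<^sup>2) \<longlonglongrightarrow> 0"
    proof (rule AE_I2)
      fix x
      have "(\<lambda>n. (cmod (F n x - f x))\<^sup>2) \<longlonglongrightarrow> (cmod (f x - f x))\<^sup>2"
        by (intro tendsto_intros lim)
      then show "(\<lambda>n. (cmod (F n x - f x))\<^sup>2) \<longlonglongrightarrow> 0" by simp
    qed
    show "AE x in lborel. norm ((cmod (F n x - f x))\<^sup>2) \<le> 4 * (w x)\<^sup>2" for n
    proof (rule AE_I2)
      fix x
      have "cmod (F n x - f x) \<le> 2 * w x"
        using F[of n x] fw[of x] norm_triangle_ineq4[of "F n x" "f x"] by linarith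
      then have "(cmod (F n x - f x))\<^sup>2 \<le> (2 * w x)\<^sup>2" by (intro power_mono) auto
      then show "norm ((cmod (F n x - f x))\<^sup>2) \<le> 4 * (w x)\<^sup>2" by (simp add: power_mult_distrib)
    qed
  qed (use assms w in auto)
  then have "(\<lambda>n. sqrt (\<integral>x. (cmod (F n x - f x))\<^sup>2 \<partial>lborel)) \<longlonglongrightarrow> sqrt 0"
    by (intro tendsto_real_sqrt) simp
  then show ?thesis by (simp add: L2norm_def)
qed

section \<open>An exponential majorant for Gaussian estimates\<close>

lemma integrable_exp_neg_norm:
  "integrable lborel (\<lambda>x::'a::euclidean_space. exp (- norm x))"
proof -
  \<comment> \<open>On the shell n <= |x| <= n + 1 the integrand is at most exp (- n). The whole
    ball of radius n + 1 replaces the shell, since its volume already grows only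
    polynomially.\<close>
  let ?u = "\<lambda>n x. exp (- real n) * indicator (cball (0::'a) (real n + 1)) x"
  let ?v = "unit_ball_vol DIM('a)"
  \<comment> \<open>One half of the exponent absorbs the polynomial volume, the other half leaves
    the geometric series with ratio exp (-1/2).\<close>
  have sm: "summable (\<lambda>n. exp (- real n) * (?v * (real n + 1) ^ DIM('a)))"
  proof (rule summable_comparison_test_ev)
    show "summable (\<lambda>n. (exp (-1/2::real)) ^ n)" by (rule summable_geometric) simp
    have "(\<lambda>n. exp (- real n / 2) * (?v * (real n + 1) ^ DIM('a))) \<longlonglongrightarrow> 0"
    proof -
      have "((\<lambda>t::real. t ^ DIM('a) / exp t) \<longlongrightarrow> 0) at_top" by (rule tendsto_power_div_exp_0)
      moreover have "filterlim (\<lambda>n. (real n + 1) / 2) at_top sequentially"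
        unfolding filterlim_at_top
      proof
        fix Z :: real
        show "\<forall>\<^sub>F n in sequentially. Z \<le> (real n + 1) / 2"
          using eventually_ge_at_top[of "nat \<lceil>2 * Z\<rceil>"] 
        proof eventually_elim
          case (elim n)
          have "2 * Z \<le> real (nat \<lceil>2 * Z\<rceil>)" by (rule real_nat_ceiling_ge)
          also have "\<dots> \<le> real n" using elim by simp
          finally show ?case by simp
        qed
      qed
      ultimately have "(\<lambda>n. ((real n + 1) / 2) ^ DIM('a) / exp ((real n + 1) / 2)) \<longlonglongrightarrow> 0"
        by (rule filterlim_compose)
      then have "(\<lambda>n. (?v * 2 ^ DIM('a) * exp (1/2)) * (((real n + 1) / 2) ^ DIM('a) / exp ((real n + 1) / 2))) \<longlonglongrightarrow> 0"
        by (rule tendsto_mult_right_zero)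
      moreover have "(?v * 2 ^ DIM('a) * exp (1/2)) * (((real n + 1) / 2) ^ DIM('a) / exp ((real n + 1) / 2))
          = exp (- real n / 2) * (?v * (real n + 1) ^ DIM('a))" for n
      proof -
        have "exp (- real n / 2) = exp (1/2 - (real n + 1) / 2)" by (simp add: field_simps)
        also have "\<dots> = exp (1/2) / exp ((real n + 1) / 2)" by (rule exp_diff)
        finally show ?thesis by (simp add: power_divide)
      qed
      ultimately show ?thesis by simp
    qed
    then have "\<forall>\<^sub>F n in sequentially. exp (- real n / 2) * (?v * (real n + 1) ^ DIM('a)) < 1"
      by (rule order_tendstoD) simp
    then show "\<forall>\<^sub>F n in sequentially. norm (exp (- real n) * (?v * (real n + 1) ^ DIM('a))) \<le> (exp (-1/2)) ^ n"
    proof eventually_elim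
      case (elim n)
      have "norm (exp (- real n) * (?v * (real n + 1) ^ DIM('a)))
         = exp (- real n / 2) * (exp (- real n / 2) * (?v * (real n + 1) ^ DIM('a)))"
        by (simp add: abs_mult mult.assoc[symmetric] exp_add[symmetric])
      also have "\<dots> \<le> exp (- real n / 2) * 1" using elim by (intro mult_left_mono) auto
      also have "\<dots> = (exp (-1/2)) ^ n" by (simp flip: exp_of_nat_mult)
      finally show ?case .
    qed
  qed
  have term_le: "f n \<le> suminf f" for f :: "nat \<Rightarrow> ennreal" and n
    using sum_le_suminf[OF summableI, of "{n}" f] by simp
  have bound: "ennreal (exp (- norm x)) \<le> (\<Sum>n. ennreal (?u n x))" for x :: 'a
  proof -
    define n where "n = nat \<lfloor>norm x\<rfloor>"
    have n: "real n \<le> norm x" "norm x \<le> real n + 1" unfolding n_def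
      by (simp, use floor_correct[of "norm x"] in \<open>simp del: floor_correct\<close>)
    then have "ennreal (exp (- norm x)) \<le> ennreal (?u n x)" by (intro ennreal_leI) (auto simp: indicator_def)
    moreover have "ennreal (?u n x) \<le> (\<Sum>n. ennreal (?u n x))"
      by (rule term_le)
    ultimately show ?thesis by (rule order_trans)
  qed
  have "(\<integral>\<^sup>+x. ennreal (norm (exp (- norm x))) \<partial>(lborel :: 'a measure)) \<le> (\<integral>\<^sup>+x. (\<Sum>n. ennreal (?u n x)) \<partial>(lborel :: 'a measure))"
    by (rule nn_integral_mono) (simp only: real_norm_def abs_exp_cancel bound)
  also have "\<dots> = (\<Sum>n. \<integral>\<^sup>+x. ennreal (?u n x) \<partial>lborel)"
    by (rule nn_integral_suminf)
      (intro measurable_compose[OF _ measurable_ennreal] borel_measurable_times borel_measurable_const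
        borel_measurable_indicator; simp)
  also have "\<dots> = (\<Sum>n. ennreal (exp (- real n) * (?v * (real n + 1) ^ DIM('a))))"
  proof (rule suminf_cong)
    fix n
    have "(\<integral>\<^sup>+x. ennreal (?u n x) \<partial>lborel)
        = (\<integral>\<^sup>+x. ennreal (exp (- real n)) * indicator (cball (0::'a) (real n + 1)) x \<partial>lborel)"
      by (intro nn_integral_cong) (simp add: indicator_def)
    also have "\<dots> = ennreal (exp (- real n)) * emeasure lborel (cball (0::'a) (real n + 1))"
      by (rule nn_integral_cmult_indicator) simp
    also have "\<dots> = ennreal (exp (- real n) * (?v * (real n + 1) ^ DIM('a)))"
      by (simp add: emeasure_cball flip: ennreal_mult')
    finally show "(\<integral>\<^sup>+x. ennreal (?u n x) \<partial>lborel) = ennreal (exp (- real n) * (?v * (real n + 1) ^ DIM('a)))" .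
  qed
  also have "\<dots> < \<infinity>"
    unfolding infinity_ennreal_def less_top[symmetric]
    by (rule ennreal_suminf_neq_top[OF sm]) simp
  finally show ?thesis by (intro integrableI_bounded) auto
qed

abbreviation decay :: "real^'n \<Rightarrow> real" where
  "decay x \<equiv> exp (- norm x)"

lemma integrable_decay_sq: "integrable lborel (\<lambda>x::real^'n. (K * decay x)\<^sup>2)"
proof -
  have "integrable lborel (\<lambda>x::real^'n. K\<^sup>2 * exp (- norm x))"
    using integrable_exp_neg_norm by (intro integrable_mult_right) auto
  then show ?thesis
    by (rule Bochner_Integration.integrable_bound)
      (auto simp: power_mult_distrib mult_left_mono simp flip: exp_double)
qed

lemma L2_decay: "f \<in> borel_measurable borel \<Longrightarrow> (\<And>x. cmod (f x) \<le> K * decay x) \<Longrightarrow> L2 f"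
  by (rule L2I_bound[OF _ integrable_decay_sq])

lemma L2norm_decay_bound:
  fixes f :: "real^'n \<Rightarrow> complex"
  assumes "f \<in> borel_measurable borel" "\<And>x. cmod (f x) \<le> K * decay x" "0 \<le> K"
  shows "L2norm f \<le> K * L2norm (\<lambda>x::real^'n. of_real (decay x))"
proof -
  have "L2norm f \<le> L2norm (\<lambda>x::real^'n. of_real K * of_real (decay x))"
    using assms by (intro L2norm_mono L2_decay[where K=K]) (auto simp: norm_mult)
  then show ?thesis using assms(3) unfolding L2norm_cmult by simp
qed

subsection \<open>Gaussian wave packets\<close>

text \<open>The leading coefficient is a scalar because the oscillator potential and the Laplacian
  are isotropic. The same polynomials serve as exponents of Gaussians, as potentials and as the
  prefactors that differentiation produces.\<close>

definition quad :: "complex \<Rightarrow> ('n \<Rightarrow> complex) \<Rightarrow> complex \<Rightarrow> real^'n \<Rightarrow> complex" where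
  "quad a B c x = a * of_real ((norm x)\<^sup>2) + (\<Sum>j\<in>UNIV. B j * of_real (x $ j)) + c"

definition gauss :: "complex \<Rightarrow> ('n \<Rightarrow> complex) \<Rightarrow> complex \<Rightarrow> real^'n \<Rightarrow> complex" where
  "gauss a B c x = exp (quad a B c x)"

definition wave :: "real^'n \<Rightarrow> real^'n \<Rightarrow> complex" where
  "wave \<xi> = gauss (-1/2) (\<lambda>j. \<i> * of_real (\<xi> $ j)) 0"

lemma continuous_quad [continuous_intros]: "continuous_on S (quad a B c)"
  unfolding quad_def by (intro continuous_intros)

lemma continuous_gauss [continuous_intros]: "continuous_on S (gauss a B c)"
  unfolding gauss_def by (intro continuous_intros)

lemma quad_measurable [measurable]: "quad a B c \<in> borel_measurable borel"
  by (intro borel_measurable_continuous_onI continuous_intros)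

lemma gauss_measurable [measurable]: "gauss a B c \<in> borel_measurable borel"
  by (intro borel_measurable_continuous_onI continuous_intros)

lemma cmod_quad_le:
  "cmod (quad a B c x) \<le> (cmod a + (\<Sum>j\<in>UNIV. cmod (B j)) + cmod c) * (1 + norm x)\<^sup>2"
proof -
  have "cmod (\<Sum>j\<in>UNIV. B j * of_real (x $ j)) \<le> (\<Sum>j\<in>UNIV. cmod (B j) * (1 + norm x)\<^sup>2)"
  proof (rule sum_norm_le)
    fix j
    have "\<bar>x $ j\<bar> \<le> norm x" by (rule component_le_norm_cart)
    also have "\<dots> \<le> (1 + norm x)\<^sup>2" by (simp add: power2_eq_square algebra_simps)
    finally show "cmod (B j * of_real (x $ j)) \<le> cmod (B j) * (1 + norm x)\<^sup>2"
      by (simp add: norm_mult mult_left_mono)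
  qed
  moreover have "cmod (a * of_real ((norm x)\<^sup>2)) \<le> cmod a * (1 + norm x)\<^sup>2"
    by (simp add: norm_mult norm_power mult_left_mono power_mono)
  moreover have "cmod c \<le> cmod c * (1 + norm x)\<^sup>2"
    using mult_left_mono[of 1 "(1 + norm x)\<^sup>2" "cmod c"] by simp
  ultimately show ?thesis
    unfolding quad_def using norm_triangle_ineq[of "a * of_real ((norm x)\<^sup>2) + (\<Sum>j\<in>UNIV. B j * of_real (x $ j))" c]
      norm_triangle_ineq[of "a * of_real ((norm x)\<^sup>2)" "\<Sum>j\<in>UNIV. B j * of_real (x $ j)"]
    by (simp add: algebra_simps sum_distrib_left sum_distrib_right)
qed

text \<open>Only real parts enter the bound, so it is insensitive to arbitrarily fast oscillation;
  this is what survives controls of size 1/\<tau>.\<close>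

lemma cmod_gauss_le:
  assumes "Re a \<le> - a0" "(\<Sum>j\<in>UNIV. \<bar>Re (B j)\<bar>) \<le> M" "Re c \<le> M"
  shows "cmod (gauss a B c x) \<le> exp (M + M * norm x - a0 * (norm x)\<^sup>2)"
proof -
  have "Re (quad a B c x) = Re a * (norm x)\<^sup>2 + (\<Sum>j\<in>UNIV. Re (B j) * x $ j) + Re c"
    unfolding quad_def by (simp flip: of_real_power)
  also have "\<dots> \<le> - a0 * (norm x)\<^sup>2 + M * norm x + M"
  proof (intro add_mono)
    show "Re a * (norm x)\<^sup>2 \<le> - a0 * (norm x)\<^sup>2" using assms(1) by (intro mult_right_mono) auto
    have "(\<Sum>j\<in>UNIV. Re (B j) * x $ j) \<le> (\<Sum>j\<in>UNIV. \<bar>Re (B j)\<bar> * norm x)"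
    proof (rule sum_mono)
      fix j
      have "Re (B j) * x $ j \<le> \<bar>Re (B j)\<bar> * \<bar>x $ j\<bar>" by (metis abs_ge_self abs_mult)
      also have "\<dots> \<le> \<bar>Re (B j)\<bar> * norm x" by (intro mult_left_mono component_le_norm_cart) auto
      finally show "Re (B j) * x $ j \<le> \<bar>Re (B j)\<bar> * norm x" .
    qed
    also have "\<dots> \<le> M * norm x" using assms(2) by (simp add: mult_right_mono flip: sum_distrib_right)
    finally show "(\<Sum>j\<in>UNIV. Re (B j) * x $ j) \<le> M * norm x" .
  qed (rule assms)
  finally show ?thesis unfolding gauss_def by simp
qed

text \<open>The prefactor is absorbed by (1 + |x|)^2 <= exp (2 |x|), and one further exp (- |x|) is
  set aside as \<open>decay\<close>, which raises the linear rate from M to M + 3. Completing the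
  square in (M + 3) |x| - a0 |x|^2 gives (M + 3)^2 / (4 a0).\<close>

lemma cmod_mult_gauss_le:
  assumes "a0 > 0" "Re a \<le> - a0" "(\<Sum>j\<in>UNIV. \<bar>Re (B j)\<bar>) \<le> M" "Re c \<le> M" "0 \<le> N"
    and "cmod q \<le> N * (1 + norm x)\<^sup>2"
  shows "cmod (q * gauss a B c x) \<le> N * exp (M + (M + 3)\<^sup>2 / (4 * a0)) * decay x"
proof -
  have "(1 + norm x)\<^sup>2 \<le> exp (2 * norm x)"
    using power_mono[OF exp_ge_add_one_self[of "norm x"], of 2] by (simp flip: exp_double)
  then have "cmod q \<le> N * exp (2 * norm x)"
    using assms(5,6) mult_left_mono by (meson order_trans)
  then have "cmod (q * gauss a B c x) \<le> (N * exp (2 * norm x)) * exp (M + M * norm x - a0 * (norm x)\<^sup>2)"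
    unfolding norm_mult using assms cmod_gauss_le by (intro mult_mono) auto
  also have "\<dots> = N * exp (2 * norm x + (M + M * norm x - a0 * (norm x)\<^sup>2))"
    by (simp add: exp_add)
  also have "\<dots> \<le> N * exp (M + (M + 3)\<^sup>2 / (4 * a0) + - norm x)"
  proof -
    have "0 \<le> (2 * a0 * norm x - (M + 3))\<^sup>2 / (4 * a0)" using assms(1) by simp
    then have "(M + 3) * norm x - a0 * (norm x)\<^sup>2 \<le> (M + 3)\<^sup>2 / (4 * a0)"
      using assms(1) by (simp add: power2_diff field_simps power2_eq_square)
    then show ?thesis using assms(5) by (intro mult_left_mono) (auto simp: algebra_simps)
  qed
  finally show ?thesis by (simp only: exp_add mult.assoc)
qed

text \<open>\<open>K\<close> is fixed before \<open>q\<close> and \<open>N\<close>: one constant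
  serves a whole sequence of prefactors, as dominated convergence requires.\<close>

lemma quad_gauss_decay:
  assumes "Re a < 0"
  obtains K where "0 \<le> K" "\<And>q N x. \<lbrakk>0 \<le> N; cmod q \<le> N * (1 + norm x)\<^sup>2\<rbrakk> \<Longrightarrow> cmod (q * gauss a B c x) \<le> N * K * decay x"
proof
  let ?M = "(\<Sum>j\<in>UNIV. \<bar>Re (B j)\<bar>) + \<bar>Re c\<bar>"
  show "0 \<le> exp (?M + (?M + 3)\<^sup>2 / (4 * (- Re a)))" by simp
  have *: "Re c \<le> ?M" "(\<Sum>j\<in>UNIV. \<bar>Re (B j)\<bar>) \<le> ?M"
    using sum_nonneg[of UNIV "\<lambda>j. \<bar>Re (B j)\<bar>"] by (auto intro: add_increasing)
  show "cmod (q * gauss a B c x) \<le> N * exp (?M + (?M + 3)\<^sup>2 / (4 * (- Re a))) * decay x"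
    if "0 \<le> N" "cmod q \<le> N * (1 + norm x)\<^sup>2" for q N x
    by (rule cmod_mult_gauss_le) (use assms that * in auto)
qed

lemma L2_quad_gauss:
  assumes "Re a < 0" shows "L2 (\<lambda>x. quad a' B' c' x * gauss a B c x)"
proof -
  obtain K where K: "0 \<le> K" "\<And>q N x. \<lbrakk>0 \<le> N; cmod q \<le> N * (1 + norm x)\<^sup>2\<rbrakk> \<Longrightarrow> cmod (q * gauss a B c x) \<le> N * K * decay x"
    using quad_gauss_decay[OF assms] by blast
  show ?thesis
    by (rule L2_decay[OF _ K(2)[OF _ cmod_quad_le]]) (auto intro!: sum_nonneg add_nonneg_nonneg)
qed

lemma L2_gauss: "Re a < 0 \<Longrightarrow> L2 (gauss a B c)"
  using L2_quad_gauss[of a 0 "\<lambda>_. 0" 1 B c] by (simp add: quad_def)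

lemma L2_wave [simp]: "L2 (wave \<xi>)"
  unfolding wave_def by (rule L2_gauss) simp

lemma wave_eq: "wave \<xi> x = of_real (exp (- (norm x)\<^sup>2 / 2)) * exp (\<i> * of_real (\<xi> \<bullet> x))"
proof -
  have "wave \<xi> x = exp (of_real (- (norm x)\<^sup>2 / 2) + \<i> * of_real (\<xi> \<bullet> x))"
    unfolding wave_def gauss_def quad_def inner_vec_def by (simp add: sum_distrib_left mult.assoc)
  then show ?thesis unfolding exp_add exp_of_real .
qed

lemma cmod_wave: "cmod (wave \<xi> x) = exp (- (norm x)\<^sup>2 / 2)"
  by (simp add: wave_eq norm_mult)

lemma wave_add: "wave (\<xi> + \<eta>) x = wave \<xi> x * exp (\<i> * of_real (\<eta> \<bullet> x))"
  by (simp add: wave_eq inner_add_left algebra_simps flip: exp_add)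

lemma cmod_wave_le: "cmod (wave \<xi> x) \<le> exp (1/2) * decay x"
proof -
  have "0 \<le> (norm x - 1)\<^sup>2" by simp
  then have "- (norm x)\<^sup>2 / 2 \<le> 1/2 - norm x" by (simp add: power2_diff)
  then show ?thesis by (simp add: cmod_wave flip: exp_add)
qed

text \<open>
  The multipliers h that preserve the closed span of the wave packets form an algebra that is closed
  under bounded pointwise limits and contains the characters. As sin (e x) / e tends to x, it
  contains the continuous bounded functions of a coordinate, hence the indicators of half spaces,
  hence those of all Borel sets.\<close>

lemma L2_wave_induct [consumes 1, case_names lincomb limit wave]:
  fixes Q :: "(real^'n \<Rightarrow> complex) \<Rightarrow> bool"
  assumes "L2 f"
    and lin: "\<And>f g a b. \<lbrakk>L2 f; L2 g; Q f; Q g\<rbrakk> \<Longrightarrow> Q (\<lambda>x. a * f x + b * g x)"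
    and lim: "\<And>f. \<lbrakk>L2 f; \<And>e. e > 0 \<Longrightarrow> \<exists>g. L2 g \<and> Q g \<and> L2norm (\<lambda>x. f x - g x) < e\<rbrakk> \<Longrightarrow> Q f"
    and wave: "\<And>\<xi>. Q (wave \<xi>)"
  shows "Q f"
proof -
  have limQ: "Q h" if "\<And>n. Q (F n)" "\<And>n. F n \<in> borel_measurable borel" "h \<in> borel_measurable borel"
    "integrable lborel (\<lambda>x. (w x)\<^sup>2)" "\<And>n x. cmod (F n x) \<le> w x" "\<And>x. (\<lambda>n. F n x) \<longlonglongrightarrow> h x"
  for F h and w :: "real^'n \<Rightarrow> real"
  proof (rule lim)
    have "cmod (h x) \<le> w x" for x
      using that(5) by (intro LIMSEQ_le_const2[OF tendsto_norm[OF that(6)]]) auto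
    then show "L2 h" using that by (intro L2I_bound)
    fix e :: real assume "e > 0"
    have "(\<lambda>n. L2norm (\<lambda>x. F n x - h x)) \<longlonglongrightarrow> 0"
      using that by (intro L2_dominated_convergence[where w=w])
    from order_tendstoD(2)[OF this \<open>e > 0\<close>] obtain n where "L2norm (\<lambda>x. F n x - h x) < e"
      unfolding eventually_sequentially by auto
    moreover have "L2 (F n)" using that by (intro L2I_bound)
    ultimately show "\<exists>g. L2 g \<and> Q g \<and> L2norm (\<lambda>x. h x - g x) < e"
      using that(1) L2norm_minus_commute by metis
  qed
  define BM where "BM h \<longleftrightarrow> h \<in> borel_measurable borel \<and> (\<exists>C. \<forall>x. cmod (h x) \<le> C)" for h :: "real^'n \<Rightarrow> complex"
  \<comment> \<open>\<open>K\<close> is linear and closed under bounded limits, but not obviously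
    under products. Its multipliers \<open>T\<close> form an algebra, and since the constant 1 lies
    in \<open>K\<close>, membership in \<open>T\<close> implies membership in
    \<open>K\<close>.\<close>
  define K where "K k \<longleftrightarrow> BM k \<and> (\<forall>\<xi>. Q (\<lambda>x. wave \<xi> x * k x))" for k
  define T where "T h \<longleftrightarrow> BM h \<and> (\<forall>k. K k \<longrightarrow> K (\<lambda>x. h x * k x))" for h
  have BM_mult: "BM (\<lambda>x. h x * k x)" if "BM h" "BM k" for h k
  proof -
    obtain C D where "\<forall>x. cmod (h x) \<le> C" "\<forall>x. cmod (k x) \<le> D" using \<open>BM h\<close> \<open>BM k\<close> by (auto simp: BM_def)
    then have "cmod (h x * k x) \<le> C * D" for x
      unfolding norm_mult by (meson mult_mono norm_ge_zero order_trans)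
    then show ?thesis using that by (auto simp: BM_def)
  qed
  have BM_lin: "BM (\<lambda>x. a * h x + b * k x)" if "BM h" "BM k" for h k a b
  proof -
    obtain C D where CD: "\<forall>x. cmod (h x) \<le> C" "\<forall>x. cmod (k x) \<le> D" using \<open>BM h\<close> \<open>BM k\<close> by (auto simp: BM_def)
    have "cmod (a * h x + b * k x) \<le> cmod a * C + cmod b * D" for x
      using CD by (intro norm_triangle_mono) (simp_all add: norm_mult mult_left_mono)
    then show ?thesis using that by (auto simp: BM_def)
  qed
  have L2_BM: "L2 (\<lambda>x. wave \<xi> x * k x)" if k: "BM k" for \<xi> k
  proof -
    note [measurable] = L2_measurable[OF L2_wave]
    obtain C where "\<forall>x. cmod (k x) \<le> C" using k by (auto simp: BM_def)
    then have "cmod (wave \<xi> x * k x) \<le> (exp (1/2) * C) * decay x" for x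
      using mult_mono[OF cmod_wave_le[of \<xi> x], of "cmod (k x)" C] by (simp add: norm_mult mult_ac)
    then show ?thesis using k by (intro L2_decay) (auto simp: BM_def)
  qed
  have K_lim: "K k" if k: "\<And>n. K (k' n)" "\<And>n x. cmod (k' n x) \<le> C" "\<And>x. (\<lambda>n. k' n x) \<longlonglongrightarrow> k x" for k k' C
  proof -
    have m: "k' n \<in> borel_measurable borel" for n using k(1) by (simp add: K_def BM_def)
    have mk: "k \<in> borel_measurable borel" by (rule borel_measurable_LIMSEQ_metric[OF m k(3)])
    have bk: "cmod (k x) \<le> C" for x
      using k(2) by (intro LIMSEQ_le_const2[OF tendsto_norm[OF k(3)]]) auto
    show ?thesis unfolding K_def
    proof (intro conjI allI)
      show "BM k" using mk bk by (auto simp: BM_def)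
      fix \<xi>
      note [measurable] = L2_measurable[OF L2_wave] m mk
      show "Q (\<lambda>x. wave \<xi> x * k x)"
      proof (rule limQ)
        show "Q (\<lambda>x. wave \<xi> x * k' n x)" for n using k(1) by (simp add: K_def)
        show "integrable lborel (\<lambda>x::real^'n. ((exp (1/2) * C) * decay x)\<^sup>2)" by (rule integrable_decay_sq)
        show "cmod (wave \<xi> x * k' n x) \<le> exp (1/2) * C * decay x" for n x
          using mult_mono[OF cmod_wave_le[of \<xi> x] k(2)[of n x]] by (simp add: norm_mult mult_ac)
        show "(\<lambda>n. wave \<xi> x * k' n x) \<longlonglongrightarrow> wave \<xi> x * k x" for x
          by (intro tendsto_intros k(3))
      qed measurable
    qed
  qed
  have K_lin: "K (\<lambda>x. a * k x + b * l x)" if "K k" "K l" for a b k l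
  proof -
    have "Q (\<lambda>x. a * (wave \<xi> x * k x) + b * (wave \<xi> x * l x))" for \<xi>
      using that by (intro lin L2_BM) (auto simp: K_def)
    then show ?thesis using that BM_lin by (simp add: K_def algebra_simps)
  qed
  have T_mult: "T (\<lambda>x. h x * k x)" if "T h" "T k" for h k
    using that BM_mult by (simp add: T_def mult.assoc)
  have T_lin: "T (\<lambda>x. a * h x + b * k x)" if "T h" "T k" for h k a b
  proof -
    have "K (\<lambda>x. a * (h x * l x) + b * (k x * l x))" if "K l" for l
      using that \<open>T h\<close> \<open>T k\<close> by (intro K_lin) (auto simp: T_def)
    then show ?thesis using that BM_lin by (simp add: T_def algebra_simps)
  qed
  have T_one: "T (\<lambda>_. 1)" by (auto simp: T_def BM_def)
  have T_const: "T (\<lambda>_. c)" for c using T_lin[OF T_one T_one, of c 0] by simp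
  have T_add: "T (\<lambda>x. h x + k x)" if "T h" "T k" for h k using T_lin[OF that, of 1 1] by simp
  have T_lim: "T h" if h: "\<And>n. T (h' n)" "\<And>n x. cmod (h' n x) \<le> C" "\<And>x. (\<lambda>n. h' n x) \<longlonglongrightarrow> h x" for h h' C
  proof -
    have m: "h' n \<in> borel_measurable borel" for n using h(1) by (simp add: T_def BM_def)
    have "h \<in> borel_measurable borel" by (rule borel_measurable_LIMSEQ_metric[OF m h(3)])
    moreover have "cmod (h x) \<le> C" for x
      using h(2) by (intro LIMSEQ_le_const2[OF tendsto_norm[OF h(3)]]) auto
    ultimately have "BM h" by (auto simp: BM_def)
    moreover have "K (\<lambda>x. h x * k x)" if k: "K k" for k
    proof -
      obtain D where D: "\<forall>x. cmod (k x) \<le> D" using k by (auto simp: K_def BM_def)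
      show ?thesis
      proof (rule K_lim)
        show "K (\<lambda>x. h' n x * k x)" for n using h(1) k by (simp add: T_def)
        show "cmod (h' n x * k x) \<le> C * D" for n x
          unfolding norm_mult using D h(2) by (meson mult_mono norm_ge_zero order_trans)
        show "(\<lambda>n. h' n x * k x) \<longlonglongrightarrow> h x * k x" for x by (intro tendsto_intros h(3))
      qed
    qed
    ultimately show ?thesis by (simp add: T_def)
  qed
  have T_char: "T (\<lambda>x. exp (\<i> * of_real (\<eta> \<bullet> x)))" for \<eta>
  proof -
    have "BM (\<lambda>x. exp (\<i> * of_real (\<eta> \<bullet> x)))" unfolding BM_def
      by (auto intro!: exI[of _ 1] borel_measurable_continuous_onI continuous_intros)
    moreover have "K (\<lambda>x. exp (\<i> * of_real (\<eta> \<bullet> x)) * k x)" if "K k" for k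
    proof -
      have "Q (\<lambda>x. wave (\<xi> + \<eta>) x * k x)" for \<xi> using that by (simp add: K_def)
      then show ?thesis using that BM_mult calculation by (simp add: K_def wave_add mult.assoc)
    qed
    ultimately show ?thesis by (simp add: T_def)
  qed
  \<comment> \<open>A bounded stand-in for the coordinate, built from two characters. For e = 0 both
    sides are 0, the value of division by zero.\<close>
  have T_sin: "T (\<lambda>x. of_real (sin (e * x $ j) / e))" for e :: real and j
  proof -
    have "T (\<lambda>x. (1 / (2 * \<i> * of_real e)) * exp (\<i> * of_real (axis j e \<bullet> x))
        + (- 1 / (2 * \<i> * of_real e)) * exp (\<i> * of_real (axis j (- e) \<bullet> x)))"
      by (rule T_lin[OF T_char T_char])
    also have "(\<lambda>x. (1 / (2 * \<i> * of_real e)) * exp (\<i> * of_real (axis j e \<bullet> x))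
        + (- 1 / (2 * \<i> * of_real e)) * exp (\<i> * of_real (axis j (- e) \<bullet> x))) = (\<lambda>x. of_real (sin (e * x $ j) / e))"
      by (rule ext) (simp add: inner_axis' sin_exp_eq flip: sin_of_real; simp add: divide_simps; simp add: algebra_simps)
    finally show ?thesis .
  qed
  have T_poly: "T (\<lambda>x. of_real (p (u x)))" if "real_polynomial_function p" and u: "T (\<lambda>x. of_real (u x))"
    for p :: "real \<Rightarrow> real" and u
    using that(1)
  proof induction
    case (linear p)
    then have "p (u x) = p 1 * u x" for x
      using linear_simps(5)[OF linear, of "u x" 1] by simp
    then show ?case using T_mult[OF T_const u] by simp
  next
    case (const c) then show ?case by (rule T_const)
  next
    case (add f g) then show ?case using T_add by simp
  next
    case (mult f g) then show ?case using T_mult by simp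
  qed
  have T_F: "T (\<lambda>x. of_real (F (sin (e * x $ j) / e)))" if F: "continuous_on UNIV F" and e: "e > 0"
    for F :: "real \<Rightarrow> real" and e j
  proof -
    \<comment> \<open>The range of sin (e t) / e lies in this compact interval, on which polynomials
      approximate \<open>F\<close> uniformly although \<open>F\<close> lives on the whole
      line.\<close>
    let ?S = "{- 1 / e .. 1 / e}"
    have "\<exists>p. real_polynomial_function p \<and> (\<forall>t\<in>?S. \<bar>F t - p t\<bar> < 1 / real (Suc n))" for n
      by (rule Stone_Weierstrass_real_polynomial_function[of ?S F "1 / real (Suc n)"])
        (use F continuous_on_subset in auto)
    then obtain p where p: "\<And>n. real_polynomial_function (p n)" "\<And>n t. t \<in> ?S \<Longrightarrow> \<bar>F t - p n t\<bar> < 1 / real (Suc n)"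
      by metis
    have "compact (F ` ?S)" using F by (intro compact_continuous_image) (auto intro: continuous_on_subset)
    then obtain C where C: "\<And>t. t \<in> ?S \<Longrightarrow> \<bar>F t\<bar> \<le> C"
      using compact_imp_bounded bounded_iff by (metis image_eqI real_norm_def)
    have S: "sin (e * y) / e \<in> ?S" for y
      using e sin_ge_minus_one[of "e * y"] sin_le_one[of "e * y"] by (auto simp: divide_right_mono divide_simps)
    show ?thesis
    proof (rule T_lim)
      show "T (\<lambda>x. of_real (p n (sin (e * x $ j) / e)))" for n by (rule T_poly[OF p(1) T_sin])
      show "cmod (of_real (p n (sin (e * x $ j) / e))) \<le> C + 1" for n x
      proof -
        have "1 / real (Suc n) \<le> 1" by simp
        then show ?thesis using p(2)[OF S[of "x $ j"], of n] C[OF S[of "x $ j"]] unfolding norm_of_real by linarith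
      qed
      show "(\<lambda>n. complex_of_real (p n (sin (e * x $ j) / e))) \<longlonglongrightarrow> of_real (F (sin (e * x $ j) / e))" for x
      proof (rule tendsto_of_real, rule Lim_null_comparison[THEN Lim_null[THEN iffD2]])
        show "\<forall>\<^sub>F n in sequentially. norm (p n (sin (e * x $ j) / e) - F (sin (e * x $ j) / e)) \<le> 1 / real (Suc n)"
          using p(2)[OF S[of "x $ j"]] by (auto simp: abs_minus_commute less_imp_le)
        show "(\<lambda>n. 1 / real (Suc n)) \<longlonglongrightarrow> 0" by (rule LIMSEQ_Suc[OF lim_1_over_n])
      qed
    qed
  qed
  have T_coord: "T (\<lambda>x. of_real (F (x $ j)))" if F: "continuous_on UNIV F" "\<And>t. \<bar>F t\<bar> \<le> C"
    for F :: "real \<Rightarrow> real" and j C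
  proof (rule T_lim)
    show "T (\<lambda>x. of_real (F (sin (inverse (real (Suc n)) * x $ j) / inverse (real (Suc n)))))" for n
      by (rule T_F[OF F(1)]) simp
    show "cmod (of_real (F (sin (inverse (real (Suc n)) * x $ j) / inverse (real (Suc n))))) \<le> C" for n x
      using F(2) by simp
    show "(\<lambda>n. complex_of_real (F (sin (inverse (real (Suc n)) * x $ j) / inverse (real (Suc n))))) \<longlonglongrightarrow> of_real (F (x $ j))" for x
    proof (intro tendsto_of_real)
      have "((\<lambda>h. sin (h * x $ j)) has_real_derivative (x $ j)) (at 0)"
        by (auto intro!: derivative_eq_intros)
      then have *: "(\<lambda>h. sin (h * x $ j) / h) \<midarrow>0\<rightarrow> x $ j" by (drule_tac DERIV_D) simp
      have "filterlim (\<lambda>n. inverse (real (Suc n))) (at 0) sequentially"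
        unfolding filterlim_at using LIMSEQ_inverse_real_of_nat by auto
      from filterlim_compose[OF * this]
      have "(\<lambda>n. sin (inverse (real (Suc n)) * x $ j) / inverse (real (Suc n))) \<longlonglongrightarrow> x $ j" .
      moreover have "isCont F (x $ j)" using F(1) by (simp add: continuous_on_eq_continuous_at)
      ultimately show "(\<lambda>n. F (sin (inverse (real (Suc n)) * x $ j) / inverse (real (Suc n)))) \<longlonglongrightarrow> F (x $ j)"
        by (rule isCont_tendsto_compose[rotated])
    qed
  qed
  have T_half: "T (indicator {x. x $ j \<le> a})" for j a
  proof (rule T_lim)
    \<comment> \<open>A ramp equal to 1 up to a and, for n > 0, falling to 0 at a + 1/n; being 1 at
      a itself, it converges to the indicator of the closed half space.\<close>
    let ?F = "\<lambda>n t. max 0 (min 1 (1 - real n * (t - a)))"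
    show "T (\<lambda>x. of_real (?F n (x $ j)))" for n
      by (rule T_coord[where C=1]) (auto intro!: continuous_intros)
    show "cmod (of_real (?F n (x $ j))) \<le> 1" for n x by auto
    show "(\<lambda>n. complex_of_real (?F n (x $ j))) \<longlonglongrightarrow> indicator {x. x $ j \<le> a} x" for x
    proof (cases "x $ j \<le> a")
      case True
      then have "?F n (x $ j) = 1" for n by (simp add: mult_nonneg_nonpos)
      then show ?thesis using True by simp
    next
      case False
      then obtain N where N: "1 < real N * (x $ j - a)" using reals_Archimedean3[of "x $ j - a"] by auto
      have "?F n (x $ j) = 0" if "n \<ge> N" for n
      proof -
        have "real N * (x $ j - a) \<le> real n * (x $ j - a)" using that False by (intro mult_right_mono) auto
        then show ?thesis using N by auto
      qed
      then have "\<forall>\<^sub>F n in sequentially. complex_of_real (?F n (x $ j)) = 0"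
        unfolding eventually_sequentially by (metis of_real_0)
      then show ?thesis using False by (simp add: tendsto_eventually)
    qed
  qed
  have T_sets: "T (indicator A)" if "A \<in> sets borel" for A
  proof -
    have "A \<in> sigma_sets UNIV ((\<lambda>(a, i). {x::real^'n. x \<bullet> i \<le> a}) ` (UNIV \<times> Basis))"
      using that unfolding borel_eq_halfspace_le by simp
    then show ?thesis
    proof induction
      case (Basic A)
      then obtain a j where "A = {x. x $ j \<le> a}"
        by (auto simp: Basis_vec_def inner_axis)
      then show ?case using T_half by simp
    next
      case Empty
      then show ?case using T_const[of 0] by (simp add: indicator_def[abs_def])
    next
      case (Compl A)
      then have "T (\<lambda>x. 1 * 1 + (-1) * indicator A x)" by (intro T_lin T_const)
      then show ?case by (rule arg_cong[where f=T, THEN iffD1, rotated]) (auto simp: indicator_def)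
    next
      case (Union A)
      \<comment> \<open>The sets of the union may overlap; the product of the complementary
        indicators takes care of this, and 1 minus it converges boundedly to the indicator of the
        union.\<close>
      have fin: "T (\<lambda>x. \<Prod>i<n. 1 - indicator (A i) x)" for n
      proof (induction n)
        case 0 show ?case by (simp add: T_const)
      next
        case (Suc n)
        have "T (\<lambda>x. 1 * 1 + (-1) * indicator (A n) x)" using Union by (intro T_lin T_const)
        with Suc show ?case using T_mult by simp
      qed
      show ?case
      proof (rule T_lim)
        show "T (\<lambda>x. 1 * 1 + (-1) * (\<Prod>i<n. 1 - indicator (A i) x))" for n by (intro T_lin T_const fin)
        have val: "(\<Prod>i<n. 1 - indicator (A i) x) = (if \<exists>i<n. x \<in> A i then 0 else 1 :: complex)" for n x
        proof (cases "\<exists>i<n. x \<in> A i")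
          case True then show ?thesis by (auto intro!: prod_zero bexI simp: indicator_def)
        qed (auto intro!: prod.neutral)
        show "cmod (1 * 1 + (-1) * (\<Prod>i<n. 1 - indicator (A i) x)) \<le> 1" for n x
          unfolding val by auto
        show "(\<lambda>n. 1 * 1 + (-1) * (\<Prod>i<n. 1 - indicator (A i) x)) \<longlonglongrightarrow> (indicator (\<Union> (range A)) x :: complex)" for x
        proof (cases "\<exists>i. x \<in> A i")
          case True
          then obtain i where "x \<in> A i" by blast
          then have "\<forall>\<^sub>F n in sequentially. 1 * 1 + (-1) * (\<Prod>i<n. 1 - indicator (A i) x) = (1::complex)"
            unfolding val eventually_sequentially by (intro exI[of _ "Suc i"]) auto
          then show ?thesis using True by (simp add: tendsto_eventually indicator_def)
        qed (simp add: val indicator_def)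
      qed
    qed
  qed
  have T_BM': "T h" if h: "BM h" for h
  proof -
    obtain C where C: "\<forall>x. cmod (h x) \<le> C" using h by (auto simp: BM_def)
    have hm: "h \<in> borel_measurable borel" using h by (auto simp: BM_def)
    obtain s where s: "\<And>i. simple_function borel (s i)" "\<And>x. (\<lambda>i. s i x) \<longlonglongrightarrow> h x"
      "\<And>i x. cmod (s i x) \<le> 2 * cmod (h x)"
      using borel_measurable_implies_sequence_metric[OF hm, of 0] by (auto simp: dist_norm)
    show ?thesis
    proof (rule T_lim[OF _ _ s(2)])
      show "cmod (s n x) \<le> 2 * C" for n x using s(3)[of n x] C by (meson mult_left_mono order_trans zero_le_numeral)
      fix n
      have T_sum: "T (\<lambda>x. \<Sum>y\<in>Y. indicator (s n -` {y}) x * y)" if "finite Y" for Y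
        using that
      proof induction
        case empty then show ?case by (simp add: T_const)
      next
        case (insert y Y)
        have "T (indicator (s n -` {y}))"
          using measurable_sets[OF borel_measurable_simple_function[OF s(1)], of "{y}" n] by (intro T_sets) simp
        from T_add[OF T_mult[OF this T_const[of y]] insert.IH] show ?case
          unfolding sum.insert[OF insert.hyps] .
      qed
      have ind: "indicat_real S x *\<^sub>R y = indicator S x * y" for S and x :: "real^'n" and y :: complex
        by (simp add: indicator_def)
      have "s n x = (\<Sum>y\<in>s n ` UNIV. indicator (s n -` {y}) x * y)" for x
        using simple_function_indicator_representation_banach[OF s(1)[of n], unfolded ind space_borel Int_UNIV_right, OF UNIV_I] .
      then have "s n = (\<lambda>x. \<Sum>y\<in>s n ` UNIV. indicator (s n -` {y}) x * y)" by (rule ext)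
      moreover have "T (\<lambda>x. \<Sum>y\<in>s n ` UNIV. indicator (s n -` {y}) x * y)"
        using s(1)[of n] by (intro T_sum) (simp add: simple_function_def)
      ultimately show "T (s n)" by (rule arg_cong[where f=T, THEN iffD2])
    qed
  qed
  \<comment> \<open>\<open>wave 0\<close> has no zeros, so f is \<open>wave 0\<close> times a
    quotient. Truncating the quotient at height n makes it a bounded multiplier, and the products
    stay dominated by |f|.\<close>
  have nz: "wave 0 x \<noteq> 0" for x :: "real^'n" by (simp add: wave_eq)
  define h where "h n x = (if cmod (f x / wave 0 x) \<le> real n then f x / wave 0 x else 0)" for n x
  have hm [measurable]: "h n \<in> borel_measurable borel" for n
    unfolding h_def using L2_measurable[OF assms(1)] L2_measurable[OF L2_wave[of 0]] by measurable
  have Qh: "Q (\<lambda>x. wave 0 x * h n x)" for n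
  proof -
    have "BM (h n)" unfolding BM_def using hm by (auto simp: h_def intro!: exI[of _ "real n"])
    moreover have "K (\<lambda>_. 1)" using wave by (auto simp: K_def BM_def)
    ultimately have "K (\<lambda>x. h n x * 1)" using T_BM' T_def by blast
    then show ?thesis by (simp add: K_def)
  qed
  show ?thesis
  proof (rule limQ[OF Qh])
    show "(\<lambda>x. wave 0 x * h n x) \<in> borel_measurable borel" for n
      using L2_measurable[OF L2_wave[of 0]] by measurable
    show "f \<in> borel_measurable borel" by (rule L2_measurable[OF assms(1)])
    show "integrable lborel (\<lambda>x. (cmod (f x))\<^sup>2)" using assms(1) by (simp add: L2_def)
    show "cmod (wave 0 x * h n x) \<le> cmod (f x)" for n x using nz by (simp add: h_def)
    show "(\<lambda>n. wave 0 x * h n x) \<longlonglongrightarrow> f x" for x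
    proof -
      obtain N where "cmod (f x / wave 0 x) \<le> real N" using real_arch_simple by blast
      then have "\<forall>\<^sub>F n in sequentially. wave 0 x * h n x = f x"
        unfolding eventually_sequentially h_def using nz by (auto intro!: exI[of _ N])
      then show ?thesis by (rule tendsto_eventually)
    qed
  qed
qed

subsection \<open>Isometries, generators and Duhamel's estimate\<close>

definition isom :: "((real^'n \<Rightarrow> complex) \<Rightarrow> real^'n \<Rightarrow> complex) \<Rightarrow> bool" where
  "isom W \<longleftrightarrow> (\<forall>f. L2 f \<longrightarrow> L2 (W f) \<and> L2norm (W f) = L2norm f)
    \<and> (\<forall>f g a b. L2 f \<and> L2 g \<longrightarrow> ae_eq (W (\<lambda>x. a * f x + b * g x)) (\<lambda>x. a * W f x + b * W g x))"

lemma isom_L2: "isom W \<Longrightarrow> L2 f \<Longrightarrow> L2 (W f)"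
  by (simp add: isom_def)

lemma isom_lincomb:
  "isom W \<Longrightarrow> L2 f \<Longrightarrow> L2 g \<Longrightarrow> ae_eq (W (\<lambda>x. a * f x + b * g x)) (\<lambda>x. a * W f x + b * W g x)"
  by (simp add: isom_def)

lemma isom_norm_lincomb:
  assumes "isom W" "L2 f" "L2 g"
  shows "L2norm (\<lambda>x. a * W f x + b * W g x) = L2norm (\<lambda>x. a * f x + b * g x)"
proof -
  have "ae_eq (W (\<lambda>x. a * f x + b * g x)) (\<lambda>x. a * W f x + b * W g x)"
    by (rule isom_lincomb[OF assms])
  then have "L2norm (W (\<lambda>x. a * f x + b * g x)) = L2norm (\<lambda>x. a * W f x + b * W g x)"
    by (rule L2norm_cong_ae) (intro isom_L2[OF assms(1)] L2_add L2_cmult assms)+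
  moreover have "L2norm (W (\<lambda>x. a * f x + b * g x)) = L2norm (\<lambda>x. a * f x + b * g x)"
    using assms by (simp add: isom_def L2_add L2_cmult)
  ultimately show ?thesis by simp
qed

lemma isom_norm_diff: "isom W \<Longrightarrow> L2 f \<Longrightarrow> L2 g \<Longrightarrow> L2norm (\<lambda>x. W f x - W g x) = L2norm (\<lambda>x. f x - g x)"
  using isom_norm_lincomb[of W f g 1 "-1"] by simp

text \<open>W is linear only up to null sets, so V must respect almost everywhere equality. It does,
  because it preserves norms of differences: two functions at distance 0 have images at distance
  0.\<close>

lemma isom_comp:
  fixes V W :: "(real^'n \<Rightarrow> complex) \<Rightarrow> real^'n \<Rightarrow> complex"
  assumes "isom V" "isom W" shows "isom (\<lambda>f. V (W f))"
  unfolding isom_def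
proof (intro conjI allI impI)
  fix f :: "real^'n \<Rightarrow> complex" assume "L2 f"
  then show "L2 (V (W f))" "L2norm (V (W f)) = L2norm f" using assms by (auto simp: isom_def)
next
  fix f g :: "real^'n \<Rightarrow> complex" and a b assume *: "L2 f \<and> L2 g"
  let ?w = "W (\<lambda>x. a * f x + b * g x)"
  have L: "L2 f" "L2 g" "L2 (W f)" "L2 (W g)" "L2 ?w"
    using * by (auto intro!: isom_L2[OF assms(2)])
  have "ae_eq ?w (\<lambda>x. a * W f x + b * W g x)" by (rule isom_lincomb[OF assms(2) L(1,2)])
  then have "L2norm (\<lambda>x. ?w x - (a * W f x + b * W g x)) = 0"
    using L2norm_eq_0_iff[OF L(5) L2_add[OF L2_cmult[OF L(3)] L2_cmult[OF L(4)]]] by blast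
  then have "L2norm (\<lambda>x. V ?w x - V (\<lambda>x. a * W f x + b * W g x) x) = 0"
    using isom_norm_diff[OF assms(1) L(5) L2_add[OF L2_cmult[OF L(3)] L2_cmult[OF L(4)]]] by simp
  then have "ae_eq (V ?w) (V (\<lambda>x. a * W f x + b * W g x))"
    by (subst (asm) L2norm_eq_0_iff) (intro isom_L2[OF assms(1)] L2_add L2_cmult L)+
  moreover have "ae_eq (V (\<lambda>x. a * W f x + b * W g x)) (\<lambda>x. a * V (W f) x + b * V (W g) x)"
    by (rule isom_lincomb[OF assms(1) L(3,4)])
  ultimately show "ae_eq (V ?w) (\<lambda>x. a * V (W f) x + b * V (W g) x)"
    unfolding ae_eq_def by eventually_elim simp
qed

section \<open>Unitary groups and their generators\<close>

lemma unitary_group_zero: "unitary_group U \<Longrightarrow> L2 f \<Longrightarrow> ae_eq (U 0 f) f"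
  by (simp add: unitary_group_def)

lemma unitary_group_add: "unitary_group U \<Longrightarrow> L2 f \<Longrightarrow> ae_eq (U (s + t) f) (U s (U t f))"
  by (simp add: unitary_group_def)

lemma unitary_group_isom: "unitary_group U \<Longrightarrow> isom (U t)"
  by (simp add: unitary_group_def isom_def)

definition has_gen :: "(real \<Rightarrow> (real^'n \<Rightarrow> complex) \<Rightarrow> real^'n \<Rightarrow> complex) \<Rightarrow> (real^'n \<Rightarrow> complex) \<Rightarrow> (real^'n \<Rightarrow> complex) \<Rightarrow> bool" where
  "has_gen U \<phi> \<psi> \<longleftrightarrow> L2 \<phi> \<and> L2 \<psi>
    \<and> ((\<lambda>h. L2norm (\<lambda>x. (U h \<phi> x - \<phi> x) / of_real h - \<psi> x)) \<longlongrightarrow> 0) (at 0)"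

lemma has_gen_diff:
  assumes U: "unitary_group U" and 1: "has_gen U \<phi> \<psi>" and 2: "has_gen U \<phi>' \<psi>'"
  shows "has_gen U (\<lambda>x. \<phi> x - \<phi>' x) (\<lambda>x. \<psi> x - \<psi>' x)"
proof -
  have L: "L2 \<phi>" "L2 \<psi>" "L2 \<phi>'" "L2 \<psi>'" using 1 2 by (auto simp: has_gen_def)
  have iso: "isom (U h)" for h by (rule unitary_group_isom[OF U])
  have LU: "L2 (U h f)" if "L2 f" for h f by (rule isom_L2[OF iso that])
  let ?D = "\<lambda>h \<phi> \<psi> x. (U h \<phi> x - \<phi> x) / of_real h - \<psi> x"
  let ?d = "\<lambda>x. \<phi> x - \<phi>' x"
  have LD: "L2 (?D h f g)" if "L2 f" "L2 g" for h f g using that by (intro L2_diff L2_divide LU)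
  have le: "L2norm (?D h ?d (\<lambda>x. \<psi> x - \<psi>' x)) \<le> L2norm (?D h \<phi> \<psi>) + L2norm (?D h \<phi>' \<psi>')" for h
  proof -
    have "ae_eq (U h (\<lambda>x. 1 * \<phi> x + (-1) * \<phi>' x)) (\<lambda>x. 1 * U h \<phi> x + (-1) * U h \<phi>' x)"
      by (rule isom_lincomb[OF iso L(1,3)])
    then have "ae_eq (?D h ?d (\<lambda>x. \<psi> x - \<psi>' x)) (\<lambda>x. ?D h \<phi> \<psi> x + (-1) * ?D h \<phi>' \<psi>' x)"
      unfolding ae_eq_def by eventually_elim (simp add: diff_divide_distrib)
    then have "L2norm (?D h ?d (\<lambda>x. \<psi> x - \<psi>' x)) = L2norm (\<lambda>x. ?D h \<phi> \<psi> x + (-1) * ?D h \<phi>' \<psi>' x)"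
      by (rule L2norm_cong_ae) (intro LD L L2_diff L2_add L2_cmult)+
    also have "\<dots> \<le> L2norm (?D h \<phi> \<psi>) + L2norm (\<lambda>x. (-1) * ?D h \<phi>' \<psi>' x)"
      by (intro L2norm_triangle LD L L2_cmult)
    finally show ?thesis unfolding L2norm_cmult by simp
  qed
  have "((\<lambda>h. L2norm (?D h \<phi> \<psi>) + L2norm (?D h \<phi>' \<psi>')) \<longlongrightarrow> 0 + 0) (at 0)"
    using 1 2 unfolding has_gen_def by (intro tendsto_add) auto
  then have lim: "((\<lambda>h. L2norm (?D h \<phi> \<psi>) + L2norm (?D h \<phi>' \<psi>')) \<longlongrightarrow> 0) (at 0)"
    unfolding add_0_left .
  have lim': "((\<lambda>h. L2norm (?D h ?d (\<lambda>x. \<psi> x - \<psi>' x))) \<longlongrightarrow> 0) (at 0)"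
    by (rule tendsto_sandwich[OF _ _ tendsto_const lim])
      (intro always_eventually allI L2norm_nonneg le)+
  have "L2 ?d" "L2 (\<lambda>x. \<psi> x - \<psi>' x)" by (rule L2_diff[OF L(1,3)], rule L2_diff[OF L(2,4)])
  from conjI[OF this(1) conjI[OF this(2) lim']] show ?thesis by (rule has_gen_def[THEN iffD2])
qed

text \<open>The derivative of t \<mapsto> U (-t) \<phi>(t) is U (-t) (\<phi>'(t) - \<psi>(t)); the mean value inequality
  is applied to the distance of \<phi>(t) from the true evolution.\<close>

lemma duhamel:
  assumes U: "unitary_group U"
    and L: "\<And>t. L2 (\<phi> t)"
    and gen: "\<And>t. has_gen U (\<phi> t) (\<psi> t)"
    and L': "\<And>t. L2 (\<phi>' t)"
    and der: "\<And>t. ((\<lambda>h. L2norm (\<lambda>x. (\<phi> (t + h) x - \<phi> t x) / of_real h - \<phi>' t x)) \<longlongrightarrow> 0) (at 0)"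
    and K: "\<And>t. t \<in> closed_segment 0 T \<Longrightarrow> L2norm (\<lambda>x. \<phi>' t x - \<psi> t x) \<le> K"
  shows "L2norm (\<lambda>x. U T (\<phi> 0) x - \<phi> T x) \<le> K * \<bar>T\<bar>"
proof -
  define N where "N t = L2norm (\<lambda>x. U t (\<phi> 0) x - \<phi> t x)" for t
  have iso: "isom (U h)" for h by (rule unitary_group_isom[OF U])
  have LU: "L2 (U h f)" if "L2 f" for h f by (rule isom_L2[OF iso that])
  have L\<psi>: "L2 (\<psi> t)" for t using gen by (auto simp: has_gen_def)
  have N0: "N 0 = 0"
    unfolding N_def L2norm_eq_0_iff[OF LU[OF L] L] by (rule unitary_group_zero[OF U L])
  \<comment> \<open>Since \<open>U h\<close> is an isometry, \<open>N t\<close> is also the distance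
    from U h (U t (\<phi> 0)) to U h (\<phi> t); the reverse triangle inequality then compares
    \<open>N (t + h)\<close> with \<open>N t\<close>.\<close>
  have step: "\<bar>N (t + h) - N t\<bar> \<le> L2norm (\<lambda>x. U h (\<phi> t) x - \<phi> (t + h) x)" for t h
  proof -
    have "ae_eq (U (h + t) (\<phi> 0)) (U h (U t (\<phi> 0)))" by (rule unitary_group_add[OF U L])
    then have "ae_eq (\<lambda>x. (U (t + h) (\<phi> 0) x - \<phi> (t + h) x) - (U h (U t (\<phi> 0)) x - U h (\<phi> t) x))
        (\<lambda>x. U h (\<phi> t) x - \<phi> (t + h) x)"
      unfolding ae_eq_def add.commute[of h t] by eventually_elim simp
    then have "L2norm (\<lambda>x. (U (t + h) (\<phi> 0) x - \<phi> (t + h) x) - (U h (U t (\<phi> 0)) x - U h (\<phi> t) x))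
        = L2norm (\<lambda>x. U h (\<phi> t) x - \<phi> (t + h) x)"
      by (rule L2norm_cong_ae) (intro L2_diff LU L)+
    moreover have "N t = L2norm (\<lambda>x. U h (U t (\<phi> 0)) x - U h (\<phi> t) x)"
      unfolding N_def by (rule isom_norm_diff[symmetric]) (intro iso LU L)+
    ultimately show ?thesis
      using L2norm_diff_ge[of "\<lambda>x. U (t + h) (\<phi> 0) x - \<phi> (t + h) x" "\<lambda>x. U h (U t (\<phi> 0)) x - U h (\<phi> t) x"]
      by (simp add: N_def L2_diff LU L)
  qed
  have loc: "\<exists>d>0. \<forall>h. \<bar>h\<bar> < d \<longrightarrow> \<bar>N (t + h) - N t\<bar> \<le> (K + e) * \<bar>h\<bar>"
    if e: "e > 0" and t: "t \<in> closed_segment 0 T" for e t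
  proof -
    let ?p = "\<lambda>h x. (U h (\<phi> t) x - \<phi> t x) / of_real h - \<psi> t x"
    let ?q = "\<lambda>h x. (\<phi> (t + h) x - \<phi> t x) / of_real h - \<phi>' t x"
    have "((\<lambda>h. L2norm (?p h) + L2norm (?q h)) \<longlongrightarrow> 0 + 0) (at 0)"
      using gen[of t] der[of t] unfolding has_gen_def by (intro tendsto_add) auto
    then have "\<forall>\<^sub>F h in at 0. L2norm (?p h) + L2norm (?q h) < e"
      using e by (intro order_tendstoD) auto
    then obtain d where d: "d > 0" "\<And>h. h \<noteq> 0 \<Longrightarrow> \<bar>h\<bar> < d \<Longrightarrow> L2norm (?p h) + L2norm (?q h) < e"
      unfolding eventually_at by (auto simp: dist_real_def)
    have "\<bar>N (t + h) - N t\<bar> \<le> (K + e) * \<bar>h\<bar>" if h: "\<bar>h\<bar> < d" for h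
    proof (cases "h = 0")
      case False
      have Lp: "L2 (?p h)" and Lq: "L2 (?q h)" by (intro L2_diff L2_divide LU L L\<psi> L')+
      have "L2norm (\<lambda>x. U h (\<phi> t) x - \<phi> (t + h) x) = L2norm (\<lambda>x. of_real h * ((?p h x - ?q h x) + -1 * (\<phi>' t x - \<psi> t x)))"
        using False by (simp add: algebra_simps diff_divide_distrib)
      also have "\<dots> = \<bar>h\<bar> * L2norm (\<lambda>x. (?p h x - ?q h x) + -1 * (\<phi>' t x - \<psi> t x))"
        unfolding L2norm_cmult by simp
      also have "\<dots> \<le> \<bar>h\<bar> * (L2norm (\<lambda>x. ?p h x - ?q h x) + L2norm (\<lambda>x. -1 * (\<phi>' t x - \<psi> t x)))"
        by (intro mult_left_mono L2norm_triangle L2_diff L2_cmult Lp Lq L' L\<psi>) auto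
      also have "\<dots> \<le> \<bar>h\<bar> * (e + K)"
      proof (intro mult_left_mono add_mono)
        have "L2norm (\<lambda>x. ?p h x - ?q h x) = L2norm (\<lambda>x. ?p h x + -1 * ?q h x)"
          by (intro arg_cong[where f=L2norm] ext) simp
        also have "\<dots> \<le> L2norm (?p h) + L2norm (\<lambda>x. -1 * ?q h x)"
          by (intro L2norm_triangle Lp L2_cmult Lq)
        also have "\<dots> \<le> e" unfolding L2norm_cmult using d(2)[OF False h] by simp
        finally show "L2norm (\<lambda>x. ?p h x - ?q h x) \<le> e" .
        show "L2norm (\<lambda>x. -1 * (\<phi>' t x - \<psi> t x)) \<le> K" unfolding L2norm_cmult using K[OF t] by simp
      qed auto
      finally show ?thesis using step[of t h] by (simp add: algebra_simps)
    qed simp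
    with d(1) show ?thesis by blast
  qed
  have "N T \<le> K * \<bar>T\<bar> + e" if e: "e > 0" for e
  proof -
    \<comment> \<open>The slack e is spread over an interval of length |T|; the summand 1 covers T =
      0.\<close>
    define r where "r = e / (\<bar>T\<bar> + 1)"
    have r: "r > 0" using e by (simp add: r_def add_nonneg_pos)
    \<comment> \<open>The estimate adds up over adjacent intervals and holds on all short intervals
      around each point, so bisection yields it on the whole interval without differentiating
      \<open>N\<close>. Using \<open>min\<close> and \<open>max\<close> covers negative T.\<close>
    have "min 0 T \<le> max 0 T" by simp
    then have "\<bar>N (max 0 T) - N (min 0 T)\<bar> \<le> (K + r) * (max 0 T - min 0 T)"
    proof (induction rule: Bolzano)
      case (trans a b c) then show ?case by (simp add: algebra_simps)
    next
      case (local x)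
      then have "x \<in> closed_segment 0 T" by (auto simp: closed_segment_eq_real_ivl min_def max_def split: if_splits)
      from loc[OF r this]
      obtain d where d: "d > 0" "\<And>h. \<bar>h\<bar> < d \<Longrightarrow> \<bar>N (x + h) - N x\<bar> \<le> (K + r) * \<bar>h\<bar>" by blast
      have "\<bar>N b - N a\<bar> \<le> (K + r) * (b - a)" if "a \<le> x" "x \<le> b" "b - a < d" for a b
        using d(2)[of "b - x"] d(2)[of "a - x"] that by (simp add: algebra_simps)
      with d(1) show ?case by blast
    qed
    then have "N T \<le> (K + r) * \<bar>T\<bar>"
      using N0 by (auto simp: min_def max_def split: if_splits)
    also have "\<dots> = K * \<bar>T\<bar> + e * (\<bar>T\<bar> / (\<bar>T\<bar> + 1))" by (simp add: r_def algebra_simps)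
    also have "e * (\<bar>T\<bar> / (\<bar>T\<bar> + 1)) \<le> e * 1" using e by (intro mult_left_mono) auto
    finally show ?thesis by simp
  qed
  then show ?thesis unfolding N_def by (rule field_le_epsilon)
qed

text \<open>Duhamel's estimate for the constant curve \<phi>, whose defect is - \<psi>. It bounds
  the difference quotients uniformly in h, which the closure argument below relies on.\<close>

lemma has_gen_bound:
  assumes U: "unitary_group U" and g: "has_gen U \<phi> \<psi>"
  shows "L2norm (\<lambda>x. U h \<phi> x - \<phi> x) \<le> L2norm \<psi> * \<bar>h\<bar>"
proof (rule duhamel[OF U, where \<phi>="\<lambda>_. \<phi>" and \<psi>="\<lambda>_. \<psi>" and \<phi>'="\<lambda>_ _. 0"])
  show "L2norm (\<lambda>x. 0 - \<psi> x) \<le> L2norm \<psi>" using L2norm_minus_commute[of "\<lambda>_. 0" \<psi>] by simp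
  show "L2 \<phi>" using g by (simp add: has_gen_def)
  show "L2 (\<lambda>_. 0 :: complex)" by (simp add: L2_def)
  show "((\<lambda>h. L2norm (\<lambda>x. (\<phi> x - \<phi> x) / complex_of_real h - 0)) \<longlongrightarrow> 0) (at 0)"
    by (simp add: L2norm_def)
qed (rule g)

text \<open>Exchanging the limits in n and h requires uniformity in h. \<open>has_gen_bound\<close>,
  applied to differences of the approximants, supplies it: the difference quotients of \<phi>s m and
  \<phi>s n are no further apart than \<psi>s m and \<psi>s n.\<close>

lemma has_gen_closure:
  assumes U: "unitary_group U" and g: "\<And>n. has_gen U (\<phi>s n) (\<psi>s n)" and L: "L2 \<phi>" "L2 \<psi>"
    and lim: "(\<lambda>n. L2norm (\<lambda>x. \<phi>s n x - \<phi> x)) \<longlonglongrightarrow> 0" "(\<lambda>n. L2norm (\<lambda>x. \<psi>s n x - \<psi> x)) \<longlonglongrightarrow> 0"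
  shows "has_gen U \<phi> \<psi>"
proof -
  have iso: "isom (U h)" for h by (rule unitary_group_isom[OF U])
  have LU: "L2 (U h f)" if "L2 f" for h f by (rule isom_L2[OF iso that])
  have Ls: "L2 (\<phi>s n)" "L2 (\<psi>s n)" for n using g by (auto simp: has_gen_def)
  let ?D = "\<lambda>h f x. U h f x - f x"
  have D2: "L2norm (\<lambda>x. ?D h f x - ?D h g x) \<le> 2 * L2norm (\<lambda>x. f x - g x)" if "L2 f" "L2 g" for h f g
  proof -
    have "L2norm (\<lambda>x. ?D h f x - ?D h g x) = L2norm (\<lambda>x. (U h f x - U h g x) + -1 * (f x - g x))"
      by (simp add: algebra_simps)
    also have "\<dots> \<le> L2norm (\<lambda>x. U h f x - U h g x) + L2norm (\<lambda>x. -1 * (f x - g x))"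
      using that by (intro L2norm_triangle L2_diff L2_cmult LU)
    finally show ?thesis unfolding L2norm_cmult using isom_norm_diff[OF iso that, of h] by simp
  qed
  have Dmn: "L2norm (\<lambda>x. ?D h (\<phi>s m) x - ?D h (\<phi>s n) x) \<le> L2norm (\<lambda>x. \<psi>s m x - \<psi>s n x) * \<bar>h\<bar>" for h m n
  proof -
    have "ae_eq (U h (\<lambda>x. 1 * \<phi>s m x + (-1) * \<phi>s n x)) (\<lambda>x. 1 * U h (\<phi>s m) x + (-1) * U h (\<phi>s n) x)"
      by (rule isom_lincomb[OF iso Ls(1) Ls(1)])
    then have "ae_eq (\<lambda>x. ?D h (\<phi>s m) x - ?D h (\<phi>s n) x) (?D h (\<lambda>x. \<phi>s m x - \<phi>s n x))"
      unfolding ae_eq_def by eventually_elim simp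
    then have "L2norm (\<lambda>x. ?D h (\<phi>s m) x - ?D h (\<phi>s n) x) = L2norm (?D h (\<lambda>x. \<phi>s m x - \<phi>s n x))"
      by (rule L2norm_cong_ae) (intro L2_diff LU Ls)+
    then show ?thesis using has_gen_bound[OF U has_gen_diff[OF U g g], of h m n] by simp
  qed
  \<comment> \<open>For fixed h, m tends to infinity in \<open>Dmn\<close>. The cost of replacing
    \<phi> by \<phi>s m, twice their distance, is not divided by h and disappears in this
    limit.\<close>
  have Dn: "L2norm (\<lambda>x. ?D h \<phi> x - ?D h (\<phi>s n) x) \<le> L2norm (\<lambda>x. \<psi>s n x - \<psi> x) * \<bar>h\<bar>" for h n
  proof (rule LIMSEQ_le_const)
    have "(\<lambda>m. (L2norm (\<lambda>x. \<psi>s n x - \<psi> x) + L2norm (\<lambda>x. \<psi>s m x - \<psi> x)) * \<bar>h\<bar> + 2 * L2norm (\<lambda>x. \<phi>s m x - \<phi> x))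
        \<longlonglongrightarrow> (L2norm (\<lambda>x. \<psi>s n x - \<psi> x) + 0) * \<bar>h\<bar> + 2 * 0"
      by (intro tendsto_intros lim)
    then show "(\<lambda>m. (L2norm (\<lambda>x. \<psi>s n x - \<psi> x) + L2norm (\<lambda>x. \<psi>s m x - \<psi> x)) * \<bar>h\<bar> + 2 * L2norm (\<lambda>x. \<phi>s m x - \<phi> x))
        \<longlonglongrightarrow> L2norm (\<lambda>x. \<psi>s n x - \<psi> x) * \<bar>h\<bar>" by simp
    have "L2norm (\<lambda>x. ?D h \<phi> x - ?D h (\<phi>s n) x)
        \<le> (L2norm (\<lambda>x. \<psi>s n x - \<psi> x) + L2norm (\<lambda>x. \<psi>s m x - \<psi> x)) * \<bar>h\<bar> + 2 * L2norm (\<lambda>x. \<phi>s m x - \<phi> x)" for m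
    proof -
      have "L2norm (\<lambda>x. ?D h \<phi> x - ?D h (\<phi>s n) x)
          \<le> L2norm (\<lambda>x. ?D h \<phi> x - ?D h (\<phi>s m) x) + L2norm (\<lambda>x. ?D h (\<phi>s m) x - ?D h (\<phi>s n) x)"
        by (intro L2norm_triangle3 L2_diff LU L Ls)
      also have "L2norm (\<lambda>x. ?D h \<phi> x - ?D h (\<phi>s m) x) \<le> 2 * L2norm (\<lambda>x. \<phi>s m x - \<phi> x)"
        using D2[OF L(1) Ls(1), of h m] by (simp add: L2norm_minus_commute[of \<phi>])
      also have "L2norm (\<lambda>x. ?D h (\<phi>s m) x - ?D h (\<phi>s n) x) \<le> L2norm (\<lambda>x. \<psi>s m x - \<psi>s n x) * \<bar>h\<bar>" by (rule Dmn)
      also have "\<dots> \<le> (L2norm (\<lambda>x. \<psi>s m x - \<psi> x) + L2norm (\<lambda>x. \<psi> x - \<psi>s n x)) * \<bar>h\<bar>"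
        by (intro mult_right_mono L2norm_triangle3 L Ls) auto
      finally show ?thesis by (simp add: L2norm_minus_commute[of \<psi>] algebra_simps)
    qed
    then show "\<exists>N. \<forall>m\<ge>N. L2norm (\<lambda>x. ?D h \<phi> x - ?D h (\<phi>s n) x)
        \<le> (L2norm (\<lambda>x. \<psi>s n x - \<psi> x) + L2norm (\<lambda>x. \<psi>s m x - \<psi> x)) * \<bar>h\<bar> + 2 * L2norm (\<lambda>x. \<phi>s m x - \<phi> x)" by blast
  qed
  have "((\<lambda>h. L2norm (\<lambda>x. ?D h \<phi> x / of_real h - \<psi> x)) \<longlongrightarrow> 0) (at 0)"
  proof (rule tendstoI)
    fix e :: real assume e: "e > 0"
    have "\<forall>\<^sub>F n in sequentially. L2norm (\<lambda>x. \<psi>s n x - \<psi> x) < e / 3" using e by (intro order_tendstoD[OF lim(2)]) auto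
    then obtain n where n: "L2norm (\<lambda>x. \<psi>s n x - \<psi> x) < e / 3" unfolding eventually_sequentially by auto
    have "\<forall>\<^sub>F h in at 0. L2norm (\<lambda>x. ?D h (\<phi>s n) x / of_real h - \<psi>s n x) < e / 3"
      using g[of n] e unfolding has_gen_def by (intro order_tendstoD) auto
    moreover have "\<forall>\<^sub>F h in at (0::real). h \<noteq> 0" by (simp add: eventually_at_filter)
    ultimately show "\<forall>\<^sub>F h in at 0. dist (L2norm (\<lambda>x. ?D h \<phi> x / of_real h - \<psi> x)) 0 < e"
    proof eventually_elim
      case (elim h)
      have "L2norm (\<lambda>x. ?D h \<phi> x / of_real h - \<psi> x)
          \<le> L2norm (\<lambda>x. ?D h \<phi> x / of_real h - ?D h (\<phi>s n) x / of_real h) + L2norm (\<lambda>x. ?D h (\<phi>s n) x / of_real h - \<psi> x)"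
        by (intro L2norm_triangle3 L2_diff L2_divide LU L Ls)
      also have "L2norm (\<lambda>x. ?D h (\<phi>s n) x / of_real h - \<psi> x)
          \<le> L2norm (\<lambda>x. ?D h (\<phi>s n) x / of_real h - \<psi>s n x) + L2norm (\<lambda>x. \<psi>s n x - \<psi> x)"
        by (intro L2norm_triangle3 L2_diff L2_divide LU L Ls)
      also have "L2norm (\<lambda>x. ?D h \<phi> x / of_real h - ?D h (\<phi>s n) x / of_real h) = L2norm (\<lambda>x. ?D h \<phi> x - ?D h (\<phi>s n) x) / \<bar>h\<bar>"
        unfolding diff_divide_distrib[symmetric] L2norm_divide by simp
      also have "\<dots> \<le> L2norm (\<lambda>x. \<psi>s n x - \<psi> x)" using Dn[of h n] elim(2) by (simp add: divide_simps)
      finally show ?case using n elim(1) by simp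
    qed
  qed
  then show ?thesis using L by (simp add: has_gen_def)
qed

subsection \<open>Cutting off Gaussians\<close>

text \<open>The powers 1 / t^m are part of the family because differentiating exp (- 1 / t) creates
  them; with them it is closed under derivatives up to linear combinations.\<close>

definition flat :: "nat \<Rightarrow> real \<Rightarrow> real" where
  "flat m t = (if t > 0 then exp (- 1 / t) / t ^ m else 0)"

lemma flat_nonneg: "0 \<le> flat m t"
  by (simp add: flat_def)

text \<open>Keeping only the m-th term of the exponential series gives (1 / t)^m / m! <= exp (1 /
  t).\<close>

lemma flat_le_fact: "flat m t \<le> fact m"
proof (cases "t > 0")
  case True
  have "(\<Sum>n\<in>{m}. (1 / t) ^ n /\<^sub>R fact n) \<le> (\<Sum>n. (1 / t) ^ n /\<^sub>R fact n)"
    using True by (intro sum_le_suminf sums_summable[OF exp_converges]) auto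
  then have "(1 / t) ^ m / fact m \<le> exp (1 / t)"
    unfolding sums_unique[OF exp_converges, symmetric] by (simp add: divide_inverse mult.commute)
  then show ?thesis using True by (simp add: flat_def exp_minus field_simps)
qed (simp add: flat_def)

lemma flat_Suc: "flat m t = t * flat (Suc m) t"
  by (simp add: flat_def)

text \<open>Away from 0 the two branches are differentiated directly. At 0 the difference quotient
  is h times \<open>flat (m + 2) h\<close> for h > 0, and this tends to 0 because
  \<open>flat (m + 2)\<close> is bounded.\<close>

lemma flat_has_real_derivative:
  "(flat m has_real_derivative (flat (m + 2) t - real m * flat (m + 1) t)) (at t)"
proof (cases "t = 0")
  case True
  have "((\<lambda>h. (flat m (0 + h) - flat m 0) / h) \<longlongrightarrow> 0) (at 0)"
  proof (rule Lim_null_comparison)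
    have "norm ((flat m (0 + h) - flat m 0) / h) \<le> fact (m + 2) * \<bar>h\<bar>" for h
    proof (cases "h > 0")
      case True
      have "flat m h = h * h * flat (m + 2) h" using flat_Suc[of m h] flat_Suc[of "Suc m" h] by simp
      then have "(flat m (0 + h) - flat m 0) / h = h * flat (m + 2) h" using True by (simp add: flat_def)
      then show ?thesis
        using True flat_le_fact[of "m + 2" h] flat_nonneg[of "m + 2" h] by (simp add: abs_mult mult.commute mult_right_mono del: fact_Suc)
    qed (simp add: flat_def mult_nonneg_nonpos del: fact_Suc)
    then show "\<forall>\<^sub>F h in at 0. norm ((flat m (0 + h) - flat m 0) / h) \<le> fact (m + 2) * \<bar>h\<bar>" by (simp only: eventually_True)
    have "((\<lambda>h::real. fact (m + 2) * \<bar>h\<bar>) \<longlongrightarrow> fact (m + 2) * \<bar>0\<bar>) (at 0)" by (intro tendsto_intros)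
    then show "((\<lambda>h::real. fact (m + 2) * \<bar>h\<bar>) \<longlongrightarrow> 0) (at 0)" by simp
  qed
  then show ?thesis using True by (simp add: DERIV_def flat_def)
next
  case False
  show ?thesis
  proof (cases "t > 0")
    case True
    have "((\<lambda>t. exp (- 1 / t) / t ^ m) has_real_derivative (flat (m + 2) t - real m * flat (m + 1) t)) (at t)"
    proof (cases m)
      case 0
      show ?thesis unfolding 0 using True
        by (auto intro!: derivative_eq_intros simp: flat_def power2_eq_square)
    next
      case (Suc k)
      show ?thesis unfolding Suc using True
        by (auto intro!: derivative_eq_intros simp: flat_def divide_simps)
          (simp add: algebra_simps power2_eq_square, cases k, auto)
    qed
    then show ?thesis
      by (rule DERIV_cong_ev[THEN iffD1, rotated 3])
        (use True eventually_nhds_in_open[of "{0<..}" t] in \<open>auto simp: flat_def elim: eventually_mono\<close>)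
  next
    case False
    with \<open>t \<noteq> 0\<close> have "t < 0" by simp
    have "((\<lambda>_. 0) has_real_derivative (flat (m + 2) t - real m * flat (m + 1) t)) (at t)"
      using \<open>t < 0\<close> by (simp add: flat_def)
    then show ?thesis
      by (rule DERIV_cong_ev[THEN iffD1, rotated 3])
        (use \<open>t < 0\<close> eventually_nhds_in_open[of "{..<0}" t] in \<open>auto simp: flat_def elim: eventually_mono\<close>)
  qed
qed

lemma continuous_flat: "continuous_on S (flat m)"
  by (meson DERIV_continuous continuous_at_imp_continuous_on flat_has_real_derivative)

text \<open>The generators are chosen such that this algebra is stable under partial derivatives.\<close>

inductive smooth_alg :: "real \<Rightarrow> complex \<Rightarrow> ('n \<Rightarrow> complex) \<Rightarrow> complex \<Rightarrow> (real^'n \<Rightarrow> complex) \<Rightarrow> bool"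
  for r a B c where
  const: "smooth_alg r a B c (\<lambda>_. k)"
| coord: "smooth_alg r a B c (\<lambda>x. of_real (x $ j))"
| flat: "smooth_alg r a B c (\<lambda>x. of_real (flat m (1 - r * (norm x)\<^sup>2)))"
| gauss: "smooth_alg r a B c (gauss a B c)"
| add: "smooth_alg r a B c f \<Longrightarrow> smooth_alg r a B c g \<Longrightarrow> smooth_alg r a B c (\<lambda>x. f x + g x)"
| mult: "smooth_alg r a B c f \<Longrightarrow> smooth_alg r a B c g \<Longrightarrow> smooth_alg r a B c (\<lambda>x. f x * g x)"

lemma norm_sq_add_axis: "(norm (x + t *\<^sub>R axis j 1))\<^sup>2 = (norm x)\<^sup>2 + 2 * t * x $ j + t\<^sup>2"
  for x :: "real^'n"
proof -
  have "(norm (x + t *\<^sub>R axis j 1))\<^sup>2 = (norm x)\<^sup>2 + 2 * (x \<bullet> (t *\<^sub>R axis j 1)) + (norm (t *\<^sub>R axis j (1::real) :: real^'n))\<^sup>2"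
    unfolding power2_norm_eq_inner by (simp add: inner_add_left inner_add_right inner_commute)
  then show ?thesis by (simp add: inner_axis power_mult_distrib)
qed

lemma flat_norm_deriv:
  "((\<lambda>t. of_real (flat m (1 - r * (norm (x + t *\<^sub>R axis j 1))\<^sup>2))) has_vector_derivative
    (of_real ((flat (m + 2) (1 - r * (norm x)\<^sup>2) - real m * flat (m + 1) (1 - r * (norm x)\<^sup>2)) * (- 2 * r * x $ j)) :: complex)) (at 0)"
proof -
  have 1: "((\<lambda>t. 1 - r * ((norm x)\<^sup>2 + 2 * t * x $ j + t\<^sup>2)) has_real_derivative (- 2 * r * x $ j)) (at 0)"
    by (auto intro!: derivative_eq_intros)
  have "((\<lambda>t. flat m (1 - r * ((norm x)\<^sup>2 + 2 * t * x $ j + t\<^sup>2))) has_real_derivative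
      ((flat (m + 2) (1 - r * (norm x)\<^sup>2) - real m * flat (m + 1) (1 - r * (norm x)\<^sup>2)) * (- 2 * r * x $ j))) (at 0)"
    by (rule DERIV_chain2[OF _ 1]) (use flat_has_real_derivative[of m "1 - r * (norm x)\<^sup>2"] in simp)
  then show ?thesis unfolding norm_sq_add_axis
    by (intro has_vector_derivative_of_real) (simp add: has_real_derivative_iff_has_vector_derivative)
qed

lemma coord_deriv:
  "((\<lambda>t. of_real ((x + t *\<^sub>R axis j 1) $ k)) has_vector_derivative (if j = k then 1 else 0 :: complex)) (at 0)"
proof -
  have "((\<lambda>t. (x + t *\<^sub>R axis j 1) $ k) has_real_derivative (if j = k then 1 else 0)) (at 0)"
    by (auto intro!: derivative_eq_intros simp: axis_def)
  then have "((\<lambda>t. of_real ((x + t *\<^sub>R axis j 1) $ k)) has_vector_derivative (of_real (if j = k then 1 else 0) :: complex)) (at 0)"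
    by (intro has_vector_derivative_of_real) (simp add: has_real_derivative_iff_has_vector_derivative)
  then show ?thesis by (simp split: if_splits)
qed

lemma gauss_deriv:
  "((\<lambda>t. gauss a B c (x + t *\<^sub>R axis j 1)) has_vector_derivative (2 * a * of_real (x $ j) + B j) * gauss a B c x) (at 0)"
proof -
  have e: "quad a B c (x + t *\<^sub>R axis j 1) = quad a B c x + (of_real t * (2 * a * of_real (x $ j) + B j) + (of_real t)\<^sup>2 * a)" for t
  proof -
    have "(\<Sum>k\<in>UNIV. B k * of_real ((x + t *\<^sub>R axis j 1) $ k)) = (\<Sum>k\<in>UNIV. B k * of_real (x $ k) + (if k = j then of_real t * B j else 0))"
      by (intro sum.cong) (auto simp: axis_def algebra_simps)
    also have "\<dots> = (\<Sum>k\<in>UNIV. B k * of_real (x $ k)) + of_real t * B j" by (simp add: sum.distrib)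
    finally show ?thesis unfolding quad_def norm_sq_add_axis by (simp add: algebra_simps)
  qed
  have "((\<lambda>z. exp (quad a B c x + (z * (2 * a * of_real (x $ j) + B j) + z\<^sup>2 * a))) has_field_derivative
      (2 * a * of_real (x $ j) + B j) * gauss a B c x) (at (of_real 0))"
    by (auto intro!: derivative_eq_intros simp: gauss_def)
  from has_vector_derivative_real_field[OF this] show ?thesis
    unfolding gauss_def e by simp
qed

lemma smooth_alg_deriv:
  assumes "smooth_alg r a B c f"
  shows "\<exists>f'. smooth_alg r a B c f' \<and> (\<forall>x. ((\<lambda>t. f (x + t *\<^sub>R axis j 1)) has_vector_derivative f' x) (at 0))"
  using assms
proof induction
  case (const k)
  show ?case by (rule exI[of _ "\<lambda>_. 0"]) (simp add: smooth_alg.const)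
next
  case (coord k)
  show ?case
    by (rule exI[of _ "\<lambda>_. if j = k then 1 else 0"]) (intro conjI allI smooth_alg.const coord_deriv)
next
  case (flat m)
  have "smooth_alg r a B c (\<lambda>x. (of_real (flat (m + 2) (1 - r * (norm x)\<^sup>2)) + (- of_real (real m)) * of_real (flat (m + 1) (1 - r * (norm x)\<^sup>2))) * ((- 2 * of_real r) * of_real (x $ j)))"
    by (intro smooth_alg.intros)
  moreover have "((\<lambda>t. of_real (flat m (1 - r * (norm (x + t *\<^sub>R axis j 1))\<^sup>2))) has_vector_derivative
    (of_real (flat (m + 2) (1 - r * (norm x)\<^sup>2)) + (- of_real (real m)) * of_real (flat (m + 1) (1 - r * (norm x)\<^sup>2))) * ((- 2 * of_real r) * of_real (x $ j) :: complex)) (at 0)" for x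
    by (rule has_vector_derivative_eq_rhs[OF flat_norm_deriv]) simp
  ultimately show ?case by blast
next
  case gauss
  have "smooth_alg r a B c (\<lambda>x. (2 * a * of_real (x $ j) + B j) * gauss a B c x)" by (intro smooth_alg.intros)
  then show ?case using gauss_deriv by blast
next
  case (add f g)
  then obtain f' g' where "smooth_alg r a B c f'" "smooth_alg r a B c g'"
    "\<forall>x. ((\<lambda>t. f (x + t *\<^sub>R axis j 1)) has_vector_derivative f' x) (at 0)"
    "\<forall>x. ((\<lambda>t. g (x + t *\<^sub>R axis j 1)) has_vector_derivative g' x) (at 0)" by blast
  then show ?case
    by (intro exI[of _ "\<lambda>x. f' x + g' x"]) (auto intro!: smooth_alg.add has_vector_derivative_add)
next
  case (mult f g)
  then obtain f' g' where *: "smooth_alg r a B c f'" "smooth_alg r a B c g'"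
    "\<And>x. ((\<lambda>t. f (x + t *\<^sub>R axis j 1)) has_vector_derivative f' x) (at 0)"
    "\<And>x. ((\<lambda>t. g (x + t *\<^sub>R axis j 1)) has_vector_derivative g' x) (at 0)" by blast
  have "((\<lambda>t. f (x + t *\<^sub>R axis j 1) * g (x + t *\<^sub>R axis j 1)) has_vector_derivative f x * g' x + f' x * g x) (at 0)" for x
    using has_vector_derivative_mult[OF *(3,4)] by simp
  then show ?case
    using *(1,2) mult.hyps by (intro exI[of _ "\<lambda>x. f x * g' x + f' x * g x"] conjI allI smooth_alg.add smooth_alg.mult)
qed

lemma smooth_alg_continuous: "smooth_alg r a B c f \<Longrightarrow> continuous_on UNIV f"
proof (induction rule: smooth_alg.induct)
  case (flat m)
  show ?case
    by (intro continuous_on_of_real continuous_on_compose2[OF continuous_flat[of UNIV]] continuous_intros)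
      auto
qed (auto intro!: continuous_intros)

lemma smooth_alg_dpar: "smooth_alg r a B c f \<Longrightarrow> smooth_alg r a B c (dpar js f)"
proof (induction js)
  case (Cons j js)
  then obtain f' where f': "smooth_alg r a B c f'" "\<And>x. ((\<lambda>t. dpar js f (x + t *\<^sub>R axis j 1)) has_vector_derivative f' x) (at 0)"
    using smooth_alg_deriv[of r a B c "dpar js f" j] by blast
  have "dpar (j # js) f = f'" using vector_derivative_at[OF f'(2)] by (intro ext) simp
  then show ?case using f'(1) by simp
qed simp

lemma smooth_cs_alg:
  assumes "smooth_alg r a B c f" "bounded {x. f x \<noteq> 0}"
  shows "smooth_cs f"
  unfolding smooth_cs_def
proof (intro conjI allI)
  show "compact (closure {x. f x \<noteq> 0})" using assms(2) by simp
  show "continuous_on UNIV (dpar js f)" for js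
    by (rule smooth_alg_continuous[OF smooth_alg_dpar[OF assms(1)]])
  show "(\<lambda>t. dpar js f (x + t *\<^sub>R axis j 1)) differentiable at 0" for js j x
    using smooth_alg_deriv[OF smooth_alg_dpar[OF assms(1)], of js j] differentiableI_vector by blast
qed

section \<open>Uniform bounds for cutoffs, and the generator on Gaussians\<close>

lemma flat_norm_bound: "\<bar>flat m (1 - y)\<bar> \<le> fact m"
  using flat_le_fact flat_nonneg by simp

text \<open>The factor exp 1 normalises the value at the origin to 1, since \<open>flat 0 1\<close>
  is exp (-1). For r > 0 the support is the ball |x|^2 <= 1 / r, so r -> 0 removes the
  cutoff.\<close>

definition cutoff :: "real \<Rightarrow> real^'n \<Rightarrow> real" where
  "cutoff r x = exp 1 * flat 0 (1 - r * (norm x)\<^sup>2)"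

definition cutoff_d1 :: "real \<Rightarrow> 'n \<Rightarrow> real^'n \<Rightarrow> real" where
  "cutoff_d1 r j x = exp 1 * flat 2 (1 - r * (norm x)\<^sup>2) * (- 2 * r * x $ j)"

definition cutoff_d2 :: "real \<Rightarrow> 'n \<Rightarrow> real^'n \<Rightarrow> real" where
  "cutoff_d2 r j x = exp 1 * ((flat 4 (1 - r * (norm x)\<^sup>2) - 2 * flat 3 (1 - r * (norm x)\<^sup>2)) * (4 * r\<^sup>2 * (x $ j)\<^sup>2)
     - 2 * r * flat 2 (1 - r * (norm x)\<^sup>2))"

lemma cutoff_deriv:
  "((\<lambda>t. of_real (cutoff r (x + t *\<^sub>R axis j 1))) has_vector_derivative (of_real (cutoff_d1 r j x) :: complex)) (at 0)"
  using has_vector_derivative_mult_right[OF flat_norm_deriv[of 0 r x j], of "of_real (exp 1)"]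
  by (simp add: cutoff_def cutoff_d1_def mult.assoc del: add_2_eq_Suc')

lemma cutoff_d1_deriv:
  "((\<lambda>t. of_real (cutoff_d1 r j (x + t *\<^sub>R axis j 1))) has_vector_derivative (of_real (cutoff_d2 r j x) :: complex)) (at 0)"
proof -
  have "((\<lambda>t. (of_real (exp 1) * of_real (flat 2 (1 - r * (norm (x + t *\<^sub>R axis j 1))\<^sup>2))) * ((- 2 * of_real r) * of_real ((x + t *\<^sub>R axis j 1) $ j)))
    has_vector_derivative (of_real (cutoff_d2 r j x) :: complex)) (at 0)"
    by (rule has_vector_derivative_eq_rhs[OF has_vector_derivative_mult[OF
            has_vector_derivative_mult_right[OF flat_norm_deriv] has_vector_derivative_mult_right[OF coord_deriv]]])
      (simp add: cutoff_d2_def power2_eq_square; simp add: algebra_simps)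
  then show ?thesis by (simp only: cutoff_d1_def of_real_mult mult.assoc of_real_minus of_real_numeral)
qed

lemma laplacian_cutoff_gauss:
  "laplacian (\<lambda>x. of_real (cutoff r x) * gauss a B c x) x =
    (\<Sum>j\<in>UNIV. of_real (cutoff_d2 r j x) + 2 * of_real (cutoff_d1 r j x) * (2 * a * of_real (x $ j) + B j)
      + of_real (cutoff r x) * ((2 * a * of_real (x $ j) + B j)\<^sup>2 + 2 * a)) * gauss a B c x"
proof -
  let ?f = "\<lambda>x. of_real (cutoff r x) * gauss a B c x"
  let ?q = "\<lambda>j x. 2 * a * of_real (x $ j) + B j"
  have 1: "dpar [j] ?f = (\<lambda>x. of_real (cutoff r x) * (?q j x * gauss a B c x) + of_real (cutoff_d1 r j x) * gauss a B c x)" for j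
  proof
    fix x
    show "dpar [j] ?f x = of_real (cutoff r x) * (?q j x * gauss a B c x) + of_real (cutoff_d1 r j x) * gauss a B c x"
      using vector_derivative_at[OF has_vector_derivative_mult[OF cutoff_deriv[of r x j] gauss_deriv[of a B c x j]]] by simp
  qed
  have q: "((\<lambda>t. ?q j (x + t *\<^sub>R axis j 1)) has_vector_derivative 2 * a) (at 0)" for j
    using has_vector_derivative_add[OF has_vector_derivative_mult_right[OF coord_deriv[of x j j], of "2 * a"] has_vector_derivative_const[of "B j"]]
    by simp
  have "dpar [j, j] ?f x = (of_real (cutoff_d2 r j x) + 2 * of_real (cutoff_d1 r j x) * ?q j x
      + of_real (cutoff r x) * ((?q j x)\<^sup>2 + 2 * a)) * gauss a B c x" for j
  proof -
    have "dpar [j, j] ?f x = vector_derivative (\<lambda>t. dpar [j] ?f (x + t *\<^sub>R axis j 1)) (at 0)" by (simp only: dpar.simps)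
    also have "\<dots> = (of_real (cutoff_d2 r j x) + 2 * of_real (cutoff_d1 r j x) * ?q j x
      + of_real (cutoff r x) * ((?q j x)\<^sup>2 + 2 * a)) * gauss a B c x"
      unfolding 1
      by (rule vector_derivative_at[OF has_vector_derivative_eq_rhs[OF has_vector_derivative_add[OF
              has_vector_derivative_mult[OF cutoff_deriv has_vector_derivative_mult[OF q gauss_deriv]]
              has_vector_derivative_mult[OF cutoff_d1_deriv gauss_deriv]]]])
        (simp add: algebra_simps power2_eq_square)
    finally show ?thesis .
  qed
  then show ?thesis unfolding laplacian_def by (simp only: sum_distrib_right)
qed

lemma quad_laplace:
  "(\<Sum>j\<in>UNIV. (2 * a * of_real (x $ j) + B j)\<^sup>2 + 2 * a)
    = quad (4 * a\<^sup>2) (\<lambda>j. 4 * a * B j) ((\<Sum>j\<in>UNIV. (B j)\<^sup>2) + 2 * of_nat CARD('n) * a) x" for x :: "real^'n"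
proof -
  have n: "(norm x)\<^sup>2 = (\<Sum>j\<in>UNIV. (x $ j)\<^sup>2)"
    by (simp add: norm_vec_def L2_set_def sum_nonneg)
  show ?thesis unfolding quad_def n
    by (simp add: power2_sum sum.distrib sum_distrib_left power_mult_distrib algebra_simps)
qed

lemma quad_add: "quad a B c x + quad a' B' c' x = quad (a + a') (\<lambda>j. B j + B' j) (c + c') x"
  unfolding quad_def by (simp add: algebra_simps sum.distrib)

lemma quad_cmult: "k * quad a B c x = quad (k * a) (\<lambda>j. k * B j) (k * c) x"
  unfolding quad_def by (simp add: algebra_simps sum_distrib_left)

lemma quad_diff: "quad a B c x - quad a' B' c' x = quad (a - a') (\<lambda>j. B j - B' j) (c - c') x"
  unfolding quad_def by (simp add: algebra_simps sum_subtractf)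

lemma cutoff_bound: "\<bar>cutoff s x\<bar> \<le> exp 1"
  using flat_norm_bound[of 0 "s * (norm x)\<^sup>2"] by (simp add: cutoff_def abs_mult)

lemma cutoff_d1_bound:
  assumes "0 < s" "s \<le> 1" shows "\<bar>cutoff_d1 s j x\<bar> \<le> 4 * exp 1 * (1 + norm x)"
proof -
  have "\<bar>- 2 * s * x $ j\<bar> \<le> 2 * (1 * norm x)"
    using assms component_le_norm_cart[of x j] by (simp add: abs_mult mult_mono)
  then have "\<bar>flat 2 (1 - s * (norm x)\<^sup>2)\<bar> * \<bar>- 2 * s * x $ j\<bar> \<le> 2 * (2 * (1 + norm x))"
    using flat_norm_bound[of 2 "s * (norm x)\<^sup>2"] by (intro mult_mono) auto
  then show ?thesis by (simp add: cutoff_d1_def abs_mult mult.assoc)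
qed

text \<open>The factorials come from \<open>flat_le_fact\<close>: 36 = 4! + 2 * 3!, the factor 4
  makes it 144, and 2 * s * 2! <= 4 completes 148. The restriction s <= 1 keeps the bound uniform
  while the cutoff is removed.\<close>

lemma cutoff_d2_bound:
  assumes "0 < s" "s \<le> 1" shows "\<bar>cutoff_d2 s j x\<bar> \<le> 148 * exp 1 * (1 + norm x)\<^sup>2"
proof -
  let ?t = "s * (norm x)\<^sup>2"
  have x: "(x $ j)\<^sup>2 \<le> (1 + norm x)\<^sup>2"
    using component_le_norm_cart[of x j] by (intro abs_le_square_iff[THEN iffD1]) auto
  have "s\<^sup>2 * (x $ j)\<^sup>2 \<le> 1 * (1 + norm x)\<^sup>2"
    using assms x by (intro mult_mono power_le_one) auto
  moreover have "\<bar>flat 4 (1 - ?t) - 2 * flat 3 (1 - ?t)\<bar> \<le> 36"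
    using flat_norm_bound[of 4 ?t] flat_norm_bound[of 3 ?t] by (simp add: fact_numeral)
  ultimately have "\<bar>flat 4 (1 - ?t) - 2 * flat 3 (1 - ?t)\<bar> * (4 * s\<^sup>2 * (x $ j)\<^sup>2) \<le> 36 * (4 * (1 + norm x)\<^sup>2)"
    by (intro mult_mono[of _ 36 "4 * s\<^sup>2 * (x $ j)\<^sup>2"]) auto
  then have "\<bar>(flat 4 (1 - ?t) - 2 * flat 3 (1 - ?t)) * (4 * s\<^sup>2 * (x $ j)\<^sup>2)\<bar> \<le> 144 * (1 + norm x)\<^sup>2"
    by (subst abs_mult) simp
  moreover have "2 * s * \<bar>flat 2 (1 - ?t)\<bar> \<le> 2 * 1 * 2"
    using assms flat_norm_bound[of 2 ?t] by (intro mult_mono) auto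
  then have "\<bar>2 * s * flat 2 (1 - ?t)\<bar> \<le> 4" using assms by (simp add: abs_mult)
  moreover have "1 \<le> (1 + norm x)\<^sup>2" by simp
  ultimately have "\<bar>(flat 4 (1 - ?t) - 2 * flat 3 (1 - ?t)) * (4 * s\<^sup>2 * (x $ j)\<^sup>2) - 2 * s * flat 2 (1 - ?t)\<bar> \<le> 148 * (1 + norm x)\<^sup>2"
    by linarith
  then show ?thesis by (simp add: cutoff_d2_def abs_mult mult.assoc)
qed

lemma flat_tendsto:
  assumes "(s \<longlongrightarrow> 0) F" shows "((\<lambda>n. flat m (1 - s n * y)) \<longlongrightarrow> flat m 1) F"
proof -
  have "((\<lambda>n. 1 - s n * y) \<longlongrightarrow> 1 - 0 * y) F" by (intro tendsto_intros assms)
  moreover have "isCont (flat m) 1" using DERIV_isCont flat_has_real_derivative by blast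
  ultimately show ?thesis using isCont_tendsto_compose by fastforce
qed

lemma cutoff_tendsto: "(s \<longlongrightarrow> 0) F \<Longrightarrow> ((\<lambda>n. cutoff (s n) x) \<longlongrightarrow> 1) F"
  using tendsto_mult[OF tendsto_const[of "exp 1"] flat_tendsto[of s F 0]]
  by (simp add: cutoff_def flat_def flip: exp_add)

lemma cutoff_d1_tendsto: "(s \<longlongrightarrow> 0) F \<Longrightarrow> ((\<lambda>n. cutoff_d1 (s n) j x) \<longlongrightarrow> 0) F"
proof -
  assume s: "(s \<longlongrightarrow> 0) F"
  have "((\<lambda>n. cutoff_d1 (s n) j x) \<longlongrightarrow> exp 1 * flat 2 1 * (- 2 * 0 * x $ j)) F"
    unfolding cutoff_d1_def by (intro tendsto_intros flat_tendsto s)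
  then show ?thesis by simp
qed

lemma cutoff_d2_tendsto: "(s \<longlongrightarrow> 0) F \<Longrightarrow> ((\<lambda>n. cutoff_d2 (s n) j x) \<longlongrightarrow> 0) F"
proof -
  assume s: "(s \<longlongrightarrow> 0) F"
  have "((\<lambda>n. cutoff_d2 (s n) j x) \<longlongrightarrow> exp 1 * ((flat 4 1 - 2 * flat 3 1) * (4 * 0\<^sup>2 * (x $ j)\<^sup>2) - 2 * 0 * flat 2 1)) F"
    unfolding cutoff_d2_def by (intro tendsto_intros flat_tendsto s)
  then show ?thesis by simp
qed

lemma continuous_cutoff: "continuous_on UNIV (cutoff s)" "continuous_on UNIV (cutoff_d1 s j)" "continuous_on UNIV (cutoff_d2 s j)"
  unfolding cutoff_def[abs_def] cutoff_d1_def[abs_def] cutoff_d2_def[abs_def]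
  by (intro continuous_intros continuous_on_compose2[OF continuous_flat[of UNIV]] subset_UNIV)+

lemma smooth_cs_cutoff_gauss:
  assumes "s > 0" shows "smooth_cs (\<lambda>x. of_real (cutoff s x) * gauss a B c x)"
proof (rule smooth_cs_alg)
  have "smooth_alg s a B c (\<lambda>x. (of_real (exp 1) * of_real (flat 0 (1 - s * (norm x)\<^sup>2))) * gauss a B c x)"
    by (intro smooth_alg.intros)
  then show "smooth_alg s a B c (\<lambda>x. of_real (cutoff s x) * gauss a B c x)" by (simp add: cutoff_def)
  show "bounded {x. of_real (cutoff s x) * gauss a B c x \<noteq> 0}"
    unfolding bounded_iff
  proof (intro exI ballI)
    fix x assume "x \<in> {x. of_real (cutoff s x) * gauss a B c x \<noteq> 0}"
    then have "s * (norm x)\<^sup>2 < 1" by (auto simp: cutoff_def flat_def split: if_splits)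
    then have 1: "(norm x)\<^sup>2 < 1 / s" using assms by (simp add: field_simps)
    have "0 \<le> (norm x - 1)\<^sup>2" by simp
    then have "2 * norm x \<le> 1 + (norm x)\<^sup>2" by (simp add: power2_diff)
    then show "norm x \<le> 1 + 1 / s" using 1 assms norm_ge_zero[of x] by linarith
  qed
qed

text \<open>Each derivative falling on the cutoff carries a power of s and vanishes in the limit,
  while the bounds stay uniform in n; dominated convergence and \<open>has_gen_closure\<close> do
  the rest. The coefficient \<kappa> and the potential are left general because the controlled flows
  have \<kappa> = i / 2 and the free group has \<kappa> = i.\<close>

lemma has_gen_gauss:
  fixes a c :: complex and B :: "'n::finite \<Rightarrow> complex"
  assumes gen: "generates U (\<lambda>\<phi> x. \<kappa> * laplacian \<phi> x + quad v2 v1 v0 x * \<phi> x)" and a: "Re a < 0"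
  shows "has_gen U (gauss a B c) (\<lambda>x. (\<kappa> * quad (4 * a\<^sup>2) (\<lambda>j. 4 * a * B j) ((\<Sum>j\<in>UNIV. (B j)\<^sup>2) + 2 * of_nat CARD('n) * a) x
    + quad v2 v1 v0 x) * gauss a B c x)"
proof -
  define s where "s n = inverse (real (Suc n))" for n
  have s: "0 < s n" "s n \<le> 1" for n by (auto simp: s_def inverse_le_1_iff)
  have s0: "s \<longlonglongrightarrow> 0" unfolding s_def[abs_def] by (rule LIMSEQ_inverse_real_of_nat)
  let ?G = "gauss a B c"
  let ?q = "\<lambda>j x. 2 * a * of_real (x $ j) + B j"
  let ?X = "\<lambda>n x. complex_of_real (cutoff (s n) x)"
  define cf where "cf n j x = of_real (cutoff_d2 (s n) j x) + 2 * of_real (cutoff_d1 (s n) j x) * ?q j x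
      + ?X n x * ((?q j x)\<^sup>2 + 2 * a)" for n j and x :: "real^'n"
  define \<phi>s where "\<phi>s n x = ?X n x * ?G x" for n x
  define \<psi>s where "\<psi>s n x = (\<kappa> * (\<Sum>j\<in>UNIV. cf n j x) + quad v2 v1 v0 x * ?X n x) * ?G x" for n x
  define \<psi> where "\<psi> x = (\<kappa> * (\<Sum>j\<in>UNIV. (?q j x)\<^sup>2 + 2 * a) + quad v2 v1 v0 x) * ?G x" for x
  have op: "(\<lambda>x. \<kappa> * laplacian (\<phi>s n) x + quad v2 v1 v0 x * \<phi>s n x) = \<psi>s n" for n
    unfolding \<phi>s_def[abs_def] laplacian_cutoff_gauss \<psi>s_def[abs_def] cf_def by (simp add: algebra_simps)
  obtain K where K: "0 \<le> K" "\<And>q N x. \<lbrakk>0 \<le> N; cmod q \<le> N * (1 + norm x)\<^sup>2\<rbrakk> \<Longrightarrow> cmod (q * ?G x) \<le> N * K * decay x"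
    using quad_gauss_decay[OF a] by blast
  define Q where "Q j = 2 * cmod a + cmod (B j)" for j
  define Nj where "Nj j = exp 1 * (148 + 8 * Q j + ((Q j)\<^sup>2 + 2 * cmod a))" for j
  define Nv where "Nv = cmod v2 + (\<Sum>j\<in>UNIV. cmod (v1 j)) + cmod v0"
  have pos: "0 \<le> Q j" "0 \<le> Nj j" "0 \<le> Nv" for j
    by (auto simp: Q_def Nj_def Nv_def intro!: add_nonneg_nonneg sum_nonneg)
  have q_le: "cmod (?q j x) \<le> Q j * (1 + norm x)" for j x
  proof -
    have "cmod (?q j x) \<le> 2 * cmod a * \<bar>x $ j\<bar> + cmod (B j)"
      by (rule order_trans[OF norm_triangle_ineq]) (simp add: norm_mult)
    also have "\<dots> \<le> 2 * cmod a * (1 + norm x) + cmod (B j) * (1 + norm x)"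
      using component_le_norm_cart[of x j]
      by (intro add_mono mult_left_mono) (auto simp: algebra_simps)
    finally show ?thesis by (simp add: Q_def algebra_simps)
  qed
  have cf_le: "cmod (cf n j x) \<le> Nj j * (1 + norm x)\<^sup>2" for n j x
  proof -
    let ?y = "1 + norm x"
    have y: "1 \<le> ?y\<^sup>2" by simp
    have "cmod (cf n j x) \<le> \<bar>cutoff_d2 (s n) j x\<bar> + 2 * (\<bar>cutoff_d1 (s n) j x\<bar> * cmod (?q j x)) + \<bar>cutoff (s n) x\<bar> * (cmod (?q j x) ^ 2 + 2 * cmod a)"
      unfolding cf_def
      by (intro norm_triangle_mono) (auto simp: norm_mult intro!: mult_left_mono norm_triangle_mono simp: norm_power)
    also have "\<dots> \<le> 148 * exp 1 * ?y\<^sup>2 + 2 * ((4 * exp 1 * ?y) * (Q j * ?y)) + exp 1 * ((Q j * ?y)\<^sup>2 + 2 * cmod a * ?y\<^sup>2)"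
    proof (intro add_mono)
      show "\<bar>cutoff_d2 (s n) j x\<bar> \<le> 148 * exp 1 * ?y\<^sup>2" by (rule cutoff_d2_bound[OF s])
      have "\<bar>cutoff_d1 (s n) j x\<bar> * cmod (?q j x) \<le> (4 * exp 1 * ?y) * (Q j * ?y)"
        by (intro mult_mono q_le cutoff_d1_bound[OF s]) auto
      then show "2 * (\<bar>cutoff_d1 (s n) j x\<bar> * cmod (?q j x)) \<le> 2 * ((4 * exp 1 * ?y) * (Q j * ?y))"
        by (rule mult_left_mono) simp
      have "cmod a \<le> cmod a * ?y\<^sup>2" using mult_left_mono[OF y, of "cmod a"] by simp
      then have "(cmod (?q j x))\<^sup>2 + 2 * cmod a \<le> (Q j * ?y)\<^sup>2 + 2 * cmod a * ?y\<^sup>2"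
        using power_mono[OF q_le[of x j], of 2] by simp
      then show "\<bar>cutoff (s n) x\<bar> * ((cmod (?q j x))\<^sup>2 + 2 * cmod a) \<le> exp 1 * ((Q j * ?y)\<^sup>2 + 2 * cmod a * ?y\<^sup>2)"
        by (intro mult_mono cutoff_bound) auto
    qed
    also have "\<dots> = Nj j * ?y\<^sup>2" by (simp add: Nj_def power_mult_distrib power2_eq_square algebra_simps)
    finally show ?thesis .
  qed
  have \<phi>s_le: "cmod (\<phi>s n x) \<le> exp 1 * K * decay x" for n x
    unfolding \<phi>s_def using cutoff_bound[of "s n" x] mult_left_mono[of 1 "(1 + norm x)\<^sup>2" "exp 1"]
    by (intro K) (auto intro: order_trans)
  have \<psi>s_le: "cmod (\<psi>s n x) \<le> (cmod \<kappa> * (\<Sum>j\<in>UNIV. Nj j) + Nv * exp 1) * K * decay x" for n x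
    unfolding \<psi>s_def
  proof (rule K)
    show "0 \<le> cmod \<kappa> * (\<Sum>j\<in>UNIV. Nj j) + Nv * exp 1" by (intro add_nonneg_nonneg mult_nonneg_nonneg sum_nonneg pos) auto
    have "cmod (\<Sum>j\<in>UNIV. cf n j x) \<le> (\<Sum>j\<in>UNIV. Nj j * (1 + norm x)\<^sup>2)"
      by (intro sum_norm_le cf_le)
    then have "cmod (\<kappa> * (\<Sum>j\<in>UNIV. cf n j x)) \<le> cmod \<kappa> * ((\<Sum>j\<in>UNIV. Nj j) * (1 + norm x)\<^sup>2)"
      unfolding norm_mult sum_distrib_right by (intro mult_left_mono) auto
    moreover have "cmod (quad v2 v1 v0 x * ?X n x) \<le> (Nv * (1 + norm x)\<^sup>2) * exp 1"
      unfolding norm_mult Nv_def using cutoff_bound[of "s n" x] pos(3)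
      by (intro mult_mono cmod_quad_le) (auto simp: Nv_def)
    ultimately show "cmod (\<kappa> * (\<Sum>j\<in>UNIV. cf n j x) + quad v2 v1 v0 x * ?X n x)
        \<le> (cmod \<kappa> * (\<Sum>j\<in>UNIV. Nj j) + Nv * exp 1) * (1 + norm x)\<^sup>2"
      by (intro order_trans[OF norm_triangle_ineq]) (simp add: algebra_simps)
  qed
  have m: "\<phi>s n \<in> borel_measurable borel" "\<psi>s n \<in> borel_measurable borel" "\<psi> \<in> borel_measurable borel" for n
    unfolding \<phi>s_def[abs_def] \<psi>s_def[abs_def] \<psi>_def[abs_def] cf_def
    by (intro borel_measurable_continuous_onI continuous_intros continuous_cutoff)+
  have lim: "(\<lambda>n. \<phi>s n x) \<longlonglongrightarrow> ?G x" "(\<lambda>n. \<psi>s n x) \<longlonglongrightarrow> \<psi> x" for x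
  proof -
    have X: "(\<lambda>n. ?X n x) \<longlonglongrightarrow> 1" using tendsto_of_real[OF cutoff_tendsto[OF s0]] by simp
    have d1: "(\<lambda>n. complex_of_real (cutoff_d1 (s n) j x)) \<longlonglongrightarrow> 0" for j using tendsto_of_real[OF cutoff_d1_tendsto[OF s0]] by simp
    have d2: "(\<lambda>n. complex_of_real (cutoff_d2 (s n) j x)) \<longlonglongrightarrow> 0" for j using tendsto_of_real[OF cutoff_d2_tendsto[OF s0]] by simp
    have "(\<lambda>n. \<phi>s n x) \<longlonglongrightarrow> 1 * ?G x" unfolding \<phi>s_def by (intro tendsto_mult X tendsto_const)
    then show "(\<lambda>n. \<phi>s n x) \<longlonglongrightarrow> ?G x" by simp
    have "(\<lambda>n. \<psi>s n x) \<longlonglongrightarrow> (\<kappa> * (\<Sum>j\<in>UNIV. 0 + 2 * 0 * ?q j x + 1 * ((?q j x)\<^sup>2 + 2 * a)) + quad v2 v1 v0 x * 1) * ?G x"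
      unfolding \<psi>s_def cf_def by (intro tendsto_mult tendsto_add tendsto_sum X d1 d2 tendsto_const)
    then show "(\<lambda>n. \<psi>s n x) \<longlonglongrightarrow> \<psi> x" unfolding \<psi>_def by simp
  qed
  have "has_gen U ?G \<psi>"
  proof (rule has_gen_closure[of U \<phi>s \<psi>s])
    show "unitary_group U" using gen by (simp add: generates_def)
    show "L2 ?G" by (rule L2_gauss[OF a])
    have "cmod (\<psi> x) \<le> (cmod \<kappa> * (\<Sum>j\<in>UNIV. Nj j) + Nv * exp 1) * K * decay x" for x
      using \<psi>s_le by (intro LIMSEQ_le_const2[OF tendsto_norm[OF lim(2)]]) auto
    then show "L2 \<psi>" using m by (intro L2_decay)
    show "has_gen U (\<phi>s n) (\<psi>s n)" for n
      unfolding has_gen_def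
    proof (intro conjI)
      show "L2 (\<phi>s n)" "L2 (\<psi>s n)" using m \<phi>s_le \<psi>s_le by (blast intro: L2_decay)+
      have "smooth_cs (\<phi>s n)" unfolding \<phi>s_def[abs_def] by (rule smooth_cs_cutoff_gauss[OF s(1)])
      then have "((\<lambda>t. L2norm (\<lambda>x. (U t (\<phi>s n) x - \<phi>s n x) / complex_of_real t - (\<kappa> * laplacian (\<phi>s n) x + quad v2 v1 v0 x * \<phi>s n x))) \<longlongrightarrow> 0) (at 0)"
        using gen by (simp add: generates_def)
      then show "((\<lambda>h. L2norm (\<lambda>x. (U h (\<phi>s n) x - \<phi>s n x) / complex_of_real h - \<psi>s n x)) \<longlongrightarrow> 0) (at 0)"
        unfolding fun_cong[OF op] .
    qed
    show "(\<lambda>n. L2norm (\<lambda>x. \<phi>s n x - ?G x)) \<longlonglongrightarrow> 0"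
      by (rule L2_dominated_convergence[OF m(1) _ integrable_decay_sq \<phi>s_le lim(1)]) simp
    show "(\<lambda>n. L2norm (\<lambda>x. \<psi>s n x - \<psi> x)) \<longlonglongrightarrow> 0"
      by (rule L2_dominated_convergence[OF m(2) m(3) integrable_decay_sq \<psi>s_le lim(2)])
  qed
  then show ?thesis unfolding \<psi>_def[abs_def] quad_laplace .
qed

subsection \<open>Curves of Gaussians\<close>

text \<open>By compactness one constant serves the whole parameter interval. It depends only on the
  real parts \<open>ra\<close>, \<open>rB\<close>, \<open>rc\<close> of the exponent and is chosen
  before its imaginary parts, which may therefore blow up later.\<close>

lemma gauss_curve_decay:
  fixes ra rc :: "real \<Rightarrow> real" and rB :: "real \<Rightarrow> 'n::finite \<Rightarrow> real"
  assumes lu: "l \<le> u"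
    and cont: "continuous_on {l..u} ra" "\<And>j. continuous_on {l..u} (\<lambda>s. rB s j)" "continuous_on {l..u} rc"
      "continuous_on {l..u} \<alpha>" "\<And>j. continuous_on {l..u} (\<lambda>s. \<beta> s j)" "continuous_on {l..u} \<gamma>"
    and neg: "\<And>s. s \<in> {l..u} \<Longrightarrow> ra s < 0"
  obtains K where "0 \<le> K"
    "\<And>s a B c x. \<lbrakk>s \<in> {l..u}; Re a = ra s; \<And>j. Re (B j) = rB s j; Re c = rc s\<rbrakk>
      \<Longrightarrow> cmod (quad (\<alpha> s) (\<beta> s) (\<gamma> s) x * gauss a B c x) \<le> K * decay x"
proof -
  have ne: "{l..u} \<noteq> {}" using lu by simp
  have bdd: "\<exists>M. \<forall>s\<in>{l..u}. g s \<le> M" if "continuous_on {l..u} g" for g :: "real \<Rightarrow> real"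
    using continuous_attains_sup[OF compact_Icc ne that] by blast
  obtain s0 where s0: "s0 \<in> {l..u}" "\<And>s. s \<in> {l..u} \<Longrightarrow> ra s \<le> ra s0"
    using continuous_attains_sup[OF compact_Icc ne cont(1)] by blast
  obtain M where M: "\<And>s. s \<in> {l..u} \<Longrightarrow> (\<Sum>j\<in>UNIV. \<bar>rB s j\<bar>) + \<bar>rc s\<bar> \<le> M"
  proof -
    have "continuous_on {l..u} (\<lambda>s. (\<Sum>j\<in>UNIV. \<bar>rB s j\<bar>) + \<bar>rc s\<bar>)" by (intro continuous_intros cont)
    from bdd[OF this] show ?thesis using that by blast
  qed
  obtain N where N: "\<And>s. s \<in> {l..u} \<Longrightarrow> cmod (\<alpha> s) + (\<Sum>j\<in>UNIV. cmod (\<beta> s j)) + cmod (\<gamma> s) \<le> N"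
  proof -
    have "continuous_on {l..u} (\<lambda>s. cmod (\<alpha> s) + (\<Sum>j\<in>UNIV. cmod (\<beta> s j)) + cmod (\<gamma> s))" by (intro continuous_intros cont)
    from bdd[OF this] show ?thesis using that by blast
  qed
  have N0: "0 \<le> N"
    by (rule order_trans[OF _ N[OF s0(1)]]) (intro add_nonneg_nonneg sum_nonneg norm_ge_zero)
  show thesis
  proof (rule that[of "N * exp (M + (M + 3)\<^sup>2 / (4 * (- ra s0)))"])
    show "0 \<le> N * exp (M + (M + 3)\<^sup>2 / (4 * - ra s0))" using N0 by simp
    fix s a B c x
    assume s: "s \<in> {l..u}" and R: "Re a = ra s" "\<And>j. Re (B j) = rB s j" "Re c = rc s"
    have "0 \<le> (\<Sum>j\<in>UNIV. \<bar>rB s j\<bar>)" by (intro sum_nonneg) auto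
    then have Mle: "(\<Sum>j\<in>UNIV. \<bar>Re (B j)\<bar>) \<le> M" "Re c \<le> M"
      using M[OF s] R(2,3) abs_ge_self[of "rc s"] by (simp, linarith)
    show "cmod (quad (\<alpha> s) (\<beta> s) (\<gamma> s) x * gauss a B c x) \<le> N * exp (M + (M + 3)\<^sup>2 / (4 * (- ra s0))) * decay x"
    proof (rule cmod_mult_gauss_le)
      show "0 < - ra s0" using neg[OF s0(1)] by simp
      show "Re a \<le> - (- ra s0)" using s0(2)[OF s] R by simp
      show "cmod (quad (\<alpha> s) (\<beta> s) (\<gamma> s) x) \<le> N * (1 + norm x)\<^sup>2"
        by (rule order_trans[OF cmod_quad_le mult_right_mono[OF N[OF s]]]) simp
    qed (use Mle N0 in auto)
  qed
qed

text \<open>Only the parameters move in time, so the time derivative of such a curve has the same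
  shape as the generator applied to it in \<open>has_gen_gauss\<close>, and the two can be compared
  coefficient by coefficient.\<close>

locale gauss_curve =
  fixes a a' c c' :: "real \<Rightarrow> complex" and B B' :: "real \<Rightarrow> 'n::finite \<Rightarrow> complex"
  assumes da: "\<And>t. (a has_vector_derivative a' t) (at t)"
    and dB: "\<And>t j. ((\<lambda>t. B t j) has_vector_derivative B' t j) (at t)"
    and dc: "\<And>t. (c has_vector_derivative c' t) (at t)"
    and cont_a': "continuous_on UNIV a'"
    and cont_B': "\<And>j. continuous_on UNIV (\<lambda>t. B' t j)"
    and cont_c': "continuous_on UNIV c'"
    and neg: "\<And>t. Re (a t) < 0"
begin

lemma cont: "continuous_on UNIV a" "continuous_on UNIV (\<lambda>t. B t j)" "continuous_on UNIV c"
  using da dB dc by (meson continuous_at_imp_continuous_on has_vector_derivative_continuous)+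

abbreviation "G t \<equiv> gauss (a t) (B t) (c t)"
abbreviation "dG t x \<equiv> quad (a' t) (B' t) (c' t) x * G t x"

lemma deriv_G: "((\<lambda>t. G t x) has_vector_derivative dG t x) (at t)"
proof -
  have "((\<lambda>t. quad (a t) (B t) (c t) x) has_vector_derivative quad (a' t) (B' t) (c' t) x) (at t)"
    unfolding quad_def
    by (intro has_vector_derivative_add has_vector_derivative_sum has_vector_derivative_mult_left da dB dc)
  from field_vector_diff_chain_at[OF this, of exp "exp (quad (a t) (B t) (c t) x)"] DERIV_exp
  show ?thesis unfolding gauss_def o_def by simp
qed

lemma local_decay:
  obtains K where "0 \<le> K" "\<And>s x. \<bar>s - t\<bar> \<le> 1 \<Longrightarrow> cmod (dG s x) \<le> K * decay x"
proof -
  obtain K where K: "0 \<le> K"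
    "\<And>s a0 B0 c0 x. \<lbrakk>s \<in> {t - 1..t + 1}; Re a0 = Re (a s); \<And>j. Re (B0 j) = Re (B s j); Re c0 = Re (c s)\<rbrakk>
      \<Longrightarrow> cmod (quad (a' s) (B' s) (c' s) x * gauss a0 B0 c0 x) \<le> K * decay x"
  proof (rule gauss_curve_decay[of "t - 1" "t + 1" "\<lambda>s. Re (a s)" "\<lambda>s j. Re (B s j)" "\<lambda>s. Re (c s)" a' B' c'])
    note sub = continuous_on_subset[OF _ subset_UNIV]
    show "continuous_on {t - 1..t + 1} (\<lambda>s. Re (a s))" "continuous_on {t - 1..t + 1} (\<lambda>s. Re (B s j))"
      "continuous_on {t - 1..t + 1} (\<lambda>s. Re (c s))" for j
      by (intro continuous_intros sub[OF cont(1)] sub[OF cont(2)] sub[OF cont(3)])+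
    show "continuous_on {t - 1..t + 1} a'" "continuous_on {t - 1..t + 1} (\<lambda>s. B' s j)" "continuous_on {t - 1..t + 1} c'" for j
      by (rule sub[OF cont_a'], rule sub[OF cont_B'], rule sub[OF cont_c'])
  qed (use neg in auto)
  show thesis
    by (rule that[OF K(1)]) (use K(2) in \<open>auto simp: abs_le_iff\<close>)
qed

lemma L2_G: "L2 (G t)" and L2_dG: "L2 (dG t)"
  by (intro L2_gauss L2_quad_gauss neg)+

text \<open>The mean value inequality bounds the difference quotients by the supremum of the
  derivative over |s - t| <= 1, a multiple of \<open>decay\<close>; dominated convergence then
  upgrades the pointwise derivative to one in L2.\<close>

lemma L2_deriv_G: "((\<lambda>h. L2norm (\<lambda>x. (G (t + h) x - G t x) / of_real h - dG t x)) \<longlongrightarrow> 0) (at 0)"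
  unfolding tendsto_at_iff_sequentially o_def
proof (intro allI impI)
  fix X :: "nat \<Rightarrow> real" assume X: "\<forall>i. X i \<in> UNIV - {0}" "X \<longlonglongrightarrow> 0"
  obtain K where K: "0 \<le> K" "\<And>s x. \<bar>s - t\<bar> \<le> 1 \<Longrightarrow> cmod (dG s x) \<le> K * decay x"
    using local_decay by blast
  have "\<forall>\<^sub>F i in sequentially. \<bar>X i\<bar> < 1"
    using order_tendstoD(2)[OF tendsto_rabs[OF X(2)], of 1] by simp
  then obtain N where N: "\<And>i. i \<ge> N \<Longrightarrow> \<bar>X i\<bar> < 1" unfolding eventually_sequentially by blast
  show "(\<lambda>i. L2norm (\<lambda>x. (G (t + X i) x - G t x) / of_real (X i) - dG t x)) \<longlonglongrightarrow> 0"
  proof (rule LIMSEQ_offset[where k=N], rule L2_dominated_convergence[OF _ _ integrable_decay_sq[of K]])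
    fix i and x :: "real^'n"
    let ?h = "X (i + N)"
    have h: "?h \<noteq> 0" "\<bar>?h\<bar> < 1" using X(1) N by auto
    have "norm (G (t + ?h) x - G t x) \<le> (K * decay x) * norm (t + ?h - t)"
    proof (rule differentiable_bound[where S="{t - 1..t + 1}" and f'="\<lambda>s h. h *\<^sub>R dG s x"])
      show "((\<lambda>t. G t x) has_derivative (\<lambda>h. h *\<^sub>R dG s x)) (at s within {t - 1..t + 1})" for s
        using deriv_G has_derivative_at_withinI unfolding has_vector_derivative_def by blast
      fix s assume "s \<in> {t - 1..t + 1}"
      then have "cmod (dG s x) \<le> K * decay x" by (intro K(2)) auto
      then have "norm (h *\<^sub>R dG s x) \<le> (K * decay x) * norm h" for h :: real
        unfolding norm_scaleR real_norm_def using mult_left_mono[OF _ abs_ge_zero, of _ _ h]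
        by (simp only: mult.commute[of "K * decay x"])
      then show "onorm (\<lambda>h. h *\<^sub>R dG s x) \<le> K * decay x" by (rule onorm_le)
    qed (use h in auto)
    then show "cmod ((G (t + ?h) x - G t x) / of_real ?h) \<le> K * decay x"
      using h by (simp add: norm_divide divide_simps)
  next
    fix x :: "real^'n"
    have "((\<lambda>h. norm (G (t + h) x - G t x - h *\<^sub>R dG t x) / norm h) \<longlongrightarrow> 0) (at 0)"
      using deriv_G[of x t] unfolding has_vector_derivative_def has_derivative_at by blast
    moreover have "filterlim (\<lambda>i. X (i + N)) (at 0) sequentially"
      unfolding filterlim_at using X LIMSEQ_ignore_initial_segment[OF X(2)] by auto
    ultimately have "(\<lambda>i. norm (G (t + X (i + N)) x - G t x - X (i + N) *\<^sub>R dG t x) / norm (X (i + N))) \<longlonglongrightarrow> 0"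
      by (rule filterlim_compose)
    moreover have "norm (G (t + X (i + N)) x - G t x - X (i + N) *\<^sub>R dG t x) / norm (X (i + N))
        = norm ((G (t + X (i + N)) x - G t x) / of_real (X (i + N)) - dG t x)" for i
    proof -
      have "X (i + N) \<noteq> 0" using X(1) by auto
      then have "(G (t + X (i + N)) x - G t x) / of_real (X (i + N)) - dG t x
          = (G (t + X (i + N)) x - G t x - X (i + N) *\<^sub>R dG t x) / of_real (X (i + N))"
        by (simp add: scaleR_conv_of_real diff_divide_distrib)
      then show ?thesis by (simp only: norm_divide norm_of_real real_norm_def)
    qed
    ultimately have "(\<lambda>i. (G (t + X (i + N)) x - G t x) / of_real (X (i + N)) - dG t x) \<longlonglongrightarrow> 0"
      by (simp only: tendsto_norm_zero_iff)
    then show "(\<lambda>i. (G (t + X (i + N)) x - G t x) / of_real (X (i + N))) \<longlonglongrightarrow> dG t x"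
      by (rule LIM_zero_cancel)
  qed (measurable)
qed

text \<open>The three arguments of \<open>quad\<close> in the bound are the residuals of the
  equations for \<open>a\<close>, \<open>B\<close> and \<open>c\<close>. Zero residuals give an
  exact solution, bounded ones an error of order |T|.\<close>

lemma duhamel_gauss:
  assumes gen: "generates U (\<lambda>\<phi> x. \<kappa> * laplacian \<phi> x + quad v2 v1 v0 x * \<phi> x)"
    and K: "0 \<le> K" "\<And>t x. t \<in> closed_segment 0 T \<Longrightarrow>
      cmod (quad (a' t - (\<kappa> * (4 * (a t)\<^sup>2) + v2)) (\<lambda>j. B' t j - (\<kappa> * (4 * a t * B t j) + v1 j))
        (c' t - (\<kappa> * ((\<Sum>j\<in>UNIV. (B t j)\<^sup>2) + 2 * of_nat CARD('n) * a t) + v0)) x * G t x) \<le> K * decay x"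
  shows "L2norm (\<lambda>x. U T (G 0) x - G T x) \<le> K * L2norm (\<lambda>x::real^'n. of_real (decay x)) * \<bar>T\<bar>"
proof (rule duhamel[OF _ L2_G has_gen_gauss[OF gen neg] L2_dG L2_deriv_G])
  show "unitary_group U" using gen by (simp add: generates_def)
  fix t assume t: "t \<in> closed_segment 0 T"
  have "(\<lambda>x. dG t x - (\<kappa> * quad (4 * (a t)\<^sup>2) (\<lambda>j. 4 * a t * B t j) ((\<Sum>j\<in>UNIV. (B t j)\<^sup>2) + 2 * of_nat CARD('n) * a t) x
      + quad v2 v1 v0 x) * G t x)
    = (\<lambda>x. quad (a' t - (\<kappa> * (4 * (a t)\<^sup>2) + v2)) (\<lambda>j. B' t j - (\<kappa> * (4 * a t * B t j) + v1 j))
        (c' t - (\<kappa> * ((\<Sum>j\<in>UNIV. (B t j)\<^sup>2) + 2 * of_nat CARD('n) * a t) + v0)) x * G t x)"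
    unfolding quad_cmult quad_add quad_diff left_diff_distrib[symmetric] ..
  moreover have "L2norm (\<lambda>x. quad (a' t - (\<kappa> * (4 * (a t)\<^sup>2) + v2)) (\<lambda>j. B' t j - (\<kappa> * (4 * a t * B t j) + v1 j))
        (c' t - (\<kappa> * ((\<Sum>j\<in>UNIV. (B t j)\<^sup>2) + 2 * of_nat CARD('n) * a t) + v0)) x * G t x)
     \<le> K * L2norm (\<lambda>x::real^'n. of_real (decay x))"
    by (rule L2norm_decay_bound[OF _ K(2)[OF t] K(1)]) measurable
  ultimately show "L2norm (\<lambda>x. dG t x - (\<kappa> * quad (4 * (a t)\<^sup>2) (\<lambda>j. 4 * a t * B t j) ((\<Sum>j\<in>UNIV. (B t j)\<^sup>2) + 2 * of_nat CARD('n) * a t) x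
      + quad v2 v1 v0 x) * G t x) \<le> K * L2norm (\<lambda>x::real^'n. of_real (decay x))" by (simp only:)
qed

text \<open>Curves can thus be written in the variable r = t / \<tau> in [0, 1]; the factor 1 /
  \<tau> gained by the derivatives matches the size of the controls.\<close>

lemma rescale:
  assumes "\<tau> \<noteq> 0"
  shows "gauss_curve (\<lambda>t. a (t / \<tau>)) (\<lambda>t. a' (t / \<tau>) / of_real \<tau>) (\<lambda>t. c (t / \<tau>)) (\<lambda>t. c' (t / \<tau>) / of_real \<tau>)
    (\<lambda>t. B (t / \<tau>)) (\<lambda>t j. B' (t / \<tau>) j / of_real \<tau>)"
proof
  have chain: "((\<lambda>t. f (t / \<tau>)) has_vector_derivative f' / of_real \<tau>) (at t)"
    if "(f has_vector_derivative f') (at (t / \<tau>))" for f :: "real \<Rightarrow> complex" and f' t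
  proof -
    have "((\<lambda>t. t / \<tau>) has_vector_derivative 1 / \<tau>) (at t)"
      by (auto intro!: derivative_eq_intros simp: assms has_real_derivative_iff_has_vector_derivative[symmetric])
    from vector_diff_chain_at[OF this that] show ?thesis by (simp add: o_def scaleR_conv_of_real)
  qed
  have cc: "continuous_on UNIV (\<lambda>t. f (t / \<tau>) / of_real \<tau>)" if "continuous_on UNIV f" for f :: "real \<Rightarrow> complex"
    using assms by (intro continuous_intros continuous_on_compose2[OF that]) auto
  fix t j
  show "((\<lambda>t. a (t / \<tau>)) has_vector_derivative a' (t / \<tau>) / of_real \<tau>) (at t)" by (rule chain[OF da])
  show "((\<lambda>t. B (t / \<tau>) j) has_vector_derivative B' (t / \<tau>) j / of_real \<tau>) (at t)" by (rule chain[OF dB])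
  show "((\<lambda>t. c (t / \<tau>)) has_vector_derivative c' (t / \<tau>) / of_real \<tau>) (at t)" by (rule chain[OF dc])
  show "continuous_on UNIV (\<lambda>t. a' (t / \<tau>) / of_real \<tau>)" by (rule cc[OF cont_a'])
  show "continuous_on UNIV (\<lambda>t. B' (t / \<tau>) j / of_real \<tau>)" by (rule cc[OF cont_B'])
  show "continuous_on UNIV (\<lambda>t. c' (t / \<tau>) / of_real \<tau>)" by (rule cc[OF cont_c'])
  show "Re (a (t / \<tau>)) < 0" by (rule neg)
qed

end

text \<open>Under a control of size 1/\<tau> acting during time \<tau> the kinetic term is a bounded perturbation,
  because only the imaginary parts of the parameters of the curve blow up.\<close>

lemma impulsive_limit:
  fixes a a' c c' :: "real \<Rightarrow> real \<Rightarrow> complex" and B B' :: "real \<Rightarrow> real \<Rightarrow> 'n::finite \<Rightarrow> complex"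
  assumes gen: "\<And>\<tau>. \<tau> > 0 \<Longrightarrow> generates (U \<tau>) (\<lambda>\<phi> x. \<kappa> * laplacian \<phi> x + quad (v2 \<tau>) (v1 \<tau>) (v0 \<tau>) x * \<phi> x)"
    and curve: "\<And>\<tau>. \<tau> > 0 \<Longrightarrow> gauss_curve (a \<tau>) (a' \<tau>) (c \<tau>) (c' \<tau>) (B \<tau>) (B' \<tau>)"
    and re: "\<And>\<tau> r. \<tau> > 0 \<Longrightarrow> Re (a \<tau> r) = ra r" "\<And>\<tau> r j. \<tau> > 0 \<Longrightarrow> Re (B \<tau> r j) = rB r j"
      "\<And>\<tau> r. \<tau> > 0 \<Longrightarrow> Re (c \<tau> r) = rc r"
    and cont: "continuous_on {0..1} ra" "\<And>j. continuous_on {0..1} (\<lambda>r. rB r j)" "continuous_on {0..1} rc"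
      "continuous_on {0..1} \<alpha>" "\<And>j. continuous_on {0..1} (\<lambda>r. \<beta> r j)" "continuous_on {0..1} \<gamma>"
    and res: "\<And>\<tau> r. \<tau> > 0 \<Longrightarrow> a' \<tau> r / of_real \<tau> - (\<kappa> * (4 * (a \<tau> r)\<^sup>2) + v2 \<tau>) = \<alpha> r"
      "\<And>\<tau> r j. \<tau> > 0 \<Longrightarrow> B' \<tau> r j / of_real \<tau> - (\<kappa> * (4 * a \<tau> r * B \<tau> r j) + v1 \<tau> j) = \<beta> r j"
      "\<And>\<tau> r. \<tau> > 0 \<Longrightarrow> c' \<tau> r / of_real \<tau>
        - (\<kappa> * ((\<Sum>j\<in>UNIV. (B \<tau> r j)\<^sup>2) + 2 * of_nat CARD('n) * a \<tau> r) + v0 \<tau>) = \<gamma> r"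
  shows "((\<lambda>\<tau>. L2norm (\<lambda>x. U \<tau> \<tau> (gauss (a \<tau> 0) (B \<tau> 0) (c \<tau> 0)) x - gauss (a \<tau> 1) (B \<tau> 1) (c \<tau> 1) x)) \<longlongrightarrow> 0) (at_right 0)"
proof -
  \<comment> \<open>\<open>re\<close> makes the real part independent of \<tau>, so any positive
    value, here 1, reveals its sign.\<close>
  have neg: "ra r < 0" for r using gauss_curve.neg[OF curve[of 1], of r] re(1)[of 1 r] by simp
  obtain K where K: "0 \<le> K"
    "\<And>s a B c x. \<lbrakk>s \<in> {0..1}; Re a = ra s; \<And>j. Re (B j) = rB s j; Re c = rc s\<rbrakk>
      \<Longrightarrow> cmod (quad (\<alpha> s) (\<beta> s) (\<gamma> s) x * gauss a B c x) \<le> K * decay x"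
    by (rule gauss_curve_decay[of 0 1 ra rB rc \<alpha> \<beta> \<gamma>]) (use neg cont in auto)
  let ?K = "K * L2norm (\<lambda>x::real^'n. of_real (decay x))"
  have le: "L2norm (\<lambda>x. U \<tau> \<tau> (gauss (a \<tau> 0) (B \<tau> 0) (c \<tau> 0)) x - gauss (a \<tau> 1) (B \<tau> 1) (c \<tau> 1) x) \<le> ?K * \<tau>"
    if \<tau>: "\<tau> > 0" for \<tau>
  proof -
    have ne: "\<tau> \<noteq> 0" using \<tau> by simp
    interpret gauss_curve "\<lambda>t. a \<tau> (t / \<tau>)" "\<lambda>t. a' \<tau> (t / \<tau>) / of_real \<tau>" "\<lambda>t. c \<tau> (t / \<tau>)" "\<lambda>t. c' \<tau> (t / \<tau>) / of_real \<tau>"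
      "\<lambda>t. B \<tau> (t / \<tau>)" "\<lambda>t j. B' \<tau> (t / \<tau>) j / of_real \<tau>"
      by (rule gauss_curve.rescale[OF curve[OF \<tau>] ne])
    have "L2norm (\<lambda>x. U \<tau> \<tau> (G 0) x - G \<tau> x) \<le> ?K * \<bar>\<tau>\<bar>"
    proof (rule duhamel_gauss[OF gen[OF \<tau>] K(1)])
      fix t x assume "t \<in> closed_segment 0 \<tau>"
      then have "t / \<tau> \<in> {0..1}" using \<tau> by (auto simp: closed_segment_eq_real_ivl)
      then show "cmod (quad (a' \<tau> (t / \<tau>) / of_real \<tau> - (\<kappa> * (4 * (a \<tau> (t / \<tau>))\<^sup>2) + v2 \<tau>))
          (\<lambda>j. B' \<tau> (t / \<tau>) j / of_real \<tau> - (\<kappa> * (4 * a \<tau> (t / \<tau>) * B \<tau> (t / \<tau>) j) + v1 \<tau> j))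
          (c' \<tau> (t / \<tau>) / of_real \<tau> - (\<kappa> * ((\<Sum>j\<in>UNIV. (B \<tau> (t / \<tau>) j)\<^sup>2) + 2 * of_nat CARD('n) * a \<tau> (t / \<tau>)) + v0 \<tau>)) x * G t x)
        \<le> K * decay x"
        unfolding res[OF \<tau>] by (intro K(2) re \<tau>)
    qed
    then show ?thesis using \<tau> by simp
  qed
  show ?thesis
  proof (rule Lim_null_comparison)
    show "\<forall>\<^sub>F \<tau> in at_right 0. norm (L2norm (\<lambda>x. U \<tau> \<tau> (gauss (a \<tau> 0) (B \<tau> 0) (c \<tau> 0)) x - gauss (a \<tau> 1) (B \<tau> 1) (c \<tau> 1) x)) \<le> ?K * \<tau>"
      using eventually_at_right_less[of 0] by eventually_elim (use le in simp)
    have "((\<lambda>\<tau>. ?K * \<tau>) \<longlongrightarrow> ?K * 0) (at_right 0)" by (intro tendsto_intros)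
    then show "((\<lambda>\<tau>. ?K * \<tau>) \<longlongrightarrow> 0) (at_right 0)" by simp
  qed
qed

subsection \<open>Modulations, translations and dilations\<close>

definition modul :: "real \<Rightarrow> real^'n \<Rightarrow> (real^'n \<Rightarrow> complex) \<Rightarrow> real^'n \<Rightarrow> complex" where
  "modul \<alpha> p f x = exp (\<i> * of_real (\<alpha> * (norm x)\<^sup>2 + p \<bullet> x)) * f x"

definition aff :: "real \<Rightarrow> real^'n \<Rightarrow> (real^'n \<Rightarrow> complex) \<Rightarrow> real^'n \<Rightarrow> complex" where
  "aff \<sigma> \<beta> f x = of_real (\<sigma> powr (real CARD('n) / 2)) * f (\<sigma> *\<^sub>R x + \<beta>)"

lemma isom_modul: "isom (modul \<alpha> (p :: real^'n))"
  unfolding isom_def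
proof (intro conjI allI impI)
  fix f :: "real^'n \<Rightarrow> complex" assume f: "L2 f"
  have n: "cmod (modul \<alpha> p f x) = cmod (f x)" for x by (simp add: modul_def norm_mult)
  have [measurable]: "f \<in> borel_measurable borel" by (rule L2_measurable[OF f])
  have "(\<lambda>x. exp (\<i> * of_real (\<alpha> * (norm x)\<^sup>2 + p \<bullet> x))) \<in> borel_measurable borel"
    by (intro borel_measurable_continuous_onI continuous_intros)
  then have "modul \<alpha> p f \<in> borel_measurable borel" unfolding modul_def[abs_def] by measurable
  then show "L2 (modul \<alpha> p f)" "L2norm (modul \<alpha> p f) = L2norm f" using f by (auto simp: L2_def L2norm_def n)
next
  fix f g :: "real^'n \<Rightarrow> complex" and a b
  show "ae_eq (modul \<alpha> p (\<lambda>x. a * f x + b * g x)) (\<lambda>x. a * modul \<alpha> p f x + b * modul \<alpha> p g x)"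
    by (simp add: ae_eq_def modul_def algebra_simps)
qed

lemma isom_aff:
  assumes "\<sigma> > 0" shows "isom (aff \<sigma> (\<beta> :: real^'n))"
  unfolding isom_def
proof (intro conjI allI impI)
  fix f :: "real^'n \<Rightarrow> complex" assume f: "L2 f"
  let ?d = "CARD('n)"
  have sq: "(\<sigma> powr (real ?d / 2))\<^sup>2 = \<sigma> ^ ?d"
    using assms by (simp add: power2_eq_square powr_realpow flip: powr_add)
  have n: "(cmod (aff \<sigma> \<beta> f x))\<^sup>2 = \<sigma> ^ ?d *\<^sub>R (cmod (f (\<beta> + \<sigma> *\<^sub>R x)))\<^sup>2" for x
    using sq by (simp add: aff_def norm_mult power_mult_distrib add.commute)
  have [measurable]: "f \<in> borel_measurable borel" by (rule L2_measurable[OF f])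
  have lb: "lborel = density (distr lborel borel (\<lambda>x::real^'n. \<beta> + \<sigma> *\<^sub>R x)) (\<lambda>_. ennreal (\<sigma> ^ ?d))"
    using lborel_affine[of \<sigma> \<beta>] assms by (simp add: ennreal_power)
  have fm [measurable]: "(\<lambda>x. (cmod (f x))\<^sup>2) \<in> borel_measurable borel" by measurable
  have "integrable lborel (\<lambda>x. (cmod (f x))\<^sup>2) \<longleftrightarrow> integrable lborel (\<lambda>x. (cmod (aff \<sigma> \<beta> f x))\<^sup>2)"
    unfolding n by (subst lb, subst integrable_density) (use assms in \<open>auto simp: integrable_distr_eq\<close>)
  moreover have "(\<integral>x. (cmod (f x))\<^sup>2 \<partial>lborel) = (\<integral>x. (cmod (aff \<sigma> \<beta> f x))\<^sup>2 \<partial>lborel)"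
    unfolding n by (subst lb, subst integral_density) (use assms in \<open>auto simp: integral_distr\<close>)
  moreover have "aff \<sigma> \<beta> f \<in> borel_measurable borel" unfolding aff_def[abs_def] by measurable
  ultimately show "L2 (aff \<sigma> \<beta> f)" "L2norm (aff \<sigma> \<beta> f) = L2norm f" using f by (auto simp: L2_def L2norm_def)
next
  fix f g :: "real^'n \<Rightarrow> complex" and a b
  show "ae_eq (aff \<sigma> \<beta> (\<lambda>x. a * f x + b * g x)) (\<lambda>x. a * aff \<sigma> \<beta> f x + b * aff \<sigma> \<beta> g x)"
    by (simp add: ae_eq_def aff_def algebra_simps)
qed

lemma modul_gauss: "modul \<alpha> p (gauss a B c) = gauss (a + \<i> * of_real \<alpha>) (\<lambda>j. B j + \<i> * of_real (p $ j)) c"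
proof
  fix x
  have "\<i> * of_real (\<alpha> * (norm x)\<^sup>2 + p \<bullet> x) = quad (\<i> * of_real \<alpha>) (\<lambda>j. \<i> * of_real (p $ j)) 0 x"
    by (simp add: quad_def inner_vec_def sum_distrib_left algebra_simps)
  then show "modul \<alpha> p (gauss a B c) x = gauss (a + \<i> * of_real \<alpha>) (\<lambda>j. B j + \<i> * of_real (p $ j)) c x"
    unfolding modul_def gauss_def by (simp add: quad_add add.commute flip: exp_add)
qed

lemma dil_gauss:
  fixes B :: "'n::finite \<Rightarrow> complex"
  assumes "\<sigma> > 0"
  shows "aff \<sigma> 0 (gauss a B c) = gauss ((of_real \<sigma>)\<^sup>2 * a) (\<lambda>j. of_real \<sigma> * B j) (c + of_real (real CARD('n) / 2 * ln \<sigma>))"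
proof
  fix x :: "real^'n"
  have "complex_of_real (\<sigma> powr (real CARD('n) / 2)) = exp (of_real (real CARD('n) / 2 * ln \<sigma>))"
    unfolding exp_of_real using assms by (simp add: powr_def)
  moreover have "of_real (real CARD('n) / 2 * ln \<sigma>) + quad a B c (\<sigma> *\<^sub>R x + 0)
      = quad ((of_real \<sigma>)\<^sup>2 * a) (\<lambda>j. of_real \<sigma> * B j) (c + of_real (real CARD('n) / 2 * ln \<sigma>)) x"
    by (simp add: quad_def power_mult_distrib sum_distrib_left algebra_simps)
  ultimately show "aff \<sigma> 0 (gauss a B c) x = gauss ((of_real \<sigma>)\<^sup>2 * a) (\<lambda>j. of_real \<sigma> * B j) (c + of_real (real CARD('n) / 2 * ln \<sigma>)) x"
    unfolding aff_def gauss_def by (simp only: exp_add[symmetric])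
qed

lemma transl_wave:
  "aff 1 \<beta> (wave \<xi>) = gauss (-1/2) (\<lambda>j. \<i> * of_real (\<xi> $ j) - of_real (\<beta> $ j))
    (\<Sum>j\<in>UNIV. - (of_real (\<beta> $ j))\<^sup>2 / 2 + \<i> * of_real (\<xi> $ j * \<beta> $ j))"
proof
  fix x
  have n: "(norm y)\<^sup>2 = (\<Sum>j\<in>UNIV. (y $ j)\<^sup>2)" for y :: "real^'n"
    by (simp add: norm_vec_def L2_set_def sum_nonneg)
  have "quad (-1/2) (\<lambda>j. \<i> * of_real (\<xi> $ j)) 0 (x + \<beta>)
     = quad (-1/2) (\<lambda>j. \<i> * of_real (\<xi> $ j) - of_real (\<beta> $ j))
        (\<Sum>j\<in>UNIV. - (of_real (\<beta> $ j))\<^sup>2 / 2 + \<i> * of_real (\<xi> $ j * \<beta> $ j)) x"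
    unfolding quad_def n of_real_sum sum_distrib_left sum.distrib[symmetric] add_0_right
    by (rule sum.cong) (auto simp: algebra_simps power2_eq_square add_divide_distrib)
  then show "aff 1 \<beta> (wave \<xi>) x = gauss (-1/2) (\<lambda>j. \<i> * of_real (\<xi> $ j) - of_real (\<beta> $ j))
    (\<Sum>j\<in>UNIV. - (of_real (\<beta> $ j))\<^sup>2 / 2 + \<i> * of_real (\<xi> $ j * \<beta> $ j)) x"
    by (simp add: aff_def wave_def gauss_def)
qed

subsection \<open>Reachable operators\<close>

locale schrodinger =
  fixes P :: "real \<times> (real^'d) \<Rightarrow> real \<Rightarrow> (real^'d \<Rightarrow> complex) \<Rightarrow> real^'d \<Rightarrow> complex"
  assumes gen: "\<And>c. generates (P c) (\<lambda>\<phi> x. - \<i> * schrod_op c \<phi> x)"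
begin

lemma gen': "generates (P (u0, u)) (\<lambda>\<phi> x. \<i> / 2 * laplacian \<phi> x
    + quad (- \<i> * of_real u0 / 2) (\<lambda>j. - \<i> * of_real (u $ j)) 0 x * \<phi> x)"
proof -
  have "- \<i> * schrod_op (u0, u) \<phi> x = \<i> / 2 * laplacian \<phi> x
    + quad (- \<i> * of_real u0 / 2) (\<lambda>j. - \<i> * of_real (u $ j)) 0 x * \<phi> x" for \<phi> x
    by (simp add: schrod_op_def quad_def inner_vec_def sum_distrib_left sum_negf algebra_simps)
  then show ?thesis using gen[of "(u0, u)"] by simp
qed

lemma isom_P: "isom (P c t)"
  using gen[of c] unitary_group_isom[of "P c"] by (simp add: generates_def)

lemma isom_evolve: "isom (evolve P cs)"
proof (induction cs)
  case Nil
  then show ?case by (simp add: isom_def ae_eq_def)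
next
  case (Cons tc cs)
  obtain t c where tc: "tc = (t, c)" by (cases tc)
  have "evolve P (tc # cs) = (\<lambda>f. evolve P cs (P c t f))" by (simp add: tc fun_eq_iff)
  then show ?case using isom_comp[OF Cons isom_P, of c t] by simp
qed

lemma evolve_append: "evolve P (cs @ cs') f = evolve P cs' (evolve P cs f)"
  by (induction cs arbitrary: f) auto

text \<open>The control and the phase z serve finitely many states simultaneously; this is what
  allows passing to strong limits and extending from a total set of states.\<close>

definition reach :: "real \<Rightarrow> ((real^'d \<Rightarrow> complex) \<Rightarrow> real^'d \<Rightarrow> complex) \<Rightarrow> bool" where
  "reach T W \<longleftrightarrow> (\<forall>F. finite F \<and> (\<forall>f\<in>F. L2 f) \<longrightarrow> (\<forall>\<delta>>0. \<exists>cs z. (\<forall>(t, c) \<in> set cs. 0 \<le> t)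
    \<and> sum_list (map fst cs) \<le> T \<and> cmod z = 1 \<and> (\<forall>f\<in>F. L2norm (\<lambda>x. evolve P cs f x - z * W f x) < \<delta>)))"

lemma reachE:
  assumes "reach T W" "finite F" "\<And>f. f \<in> F \<Longrightarrow> L2 f" "\<delta> > 0"
  obtains cs z where "\<forall>(t, c) \<in> set cs. 0 \<le> t" "sum_list (map fst cs) \<le> T" "cmod z = 1"
    "\<And>f. f \<in> F \<Longrightarrow> L2norm (\<lambda>x. evolve P cs f x - z * W f x) < \<delta>"
proof -
  have "\<forall>f\<in>F. L2 f" using assms(3) by blast
  from assms(1)[unfolded reach_def, THEN spec, THEN mp, OF conjI[OF assms(2) this], THEN spec, THEN mp, OF assms(4)]
  show thesis using that by blast
qed

lemma reach_mono:
  assumes "reach T W" "T \<le> T'" shows "reach T' W"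
  unfolding reach_def
proof (intro allI impI)
  fix F :: "(real^'d \<Rightarrow> complex) set" and \<delta> :: real
  assume F: "finite F \<and> (\<forall>f\<in>F. L2 f)" "\<delta> > 0"
  obtain cs z where "\<forall>(t, c) \<in> set cs. 0 \<le> t" "sum_list (map fst cs) \<le> T" "cmod z = 1"
    "\<And>f. f \<in> F \<Longrightarrow> L2norm (\<lambda>x. evolve P cs f x - z * W f x) < \<delta>"
    by (rule reachE[OF assms(1), of F \<delta>]) (use F in auto)
  with assms(2) show "\<exists>cs z. (\<forall>(t, c) \<in> set cs. 0 \<le> t) \<and> sum_list (map fst cs) \<le> T' \<and> cmod z = 1
      \<and> (\<forall>f\<in>F. L2norm (\<lambda>x. evolve P cs f x - z * W f x) < \<delta>)"
    by (intro exI[of _ cs] exI[of _ z]) simp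
qed

lemma reach_P:
  assumes "0 \<le> t" shows "reach t (P c t)"
  unfolding reach_def
proof (intro allI impI)
  fix F :: "(real^'d \<Rightarrow> complex) set" and \<delta> :: real assume "\<delta> > 0"
  then show "\<exists>cs z. (\<forall>(t, c) \<in> set cs. 0 \<le> t) \<and> sum_list (map fst cs) \<le> t \<and> cmod z = 1
      \<and> (\<forall>f\<in>F. L2norm (\<lambda>x. evolve P cs f x - z * P c t f x) < \<delta>)"
    using assms by (intro exI[of _ "[(t, c)]"] exI[of _ 1]) (simp add: L2norm_def)
qed

text \<open>The second control is chosen for the exact images \<open>W1\<close> applied to F rather
  than for the approximate ones, so the two choices are independent. The second evolution is an
  isometry and transports the first error without loss; the phases multiply.\<close>

lemma reach_comp:
  assumes W1: "isom W1" "reach T1 W1" and W2: "isom W2" "reach T2 W2"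
  shows "reach (T1 + T2) (\<lambda>f. W2 (W1 f))"
  unfolding reach_def
proof (intro allI impI)
  fix F :: "(real^'d \<Rightarrow> complex) set" and \<delta> :: real
  assume F: "finite F \<and> (\<forall>f\<in>F. L2 f)" and \<delta>: "\<delta> > 0"
  obtain cs1 z1 where 1: "\<forall>(t, c) \<in> set cs1. 0 \<le> t" "sum_list (map fst cs1) \<le> T1" "cmod z1 = 1"
    "\<And>f. f \<in> F \<Longrightarrow> L2norm (\<lambda>x. evolve P cs1 f x - z1 * W1 f x) < \<delta> / 2"
    by (rule reachE[OF W1(2), of F "\<delta> / 2"]) (use F \<delta> in auto)
  obtain cs2 z2 where 2: "\<forall>(t, c) \<in> set cs2. 0 \<le> t" "sum_list (map fst cs2) \<le> T2" "cmod z2 = 1"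
    "\<And>g. g \<in> W1 ` F \<Longrightarrow> L2norm (\<lambda>x. evolve P cs2 g x - z2 * W2 g x) < \<delta> / 2"
    by (rule reachE[OF W2(2), of "W1 ` F" "\<delta> / 2"]) (use F \<delta> isom_L2[OF W1(1)] in auto)
  have "L2norm (\<lambda>x. evolve P (cs1 @ cs2) f x - z1 * z2 * W2 (W1 f) x) < \<delta>" if f: "f \<in> F" for f
  proof -
    have L: "L2 f" "L2 (W1 f)" "L2 (evolve P cs1 f)" "L2 (W2 (W1 f))" "L2 (evolve P cs2 (W1 f))" "L2 (evolve P cs2 (evolve P cs1 f))"
      using F f isom_L2[OF W1(1)] isom_L2[OF W2(1)] isom_L2[OF isom_evolve] by auto
    have "L2norm (\<lambda>x. evolve P (cs1 @ cs2) f x - z1 * z2 * W2 (W1 f) x)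
        \<le> L2norm (\<lambda>x. evolve P cs2 (evolve P cs1 f) x - z1 * evolve P cs2 (W1 f) x)
          + L2norm (\<lambda>x. z1 * evolve P cs2 (W1 f) x - z1 * z2 * W2 (W1 f) x)"
      unfolding evolve_append by (intro L2norm_triangle3 L2_cmult L)
    also have "L2norm (\<lambda>x. evolve P cs2 (evolve P cs1 f) x - z1 * evolve P cs2 (W1 f) x)
        = L2norm (\<lambda>x. evolve P cs1 f x - z1 * W1 f x)"
      using isom_norm_lincomb[OF isom_evolve[of cs2] L(3,2), of 1 "- z1"] by simp
    also have "L2norm (\<lambda>x. z1 * evolve P cs2 (W1 f) x - z1 * z2 * W2 (W1 f) x)
        = L2norm (\<lambda>x. evolve P cs2 (W1 f) x - z2 * W2 (W1 f) x)"
      using L2norm_cmult[of z1 "\<lambda>x. evolve P cs2 (W1 f) x - z2 * W2 (W1 f) x"] 1(3)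
      by (simp add: algebra_simps)
    finally show ?thesis using 1(4)[OF f] 2(4)[of "W1 f"] f by simp
  qed
  moreover have "cmod (z1 * z2) = 1" using 1(3) 2(3) by (simp add: norm_mult)
  moreover have "\<forall>(t, c) \<in> set (cs1 @ cs2). 0 \<le> t" "sum_list (map fst (cs1 @ cs2)) \<le> T1 + T2"
    using 1(1,2) 2(1,2) by auto
  ultimately show "\<exists>cs z. (\<forall>(t, c) \<in> set cs. 0 \<le> t) \<and> sum_list (map fst cs) \<le> T1 + T2 \<and> cmod z = 1
      \<and> (\<forall>f\<in>F. L2norm (\<lambda>x. evolve P cs f x - z * W2 (W1 f) x) < \<delta>)" by blast
qed

text \<open>The phases z \<tau> need not converge, but they do not depend on the state; this is what
  makes the convergence on wave packets pass to linear combinations and, by isometry, to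
  limits.\<close>

lemma reach_limit:
  fixes W' :: "real \<Rightarrow> (real^'d \<Rightarrow> complex) \<Rightarrow> real^'d \<Rightarrow> complex"
  assumes W: "isom W" and W': "\<And>\<tau>. \<tau> > 0 \<Longrightarrow> isom (W' \<tau>)" and z: "\<And>\<tau>. \<tau> > 0 \<Longrightarrow> cmod (z \<tau>) = 1"
    and reach: "\<forall>\<^sub>F \<tau> in at_right 0. reach T (W' \<tau>)"
    and lim: "\<And>\<xi>. ((\<lambda>\<tau>. L2norm (\<lambda>x. W' \<tau> (wave \<xi>) x - z \<tau> * W (wave \<xi>) x)) \<longlongrightarrow> 0) (at_right 0)"
  shows "reach T W"
proof -
  note pos = eventually_at_right_less[of "0::real"]
  have all: "((\<lambda>\<tau>. L2norm (\<lambda>x. W' \<tau> f x - z \<tau> * W f x)) \<longlongrightarrow> 0) (at_right 0)" if "L2 f" for f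
    using that
  proof (induction rule: L2_wave_induct)
    case (wave \<xi>) show ?case by (rule lim)
  next
    case (lincomb f g a b)
    let ?N = "\<lambda>\<tau> f. L2norm (\<lambda>x. W' \<tau> f x - z \<tau> * W f x)"
    show ?case
    proof (rule Lim_null_comparison)
      have "((\<lambda>\<tau>. cmod a * ?N \<tau> f + cmod b * ?N \<tau> g) \<longlongrightarrow> cmod a * 0 + cmod b * 0) (at_right 0)"
        using lincomb by (intro tendsto_intros)
      then show "((\<lambda>\<tau>. cmod a * ?N \<tau> f + cmod b * ?N \<tau> g) \<longlongrightarrow> 0) (at_right 0)" by simp
      show "\<forall>\<^sub>F \<tau> in at_right 0. norm (?N \<tau> (\<lambda>x. a * f x + b * g x)) \<le> cmod a * ?N \<tau> f + cmod b * ?N \<tau> g"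
        using pos
      proof eventually_elim
        case (elim \<tau>)
        let ?D = "\<lambda>f x. W' \<tau> f x - z \<tau> * W f x"
        have LD: "L2 (?D f)" if "L2 f" for f
          by (intro L2_diff L2_cmult isom_L2[OF W'[OF elim]] isom_L2[OF W] that)
        have "ae_eq (W' \<tau> (\<lambda>x. a * f x + b * g x)) (\<lambda>x. a * W' \<tau> f x + b * W' \<tau> g x)"
          "ae_eq (W (\<lambda>x. a * f x + b * g x)) (\<lambda>x. a * W f x + b * W g x)"
          by (rule isom_lincomb[OF W'[OF elim] lincomb(1,2)], rule isom_lincomb[OF W lincomb(1,2)])
        then have "ae_eq (?D (\<lambda>x. a * f x + b * g x)) (\<lambda>x. a * ?D f x + b * ?D g x)"
          unfolding ae_eq_def by eventually_elim (simp add: algebra_simps)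
        then have "?N \<tau> (\<lambda>x. a * f x + b * g x) = L2norm (\<lambda>x. a * ?D f x + b * ?D g x)"
          by (rule L2norm_cong_ae) (intro LD L2_add L2_cmult lincomb(1,2))+
        also have "\<dots> \<le> L2norm (\<lambda>x. a * ?D f x) + L2norm (\<lambda>x. b * ?D g x)"
          by (intro L2norm_triangle LD L2_cmult lincomb(1,2))
        finally show ?case unfolding L2norm_cmult by simp
      qed
    qed
  next
    case (limit f)
    let ?N = "\<lambda>\<tau> f. L2norm (\<lambda>x. W' \<tau> f x - z \<tau> * W f x)"
    show ?case
    proof (rule tendstoI)
      fix e :: real assume "e > 0"
      then obtain g where g: "L2 g" "((\<lambda>\<tau>. ?N \<tau> g) \<longlongrightarrow> 0) (at_right 0)" "L2norm (\<lambda>x. f x - g x) < e / 4"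
        using limit(2)[of "e / 4"] by auto
      have "\<forall>\<^sub>F \<tau> in at_right 0. ?N \<tau> g < e / 2" using \<open>e > 0\<close> by (intro order_tendstoD(2)[OF g(2)]) auto
      then show "\<forall>\<^sub>F \<tau> in at_right 0. dist (?N \<tau> f) 0 < e"
        using pos
      proof eventually_elim
        case (elim \<tau>)
        have L: "L2 (W' \<tau> f)" "L2 (W' \<tau> g)" "L2 (W f)" "L2 (W g)"
          by (intro isom_L2[OF W'[OF elim(2)]] isom_L2[OF W] limit(1) g(1))+
        have "?N \<tau> f \<le> L2norm (\<lambda>x. W' \<tau> f x - W' \<tau> g x) + L2norm (\<lambda>x. W' \<tau> g x - z \<tau> * W f x)"
          by (intro L2norm_triangle3 L L2_cmult)
        also have "L2norm (\<lambda>x. W' \<tau> f x - W' \<tau> g x) = L2norm (\<lambda>x. f x - g x)"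
          by (rule isom_norm_diff[OF W'[OF elim(2)] limit(1) g(1)])
        also have "L2norm (\<lambda>x. W' \<tau> g x - z \<tau> * W f x) \<le> ?N \<tau> g + L2norm (\<lambda>x. z \<tau> * W g x - z \<tau> * W f x)"
          by (intro L2norm_triangle3 L L2_cmult)
        also have "L2norm (\<lambda>x. z \<tau> * W g x - z \<tau> * W f x) = L2norm (\<lambda>x. f x - g x)"
          using L2norm_cmult[of "z \<tau>" "\<lambda>x. W g x - W f x"] isom_norm_diff[OF W g(1) limit(1)] z[OF elim(2)]
          by (simp add: algebra_simps L2norm_minus_commute[of g])
        finally show ?case using elim(1) g(3) by simp
      qed
    qed
  qed
  show ?thesis unfolding reach_def
  proof (intro allI impI)
    fix F :: "(real^'d \<Rightarrow> complex) set" and \<delta> :: real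
    assume F: "finite F \<and> (\<forall>f\<in>F. L2 f)" and \<delta>: "\<delta> > 0"
    \<comment> \<open>Finiteness of F is used here: a single \<tau> has to serve all its
      members.\<close>
    have "\<forall>\<^sub>F \<tau> in at_right 0. \<forall>f\<in>F. L2norm (\<lambda>x. W' \<tau> f x - z \<tau> * W f x) < \<delta> / 2"
      using F \<delta> by (intro eventually_ball_finite ballI order_tendstoD(2)[OF all]) auto
    then have "\<forall>\<^sub>F \<tau> in at_right 0. (\<forall>f\<in>F. L2norm (\<lambda>x. W' \<tau> f x - z \<tau> * W f x) < \<delta> / 2) \<and> reach T (W' \<tau>) \<and> 0 < \<tau>"
      using reach pos by eventually_elim auto
    then obtain \<tau> where \<tau>: "\<And>f. f \<in> F \<Longrightarrow> L2norm (\<lambda>x. W' \<tau> f x - z \<tau> * W f x) < \<delta> / 2" "reach T (W' \<tau>)" "0 < \<tau>"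
      using eventually_happens'[OF trivial_limit_at_right_real[of "0::real"]] by blast
    obtain cs z' where c: "\<forall>(t, c) \<in> set cs. 0 \<le> t" "sum_list (map fst cs) \<le> T" "cmod z' = 1"
      "\<And>f. f \<in> F \<Longrightarrow> L2norm (\<lambda>x. evolve P cs f x - z' * W' \<tau> f x) < \<delta> / 2"
      by (rule reachE[OF \<tau>(2), of F "\<delta> / 2"]) (use F \<delta> in auto)
    have "L2norm (\<lambda>x. evolve P cs f x - (z' * z \<tau>) * W f x) < \<delta>" if f: "f \<in> F" for f
    proof -
      have Lf: "L2 f" using F f by blast
      have L: "L2 (W' \<tau> f)" "L2 (W f)" "L2 (evolve P cs f)"
        by (intro isom_L2[OF W'[OF \<tau>(3)]] isom_L2[OF W] isom_L2[OF isom_evolve] Lf)+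
      have "L2norm (\<lambda>x. evolve P cs f x - (z' * z \<tau>) * W f x)
          \<le> L2norm (\<lambda>x. evolve P cs f x - z' * W' \<tau> f x) + L2norm (\<lambda>x. z' * W' \<tau> f x - (z' * z \<tau>) * W f x)"
        by (intro L2norm_triangle3 L2_cmult L)
      also have "L2norm (\<lambda>x. z' * W' \<tau> f x - (z' * z \<tau>) * W f x) = L2norm (\<lambda>x. W' \<tau> f x - z \<tau> * W f x)"
        using L2norm_cmult[of z' "\<lambda>x. W' \<tau> f x - z \<tau> * W f x"] c(3) by (simp add: algebra_simps)
      finally show ?thesis using \<tau>(1)[OF f] c(4)[OF f] by simp
    qed
    moreover have "cmod (z' * z \<tau>) = 1" using c(3) z[OF \<tau>(3)] by (simp add: norm_mult)
    ultimately show "\<exists>cs z. (\<forall>(t, c) \<in> set cs. 0 \<le> t) \<and> sum_list (map fst cs) \<le> T \<and> cmod z = 1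
        \<and> (\<forall>f\<in>F. L2norm (\<lambda>x. evolve P cs f x - z * W f x) < \<delta>)" using c(1,2) by blast
  qed
qed

section \<open>Operators reachable in arbitrarily small time\<close>

definition small_reach :: "((real^'d \<Rightarrow> complex) \<Rightarrow> real^'d \<Rightarrow> complex) \<Rightarrow> bool" where
  "small_reach W \<longleftrightarrow> isom W \<and> (\<forall>T>0. reach T W)"

lemma small_reach_comp:
  assumes "small_reach V" "small_reach W" shows "small_reach (\<lambda>f. V (W f))"
  unfolding small_reach_def
proof (intro conjI allI impI)
  show "isom (\<lambda>f. V (W f))" using assms isom_comp unfolding small_reach_def by blast
  fix T :: real assume "T > 0"
  then have "reach (T / 2) V" "reach (T / 2) W" using assms by (auto simp: small_reach_def)
  then show "reach T (\<lambda>f. V (W f))"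
    using reach_comp[of W "T / 2" V "T / 2"] assms by (simp add: small_reach_def)
qed

text \<open>V \<tau> and V' \<tau> may degenerate as \<tau> tends to 0, but for each fixed \<tau>
  they can be realised within T / 3. Only the propagator between them takes time \<tau>, which is
  eventually below T / 3 as well.\<close>

lemma small_reach_limit:
  assumes V: "\<And>\<tau>. \<tau> > 0 \<Longrightarrow> small_reach (V \<tau>)" and V': "\<And>\<tau>. \<tau> > 0 \<Longrightarrow> small_reach (V' \<tau>)"
    and z: "\<And>\<tau>. \<tau> > 0 \<Longrightarrow> cmod (z \<tau>) = 1" and W: "isom W"
    and lim: "\<And>\<xi>. ((\<lambda>\<tau>. L2norm (\<lambda>x. V' \<tau> (P (u \<tau>) \<tau> (V \<tau> (wave \<xi>))) x - z \<tau> * W (wave \<xi>) x)) \<longlongrightarrow> 0) (at_right 0)"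
  shows "small_reach W"
  unfolding small_reach_def
proof (intro conjI allI impI)
  fix T :: real assume T: "T > 0"
  show "reach T W"
  proof (rule reach_limit[OF W _ z _ lim])
    show "isom (\<lambda>f. V' \<tau> (P (u \<tau>) \<tau> (V \<tau> f)))" if "\<tau> > 0" for \<tau>
    proof -
      have "isom (V \<tau>)" "isom (V' \<tau>)" using V V' that by (auto simp: small_reach_def)
      then show ?thesis using isom_comp[of "V' \<tau>" "\<lambda>f. P (u \<tau>) \<tau> (V \<tau> f)"] isom_comp[OF isom_P] by blast
    qed
    have "\<forall>\<^sub>F \<tau> in at_right 0. \<tau> < T / 3" using T by (intro order_tendstoD(2)[OF tendsto_ident_at]) auto
    then show "\<forall>\<^sub>F \<tau> in at_right 0. reach T (\<lambda>f. V' \<tau> (P (u \<tau>) \<tau> (V \<tau> f)))"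
      using eventually_at_right_less[of "0::real"]
    proof eventually_elim
      case (elim \<tau>)
      have i: "isom (V \<tau>)" "isom (V' \<tau>)" and r: "reach (T / 3) (V \<tau>)" "reach (T / 3) (V' \<tau>)"
        using V[OF elim(2)] V'[OF elim(2)] T by (auto simp: small_reach_def)
      have "reach (T / 3 + \<tau>) (\<lambda>f. P (u \<tau>) \<tau> (V \<tau> f))"
        by (rule reach_comp[OF i(1) r(1) isom_P reach_P]) (use elim in simp)
      from reach_comp[OF isom_comp[OF isom_P i(1)] this i(2) r(2)]
      show ?case by (rule reach_mono) (use elim in simp)
    qed
  qed
qed (rule W)

lemma small_reach_id: "small_reach (\<lambda>f. f)"
  unfolding small_reach_def
proof (intro conjI allI impI)
  show "isom (\<lambda>f. f :: real^'d \<Rightarrow> complex)" by (simp add: isom_def ae_eq_def)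
  fix T :: real assume "T > 0"
  then show "reach T (\<lambda>f. f)"
    unfolding reach_def by (intro allI impI exI[of _ "[]"] exI[of _ 1]) simp
qed

text \<open>The control integrates over time \<tau> to the potential - \<alpha> |x|^2 - p.x, whose
  propagator is the modulation; the factor 2 compensates the 1/2 in front of u0.\<close>

lemma small_reach_modul: "small_reach (modul \<alpha> p)"
proof (rule small_reach_limit[where V="\<lambda>_ f. f" and V'="\<lambda>_ f. f" and z="\<lambda>_. 1" and u="\<lambda>\<tau>. (- 2 * \<alpha> / \<tau>, - (1 / \<tau>) *\<^sub>R p)"])
  fix \<xi> :: "real^'d"
  \<comment> \<open>The solution with the kinetic term left out: the packet modulated by r \<alpha>
    and r p. The residuals given to \<open>impulsive_limit\<close> are therefore exactly minus the
    kinetic contribution.\<close>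
  define a B where "a r = -1/2 + \<i> * of_real (\<alpha> * r)" and "B r j = \<i> * of_real (\<xi> $ j + r * p $ j)" for r j
  have "((\<lambda>\<tau>. L2norm (\<lambda>x. P (- 2 * \<alpha> / \<tau>, - (1 / \<tau>) *\<^sub>R p) \<tau> (gauss (a 0) (B 0) 0) x - gauss (a 1) (B 1) 0 x)) \<longlongrightarrow> 0) (at_right 0)"
  proof (rule impulsive_limit[where a="\<lambda>_. a" and B="\<lambda>_. B" and c="\<lambda>_ _. 0" and c'="\<lambda>_ _. 0"
        and a'="\<lambda>_ _. \<i> * of_real \<alpha>" and B'="\<lambda>_ _ j. \<i> * of_real (p $ j)" and ra="\<lambda>_. -1/2" and rB="\<lambda>_ _. 0" and rc="\<lambda>_. 0"
        and \<alpha>="\<lambda>r. - 2 * \<i> * (a r)\<^sup>2" and \<beta>="\<lambda>r j. - 2 * \<i> * a r * B r j"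
        and \<gamma>="\<lambda>r. - (\<i> / 2 * ((\<Sum>j\<in>UNIV. (B r j)\<^sup>2) + 2 * of_nat CARD('d) * a r))", OF gen'])
    show "gauss_curve a (\<lambda>_. \<i> * of_real \<alpha>) (\<lambda>_. 0) (\<lambda>_. 0) B (\<lambda>_ j. \<i> * of_real (p $ j))"
      unfolding a_def B_def
      by unfold_locales (auto intro!: derivative_eq_intros has_vector_derivative_real_field
          simp: of_real_mult has_vector_derivative_def scaleR_conv_of_real algebra_simps)
  qed (auto simp: a_def B_def field_simps intro!: continuous_intros)
  moreover have "gauss (a 0) (B 0) 0 = wave \<xi>" by (simp add: a_def B_def[abs_def] wave_def)
  moreover have "gauss (a 1) (B 1) 0 = modul \<alpha> p (wave \<xi>)"
    by (simp add: a_def B_def[abs_def] wave_def modul_gauss algebra_simps)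
  ultimately show "((\<lambda>\<tau>. L2norm (\<lambda>x. P (- 2 * \<alpha> / \<tau>, - (1 / \<tau>) *\<^sub>R p) \<tau> (wave \<xi>) x - 1 * modul \<alpha> p (wave \<xi>) x)) \<longlongrightarrow> 0) (at_right 0)"
    by simp
qed (use small_reach_id isom_modul in auto)

text \<open>A packet with additional momentum - \<beta> / \<tau> moves by - \<beta> during time
  \<tau>, which turns f (x) into f (x + \<beta>). Its kinetic energy |\<beta>|^2 / (2 \<tau>^2)
  acting for time \<tau> leaves the divergent phase in \<open>z\<close>.\<close>

lemma small_reach_transl: "small_reach (aff 1 \<beta>)"
proof (rule small_reach_limit[where V="\<lambda>\<tau>. modul 0 (- (1 / \<tau>) *\<^sub>R \<beta>)" and V'="\<lambda>\<tau>. modul 0 ((1 / \<tau>) *\<^sub>R \<beta>)"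
      and z="\<lambda>\<tau>. exp (\<i> * of_real (- (norm \<beta>)\<^sup>2 / (2 * \<tau>)))" and u="\<lambda>_. (0, 0)"])
  fix \<xi> :: "real^'d"
  define p where "p = - \<beta>"
  \<comment> \<open>The packet centred at r p with momentum \<xi> + p / \<tau>. Its spreading is
    ignored, so the quadratic coefficient stays -1/2; the terms in 1 / \<tau> cancel in all
    residuals.\<close>
  define B where "B = (\<lambda>\<tau> r j. \<i> * of_real (\<xi> $ j + p $ j / \<tau>) + of_real (r * p $ j))"
  define c where "c = (\<lambda>\<tau> r. \<Sum>j\<in>UNIV. of_real (- r\<^sup>2 * (p $ j)\<^sup>2 / 2) - \<i> * of_real (r * (\<xi> $ j * p $ j + (p $ j)\<^sup>2 / (2 * \<tau>))))"
  define c' where "c' = (\<lambda>\<tau> r. \<Sum>j\<in>UNIV. of_real (- r * (p $ j)\<^sup>2) - \<i> * of_real (\<xi> $ j * p $ j + (p $ j)\<^sup>2 / (2 * \<tau>)))"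
  let ?u = "(0, 0) :: real \<times> (real^'d)"
  have "((\<lambda>\<tau>. L2norm (\<lambda>x. P ?u \<tau> (gauss (-1/2) (B \<tau> 0) (c \<tau> 0)) x - gauss (-1/2) (B \<tau> 1) (c \<tau> 1) x)) \<longlongrightarrow> 0) (at_right 0)"
  proof (rule impulsive_limit[where a="\<lambda>_ _. -1/2" and B=B and c=c and c'=c'
        and a'="\<lambda>_ _. 0" and B'="\<lambda>_ _ j. of_real (p $ j)" and ra="\<lambda>_. -1/2" and rB="\<lambda>r j. r * p $ j"
        and rc="\<lambda>r. \<Sum>j\<in>UNIV. - r\<^sup>2 * (p $ j)\<^sup>2 / 2"
        and \<alpha>="\<lambda>r. - \<i> / 2" and \<beta>="\<lambda>r j. - of_real (\<xi> $ j) + \<i> * of_real (r * p $ j)"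
        and \<gamma>="\<lambda>r. \<Sum>j\<in>UNIV. \<i> / 2 - \<i> / 2 * (\<i> * of_real (\<xi> $ j) + of_real (r * p $ j))\<^sup>2", OF gen'])
    show "gauss_curve (\<lambda>_. -1/2) (\<lambda>_. 0) (c \<tau>) (c' \<tau>) (B \<tau>) (\<lambda>_ j. of_real (p $ j))" if "\<tau> > 0" for \<tau>
    proof
      show "((\<lambda>r. B \<tau> r j) has_vector_derivative of_real (p $ j)) (at r)" for r j
        unfolding B_def by (auto intro!: derivative_eq_intros has_vector_derivative_real_field simp: has_vector_derivative_def scaleR_conv_of_real)
      show "(c \<tau> has_vector_derivative c' \<tau> r) (at r)" for r
        unfolding c_def c'_def
        by (intro has_vector_derivative_sum has_vector_derivative_diff has_vector_derivative_mult_right has_vector_derivative_of_real)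
          (auto intro!: derivative_eq_intros simp: has_real_derivative_iff_has_vector_derivative[symmetric])
    qed (auto simp: c'_def intro!: continuous_intros)
    show "of_real (p $ j) / of_real \<tau> - (\<i> / 2 * (4 * (- 1 / 2) * B \<tau> r j) + - \<i> * of_real ((0 :: real^'d) $ j))
        = - of_real (\<xi> $ j) + \<i> * of_real (r * p $ j)" if "\<tau> > 0" for \<tau> r j
      using that by (simp add: B_def algebra_simps)
    show "c' \<tau> r / of_real \<tau> - (\<i> / 2 * ((\<Sum>j\<in>UNIV. (B \<tau> r j)\<^sup>2) + 2 * of_nat CARD('d) * (- 1 / 2)) + 0)
        = (\<Sum>j\<in>UNIV. \<i> / 2 - \<i> / 2 * (\<i> * of_real (\<xi> $ j) + of_real (r * p $ j))\<^sup>2)" if "\<tau> > 0" for \<tau> r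
    proof -
      have "c' \<tau> r / of_real \<tau> - (\<i> / 2 * ((\<Sum>j\<in>UNIV. (B \<tau> r j)\<^sup>2) + 2 * of_nat CARD('d) * (- 1 / 2)) + 0)
        = c' \<tau> r / of_real \<tau> - \<i> / 2 * ((\<Sum>j\<in>UNIV. (B \<tau> r j)\<^sup>2 - 1))"
        by (simp add: sum_subtractf)
      also have "\<dots> = (\<Sum>j\<in>UNIV. (of_real (- r * (p $ j)\<^sup>2) - \<i> * of_real (\<xi> $ j * p $ j + (p $ j)\<^sup>2 / (2 * \<tau>))) / of_real \<tau>
          - \<i> / 2 * ((B \<tau> r j)\<^sup>2 - 1))"
        unfolding c'_def sum_divide_distrib sum_distrib_left sum_subtractf[symmetric] ..
      also have "\<dots> = (\<Sum>j\<in>UNIV. \<i> / 2 - \<i> / 2 * (\<i> * of_real (\<xi> $ j) + of_real (r * p $ j))\<^sup>2)"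
      proof (rule sum.cong)
        fix j
        show "(of_real (- r * (p $ j)\<^sup>2) - \<i> * of_real (\<xi> $ j * p $ j + (p $ j)\<^sup>2 / (2 * \<tau>))) / of_real \<tau>
          - \<i> / 2 * ((B \<tau> r j)\<^sup>2 - 1) = \<i> / 2 - \<i> / 2 * (\<i> * of_real (\<xi> $ j) + of_real (r * p $ j))\<^sup>2"
          using that unfolding B_def complex_eq_iff by (simp add: power2_eq_square field_simps)
      qed simp
      finally show ?thesis .
    qed
  qed (auto simp: B_def c_def power2_eq_square intro!: continuous_intros)
  moreover have "modul 0 (- (1 / \<tau>) *\<^sub>R \<beta>) (wave \<xi>) = gauss (-1/2) (B \<tau> 0) (c \<tau> 0)" for \<tau>
    by (simp add: wave_def modul_gauss B_def c_def p_def algebra_simps)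
  \<comment> \<open>The second modulation is an isometry, so it may be applied to both states inside
    the norm; on the Gaussian it cancels the momentum p / \<tau>.\<close>
  moreover have "L2norm (\<lambda>x. P ?u \<tau> g x - gauss (-1/2) (B \<tau> 1) (c \<tau> 1) x)
      = L2norm (\<lambda>x. modul 0 ((1 / \<tau>) *\<^sub>R \<beta>) (P ?u \<tau> g) x - exp (\<i> * of_real (- (norm \<beta>)\<^sup>2 / (2 * \<tau>))) * aff 1 \<beta> (wave \<xi>) x)"
    if "L2 g" for \<tau> g
  proof -
    have n: "(norm \<beta>)\<^sup>2 = (\<Sum>j\<in>UNIV. (\<beta> $ j)\<^sup>2)" by (simp add: norm_vec_def L2_set_def sum_nonneg)
    have cc: "c \<tau> 1 = \<i> * of_real (- (norm \<beta>)\<^sup>2 / (2 * \<tau>))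
        + (\<Sum>j\<in>UNIV. - (of_real (\<beta> $ j))\<^sup>2 / 2 + \<i> * of_real (\<xi> $ j * \<beta> $ j))"
    proof -
      have "\<i> * of_real (- (norm \<beta>)\<^sup>2 / (2 * \<tau>)) = (\<Sum>j\<in>UNIV. \<i> * of_real (- (\<beta> $ j)\<^sup>2 / (2 * \<tau>)))"
        unfolding n by (simp add: sum_negf sum_distrib_left sum_divide_distrib)
      then show ?thesis unfolding c_def p_def by (simp add: algebra_simps flip: sum.distrib)
    qed
    have "modul 0 ((1 / \<tau>) *\<^sub>R \<beta>) (gauss (-1/2) (B \<tau> 1) (c \<tau> 1)) x
        = exp (\<i> * of_real (- (norm \<beta>)\<^sup>2 / (2 * \<tau>))) * aff 1 \<beta> (wave \<xi>) x" for x
      unfolding modul_gauss transl_wave gauss_def quad_def cc exp_add[symmetric]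
      by (rule arg_cong[where f=exp]) (simp add: B_def p_def algebra_simps)
    then show ?thesis
      using isom_norm_diff[OF isom_modul isom_L2[OF isom_P that] L2_gauss, of "-1/2" 0 "(1 / \<tau>) *\<^sub>R \<beta>" ?u \<tau> "B \<tau> 1" "c \<tau> 1"]
      by simp
  qed
  ultimately show "((\<lambda>\<tau>. L2norm (\<lambda>x. modul 0 ((1 / \<tau>) *\<^sub>R \<beta>) (P ?u \<tau> (modul 0 (- (1 / \<tau>) *\<^sub>R \<beta>) (wave \<xi>))) x
      - exp (\<i> * of_real (- (norm \<beta>)\<^sup>2 / (2 * \<tau>))) * aff 1 \<beta> (wave \<xi>) x)) \<longlongrightarrow> 0) (at_right 0)"
    by (simp add: L2_gauss)
qed (use small_reach_modul isom_aff[of 1 \<beta>] in auto)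

text \<open>The phase s |x|^2 / (2 \<tau>) has the velocity field s x / \<tau>, which stretches
  space by exp s = 1 / \<sigma> in time \<tau>. The inverted potential of strength - s^2 / \<tau>^2
  balances the kinetic energy of this field, so the phase stays constant and the second modulation
  removes it.\<close>

lemma small_reach_dil:
  assumes "\<sigma> > 0" shows "small_reach (aff \<sigma> 0)"
proof -
  define s where "s = - ln \<sigma>"
  have \<sigma>: "\<sigma> = exp (- s)" using assms by (simp add: s_def)
  show ?thesis
  proof (rule small_reach_limit[where V="\<lambda>\<tau>. modul (s / (2 * \<tau>)) 0" and V'="\<lambda>\<tau>. modul (- s / (2 * \<tau>)) 0"
      and z="\<lambda>\<tau>. 1" and u="\<lambda>\<tau>. (- s\<^sup>2 / \<tau>\<^sup>2, 0)"])
    fix \<xi> :: "real^'d"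
    \<comment> \<open>The imaginary part s / (2 \<tau>) is kept throughout, while the real part
      follows the dilation by exp (- s r). The constant \<open>c\<close> below is real: it carries
      the L2 normalisation of the dilated packet and no phase.\<close>
    define a where "a = (\<lambda>\<tau> r. of_real (- exp (- 2 * s * r) / 2) + \<i> * of_real (s / (2 * \<tau>)))"
    define B where "B = (\<lambda>r j. \<i> * of_real (\<xi> $ j * exp (- s * r)))"
    define c where "c = (\<lambda>r. complex_of_real (- s * real CARD('d) * r / 2))"
    have "((\<lambda>\<tau>. L2norm (\<lambda>x. P (- s\<^sup>2 / \<tau>\<^sup>2, 0) \<tau> (gauss (a \<tau> 0) (B 0) (c 0)) x - gauss (a \<tau> 1) (B 1) (c 1) x)) \<longlongrightarrow> 0) (at_right 0)"
    proof (rule impulsive_limit[where a=a and B="\<lambda>_. B" and c="\<lambda>_. c" and c'="\<lambda>_ _. of_real (- s * real CARD('d) / 2)"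
          and a'="\<lambda>_ r. of_real (s * exp (- 2 * s * r))" and B'="\<lambda>_ r j. \<i> * of_real (- s * (\<xi> $ j * exp (- s * r)))"
          and ra="\<lambda>r. - exp (- 2 * s * r) / 2" and rB="\<lambda>r j. 0" and rc="\<lambda>r. - s * real CARD('d) * r / 2"
          and \<alpha>="\<lambda>r. - \<i> * of_real (exp (- 2 * s * r) * exp (- 2 * s * r)) / 2"
          and \<beta>="\<lambda>r j. - of_real (\<xi> $ j * exp (- s * r) * exp (- 2 * s * r))"
          and \<gamma>="\<lambda>r. - \<i> / 2 * (\<Sum>j\<in>UNIV. (B r j)\<^sup>2) + \<i> / 2 * of_nat CARD('d) * of_real (exp (- 2 * s * r))", OF gen'])
      show "gauss_curve (a \<tau>) (\<lambda>r. of_real (s * exp (- 2 * s * r))) c (\<lambda>_. of_real (- s * real CARD('d) / 2)) B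
          (\<lambda>r j. \<i> * of_real (- s * (\<xi> $ j * exp (- s * r))))" if "\<tau> > 0" for \<tau>
      proof
        show "(a \<tau> has_vector_derivative of_real (s * exp (- 2 * s * r))) (at r)" for r
          unfolding a_def
          by (rule has_vector_derivative_eq_rhs, rule has_vector_derivative_add, rule has_vector_derivative_of_real)
            (auto intro!: derivative_eq_intros simp: has_real_derivative_iff_has_vector_derivative[symmetric])
        show "((\<lambda>r. B r j) has_vector_derivative \<i> * of_real (- s * (\<xi> $ j * exp (- s * r)))) (at r)" for r j
          unfolding B_def by (intro has_vector_derivative_mult_right has_vector_derivative_of_real)
            (auto intro!: derivative_eq_intros simp: has_real_derivative_iff_has_vector_derivative[symmetric])
        show "(c has_vector_derivative of_real (- s * real CARD('d) / 2)) (at r)" for r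
          unfolding c_def by (intro has_vector_derivative_of_real)
            (auto intro!: derivative_eq_intros simp: has_real_derivative_iff_has_vector_derivative[symmetric])
      qed (auto simp: a_def intro!: continuous_intros)
    qed (auto simp: a_def B_def c_def complex_eq_iff power2_eq_square field_simps intro!: continuous_intros)
    moreover have "modul (s / (2 * \<tau>)) 0 (wave \<xi>) = gauss (a \<tau> 0) (B 0) (c 0)" for \<tau>
      by (simp add: wave_def modul_gauss a_def B_def c_def algebra_simps)
    moreover have "L2norm (\<lambda>x. P (- s\<^sup>2 / \<tau>\<^sup>2, 0) \<tau> g x - gauss (a \<tau> 1) (B 1) (c 1) x)
        = L2norm (\<lambda>x. modul (- s / (2 * \<tau>)) 0 (P (- s\<^sup>2 / \<tau>\<^sup>2, 0) \<tau> g) x - 1 * aff \<sigma> 0 (wave \<xi>) x)" if "L2 g" for \<tau> g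
    proof -
      have "modul (- s / (2 * \<tau>)) 0 (gauss (a \<tau> 1) (B 1) (c 1)) = aff \<sigma> 0 (wave \<xi>)"
        unfolding wave_def dil_gauss[OF assms] modul_gauss
        by (simp add: a_def B_def c_def \<sigma> exp_of_real power2_eq_square algebra_simps flip: exp_add of_real_mult)
      moreover have "Re (a \<tau> 1) < 0" by (simp add: a_def)
      ultimately show ?thesis
        using isom_norm_diff[OF isom_modul isom_L2[OF isom_P that] L2_gauss, of "a \<tau> 1" "- s / (2 * \<tau>)" 0 "(- s\<^sup>2 / \<tau>\<^sup>2, 0)" \<tau> "B 1" "c 1"]
        by simp
    qed
    moreover have "Re (a \<tau> 0) < 0" for \<tau> by (simp add: a_def)
    ultimately show "((\<lambda>\<tau>. L2norm (\<lambda>x. modul (- s / (2 * \<tau>)) 0 (P (- s\<^sup>2 / \<tau>\<^sup>2, 0) \<tau> (modul (s / (2 * \<tau>)) 0 (wave \<xi>))) x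
      - 1 * aff \<sigma> 0 (wave \<xi>) x)) \<longlongrightarrow> 0) (at_right 0)"
      by (simp add: L2_gauss)
  qed (use small_reach_modul isom_aff assms in auto)
qed

text \<open>The wave packets of fixed width are the coherent states of the harmonic oscillator, whose
  evolution is explicit and, up to a phase, periodic.\<close>

lemma oscillator_wave:
  assumes "l > 0"
  shows "L2norm (\<lambda>x. P (l ^ 4, 0) (\<theta> / l\<^sup>2) (aff l 0 (wave \<xi>)) x
    - gauss (of_real (- l\<^sup>2 / 2)) (\<lambda>j. \<i> * of_real (l * \<xi> $ j) * exp (- \<i> * of_real \<theta>))
      (of_real ((norm \<xi>)\<^sup>2 / 4) * (exp (- 2 * \<i> * of_real \<theta>) - 1)
        - \<i> * of_real (real CARD('d) * \<theta> / 2) + of_real (real CARD('d) / 2 * ln l)) x) = 0"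
proof -
  \<comment> \<open>Strength l^4 means frequency l^2, and the ground state exp (- l^2 |x|^2 / 2) has
    the width of the dilated packet. Hence the quadratic coefficient stays fixed, and time \<theta>
    / l^2 is a rotation by \<theta>.\<close>
  define w where "w = - \<i> * of_real (l\<^sup>2)"
  define B where "B = (\<lambda>t j. \<i> * of_real (l * \<xi> $ j) * exp (w * of_real t))"
  define B' where "B' = (\<lambda>t j. \<i> * of_real (l * \<xi> $ j) * (w * exp (w * of_real t)))"
  define c where "c = (\<lambda>t. of_real ((norm \<xi>)\<^sup>2 / 4) * (exp (2 * w * of_real t) - 1)
        + w * of_real (real CARD('d) / 2) * of_real t + of_real (real CARD('d) / 2 * ln l))"
  define c' where "c' = (\<lambda>t. of_real ((norm \<xi>)\<^sup>2 / 4) * (2 * w * exp (2 * w * of_real t))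
        + w * of_real (real CARD('d) / 2))"
  have de: "((\<lambda>t. exp (v * of_real t)) has_vector_derivative v * exp (v * of_real t)) (at t)" for v :: complex and t
    by (rule has_vector_derivative_real_field) (auto intro!: derivative_eq_intros)
  have dt: "((\<lambda>t. v * of_real t) has_vector_derivative v) (at t)" for v :: complex and t
    by (rule has_vector_derivative_real_field) (auto intro!: derivative_eq_intros)
  interpret gauss_curve "\<lambda>_. of_real (- l\<^sup>2 / 2)" "\<lambda>_. 0" c c' B B'
  proof
    show "((\<lambda>t. B t j) has_vector_derivative B' t j) (at t)" for t j
      unfolding B_def B'_def by (intro has_vector_derivative_mult_right de)
    have "(c has_vector_derivative of_real ((norm \<xi>)\<^sup>2 / 4) * (2 * w * exp (2 * w * of_real t) - 0)
        + w * of_real (real CARD('d) / 2) + 0) (at t)" for t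
      unfolding c_def by (intro has_vector_derivative_add has_vector_derivative_diff has_vector_derivative_mult_right de dt has_vector_derivative_const)
    then show "(c has_vector_derivative c' t) (at t)" for t by (simp add: c'_def)
    show "continuous_on UNIV (\<lambda>t. B' t j)" for j unfolding B'_def by (intro continuous_intros)
    show "continuous_on UNIV c'" unfolding c'_def by (intro continuous_intros)
    show "Re (of_real (- l\<^sup>2 / 2)) < 0" using assms by simp
  qed simp_all
  have n: "complex_of_real ((norm \<xi>)\<^sup>2) = (\<Sum>j\<in>UNIV. (of_real (\<xi> $ j))\<^sup>2)"
    by (simp add: norm_vec_def L2_set_def sum_nonneg)
  have BB: "(\<Sum>j\<in>UNIV. (B t j)\<^sup>2) = - of_real (l\<^sup>2) * of_real ((norm \<xi>)\<^sup>2) * exp (2 * w * of_real t)" for t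
  proof -
    have "(exp (w * of_real t))\<^sup>2 = exp (2 * w * of_real t)"
      by (simp add: mult.assoc flip: exp_double)
    then have "(B t j)\<^sup>2 = - of_real (l\<^sup>2) * exp (2 * w * of_real t) * (of_real (\<xi> $ j))\<^sup>2" for j
      by (simp add: B_def power_mult_distrib)
    then have "(\<Sum>j\<in>UNIV. (B t j)\<^sup>2) = - of_real (l\<^sup>2) * exp (2 * w * of_real t) * (\<Sum>j\<in>UNIV. (of_real (\<xi> $ j))\<^sup>2)"
      by (simp only: sum_distrib_left)
    then show ?thesis unfolding n by (simp only: mult_ac)
  qed
  \<comment> \<open>The curve solves the equation exactly, so Duhamel's estimate applies with K = 0
    and the distance vanishes.\<close>
  have "L2norm (\<lambda>x. P (l ^ 4, 0) (\<theta> / l\<^sup>2) (G 0) x - G (\<theta> / l\<^sup>2) x) \<le> 0 * L2norm (\<lambda>x::real^'d. of_real (decay x)) * \<bar>\<theta> / l\<^sup>2\<bar>"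
  proof (rule duhamel_gauss[OF gen' order_refl])
    fix t and x :: "real^'d"
    have 1: "0 - (\<i> / 2 * (4 * (of_real (- l\<^sup>2 / 2))\<^sup>2) + - \<i> * of_real (l ^ 4) / 2) = 0"
      by (simp add: power2_eq_square power4_eq_xxxx)
    have 2: "B' t j - (\<i> / 2 * (4 * of_real (- l\<^sup>2 / 2) * B t j) + - \<i> * of_real ((0 :: real^'d) $ j)) = 0" for j
      by (simp add: B'_def B_def w_def)
    have 3: "c' t - (\<i> / 2 * ((\<Sum>j\<in>UNIV. (B t j)\<^sup>2) + 2 * of_nat CARD('d) * of_real (- l\<^sup>2 / 2)) + 0) = 0"
      unfolding BB c'_def w_def[symmetric] by (simp add: w_def algebra_simps)
    show "cmod (quad (0 - (\<i> / 2 * (4 * (of_real (- l\<^sup>2 / 2))\<^sup>2) + - \<i> * of_real (l ^ 4) / 2))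
        (\<lambda>j. B' t j - (\<i> / 2 * (4 * of_real (- l\<^sup>2 / 2) * B t j) + - \<i> * of_real ((0 :: real^'d) $ j)))
        (c' t - (\<i> / 2 * ((\<Sum>j\<in>UNIV. (B t j)\<^sup>2) + 2 * of_nat CARD('d) * of_real (- l\<^sup>2 / 2)) + 0)) x * G t x) \<le> 0 * decay x"
      unfolding 1 2 3 by (simp add: quad_def)
  qed
  then have "L2norm (\<lambda>x. P (l ^ 4, 0) (\<theta> / l\<^sup>2) (G 0) x - G (\<theta> / l\<^sup>2) x) = 0"
    using L2norm_nonneg by (simp add: order_antisym)
  moreover have "G 0 = aff l 0 (wave \<xi>)"
    unfolding wave_def dil_gauss[OF assms] by (simp add: B_def c_def algebra_simps)
  moreover have "G (\<theta> / l\<^sup>2) = gauss (of_real (- l\<^sup>2 / 2)) (\<lambda>j. \<i> * of_real (l * \<xi> $ j) * exp (- \<i> * of_real \<theta>))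
      (of_real ((norm \<xi>)\<^sup>2 / 4) * (exp (- 2 * \<i> * of_real \<theta>) - 1)
        - \<i> * of_real (real CARD('d) * \<theta> / 2) + of_real (real CARD('d) / 2 * ln l))"
    using assms by (simp add: B_def c_def w_def mult.assoc)
  ultimately show ?thesis by simp
qed

end

text \<open>The complex width 1 + 2 i s has real part 1 and never meets the branch cut of
  \<open>Ln\<close>, so the normalisation (1 + 2 i s)^(-d/2) is smooth in s in every dimension d.
  The curve has zero residual and is therefore the true evolution.\<close>

lemma free_wave:
  fixes \<xi> :: "real^'n"
  assumes gen: "generates E (\<lambda>\<phi> x. \<i> * laplacian \<phi> x)"
  defines "u \<equiv> \<lambda>s. 1 + 2 * \<i> * of_real s"
  shows "L2norm (\<lambda>x. E s (wave \<xi>) x - gauss (- 1 / 2 / u s) (\<lambda>j. \<i> * of_real (\<xi> $ j) / u s)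
    (- \<i> * of_real ((norm \<xi>)\<^sup>2) * of_real s / u s - of_nat CARD('n) / 2 * Ln (u s)) x) = 0"
proof -
  have nz: "1 + 2 * \<i> * complex_of_real s \<noteq> 0" for s by (simp add: complex_eq_iff)
  have nn: "1 + 2 * \<i> * complex_of_real s \<notin> \<real>\<^sub>\<le>\<^sub>0" for s by (simp add: complex_nonpos_Reals_iff)
  define a where "a = (\<lambda>s. - 1 / 2 / (1 + 2 * \<i> * complex_of_real s))"
  define B where "B = (\<lambda>s j. \<i> * of_real (\<xi> $ j) / (1 + 2 * \<i> * complex_of_real s))"
  define c where "c = (\<lambda>s. - \<i> * of_real ((norm \<xi>)\<^sup>2) * of_real s / (1 + 2 * \<i> * complex_of_real s)
      - of_nat CARD('n) / 2 * Ln (1 + 2 * \<i> * complex_of_real s))"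
  define a' where "a' = (\<lambda>s. \<i> / (1 + 2 * \<i> * complex_of_real s)\<^sup>2)"
  define B' where "B' = (\<lambda>s j. 2 * of_real (\<xi> $ j) / (1 + 2 * \<i> * complex_of_real s)\<^sup>2)"
  define c' where "c' = (\<lambda>s. - \<i> * of_real ((norm \<xi>)\<^sup>2) / (1 + 2 * \<i> * complex_of_real s)\<^sup>2
      - of_nat CARD('n) * \<i> / (1 + 2 * \<i> * complex_of_real s))"
  have dinv: "((\<lambda>t. v / (1 + 2 * \<i> * complex_of_real t)) has_vector_derivative - 2 * \<i> * v / (1 + 2 * \<i> * complex_of_real t)\<^sup>2) (at t)" for v t
    using nz[of t] by (intro has_vector_derivative_real_field) (auto intro!: derivative_eq_intros simp: power2_eq_square)
  have dq: "((\<lambda>t. of_real t / (1 + 2 * \<i> * complex_of_real t)) has_vector_derivative 1 / (1 + 2 * \<i> * complex_of_real t)\<^sup>2) (at t)" for t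
  proof -
    have sub: "v / y - v = (v - v * y) / y" if "y \<noteq> 0" for v y :: complex
      using that by (simp add: diff_divide_distrib)
    \<comment> \<open>Partial fractions turn t / (1 + 2 i t) into a case of \<open>dinv\<close>
      minus a constant.\<close>
    have "of_real t / (1 + 2 * \<i> * complex_of_real t) = \<i> / 2 / (1 + 2 * \<i> * complex_of_real t) - \<i> / 2" for t
    proof -
      have "\<i> / 2 / (1 + 2 * \<i> * complex_of_real t) - \<i> / 2 = (\<i> / 2 - \<i> / 2 * (1 + 2 * \<i> * complex_of_real t)) / (1 + 2 * \<i> * complex_of_real t)"
        by (rule sub[OF nz])
      also have "\<i> / 2 - \<i> / 2 * (1 + 2 * \<i> * complex_of_real t) = of_real t" by (simp add: algebra_simps)
      finally show ?thesis ..
    qed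
    then show ?thesis using has_vector_derivative_diff[OF dinv[of "\<i> / 2" t] has_vector_derivative_const[of "\<i> / 2"]] by simp
  qed
  have dLn: "((\<lambda>t. Ln (1 + 2 * \<i> * complex_of_real t)) has_vector_derivative 2 * \<i> / (1 + 2 * \<i> * complex_of_real t)) (at t)" for t
    using nz[of t] nn[of t] by (intro has_vector_derivative_real_field) (auto intro!: derivative_eq_intros simp: divide_simps)
  interpret gauss_curve a a' c c' B B'
  proof
    show "(a has_vector_derivative a' t) (at t)" for t
      using dinv[of "- 1 / 2"] by (simp add: a_def a'_def)
    show "((\<lambda>t. B t j) has_vector_derivative B' t j) (at t)" for t j
      using dinv[of "\<i> * of_real (\<xi> $ j)"] by (simp add: B_def B'_def mult.assoc)
    show "(c has_vector_derivative c' t) (at t)" for t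
    proof -
      have "((\<lambda>t. - \<i> * of_real ((norm \<xi>)\<^sup>2) * (of_real t / (1 + 2 * \<i> * complex_of_real t)) - of_nat CARD('n) / 2 * Ln (1 + 2 * \<i> * complex_of_real t))
          has_vector_derivative - \<i> * of_real ((norm \<xi>)\<^sup>2) * (1 / (1 + 2 * \<i> * complex_of_real t)\<^sup>2) - of_nat CARD('n) / 2 * (2 * \<i> / (1 + 2 * \<i> * complex_of_real t))) (at t)"
        by (intro has_vector_derivative_diff has_vector_derivative_mult_right dq dLn)
      then show ?thesis by (simp add: c_def c'_def)
    qed
    show "Re (a t) < 0" for t
      by (simp add: a_def Re_divide divide_neg_pos add_pos_nonneg)
  qed (auto simp: a'_def B'_def c'_def nz intro!: continuous_intros)
  have n: "complex_of_real ((norm \<xi>)\<^sup>2) = (\<Sum>j\<in>UNIV. (of_real (\<xi> $ j))\<^sup>2)"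
    by (simp add: norm_vec_def L2_set_def sum_nonneg)
  have BB: "(\<Sum>j\<in>UNIV. (B t j)\<^sup>2) = - of_real ((norm \<xi>)\<^sup>2) / (1 + 2 * \<i> * complex_of_real t)\<^sup>2" for t
    unfolding n B_def by (simp add: power_divide power_mult_distrib sum_divide_distrib sum_negf)
  have alg: "\<i> / y\<^sup>2 - (\<i> * (4 * (- 1 / 2 / y)\<^sup>2) + 0) = 0"
    "2 * v / y\<^sup>2 - (\<i> * (4 * (- 1 / 2 / y) * (\<i> * v / y)) + 0) = 0"
    "- \<i> * v / y\<^sup>2 - N * \<i> / y - (\<i> * (- v / y\<^sup>2 + 2 * N * (- 1 / 2 / y)) + 0) = 0" for y v N :: complex
    by (simp_all add: power2_eq_square algebra_simps)
  have gen0: "generates E (\<lambda>\<phi> x. \<i> * laplacian \<phi> x + quad 0 (\<lambda>_. 0) 0 x * \<phi> x)"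
    using gen by (simp add: quad_def)
  have "L2norm (\<lambda>x. E s (G 0) x - G s x) \<le> 0 * L2norm (\<lambda>x::real^'n. of_real (decay x)) * \<bar>s\<bar>"
  proof (rule duhamel_gauss[OF gen0 order_refl])
    fix t and x :: "real^'n"
    have 1: "a' t - (\<i> * (4 * (a t)\<^sup>2) + 0) = 0"
      unfolding a_def a'_def by (rule alg)
    have 2: "B' t j - (\<i> * (4 * a t * B t j) + 0) = 0" for j
      unfolding a_def B_def B'_def by (rule alg)
    have 3: "c' t - (\<i> * ((\<Sum>j\<in>UNIV. (B t j)\<^sup>2) + 2 * of_nat CARD('n) * a t) + 0) = 0"
      unfolding BB a_def c'_def by (rule alg)
    show "cmod (quad (a' t - (\<i> * (4 * (a t)\<^sup>2) + 0)) (\<lambda>j. B' t j - (\<i> * (4 * a t * B t j) + 0))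
        (c' t - (\<i> * ((\<Sum>j\<in>UNIV. (B t j)\<^sup>2) + 2 * of_nat CARD('n) * a t) + 0)) x * G t x) \<le> 0 * decay x"
      unfolding 1 2 3 by (simp add: quad_def)
  qed
  then have "L2norm (\<lambda>x. E s (G 0) x - G s x) = 0"
    using L2norm_nonneg by (simp add: order_antisym)
  moreover have "G 0 = wave \<xi>" by (simp add: a_def B_def c_def wave_def)
  ultimately show ?thesis by (simp only: a_def B_def c_def u_def)
qed

text \<open>With tan \<theta> = 2 s, the free evolution at time s is the oscillator evolution at time \<theta>, followed
  by a dilation and a modulation (the lens transform). A negative \<theta> may be replaced by \<theta> + 2 pi,
  which costs the phase exp (- i pi d).\<close>

context schrodinger
begin

lemma small_reach_free:
  assumes gen: "generates E (\<lambda>\<phi> x. \<i> * laplacian \<phi> x)"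
  shows "small_reach (E s)"
  unfolding small_reach_def
proof (intro conjI allI impI)
  show iE: "isom (E s)" using gen unitary_group_isom[of E] by (simp add: generates_def)
  fix T :: real assume T: "T > 0"
  define \<theta> where "\<theta> = arctan (2 * s)"
  have cos: "cos \<theta> > 0" unfolding \<theta>_def by (simp add: cos_arctan add_pos_nonneg)
  have \<theta>b: "- pi / 2 < \<theta>" "\<theta> < pi / 2" unfolding \<theta>_def using arctan_bounded[of "2 * s"] by auto
  have tan: "2 * s * cos \<theta> = sin \<theta>"
    using cos tan_arctan[of "2 * s"] by (simp add: \<theta>_def tan_def field_simps)
  \<comment> \<open>With this l the oscillator runs through the angle \<theta> + 2 pi in exactly T /
    4; the other two factors get T / 4 each, three quarters of T in all.\<close>
  define l where "l = sqrt ((\<theta> + 2 * pi) / (T / 4))"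
  have \<theta>p: "\<theta> + 2 * pi > 0" using \<theta>b pi_gt_zero by linarith
  have l2: "l\<^sup>2 = (\<theta> + 2 * pi) / (T / 4)" using \<theta>p T by (simp add: l_def)
  have "x / (x / y) = y" if "x \<noteq> 0" for x y :: real using that by simp
  from this[of "\<theta> + 2 * pi" "T / 4"] have l: "l > 0" "(\<theta> + 2 * pi) / l\<^sup>2 = T / 4"
    unfolding l2 using \<theta>p T by (auto simp: l_def)
  \<comment> \<open>This undoes the dilation by l and performs the one by cos \<theta> that the lens
    transform asks for.\<close>
  define m where "m = cos \<theta> / l"
  have m: "m > 0" using cos l by (simp add: m_def)
  \<comment> \<open>The coefficient of the modulation is the imaginary part of -1 / (2 (1 + 2 i s)),
    which equals - cos \<theta> exp (- i \<theta>) / 2.\<close>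
  define V where "V = (\<lambda>f. modul (cos \<theta> * sin \<theta> / 2) (0 :: real^'d) (aff m 0 f))"
  \<comment> \<open>The ground state of the oscillator gains the phase - d / 2 per unit of angle, so
    the additional full turn contributes - pi d.\<close>
  define z where "z = exp (- \<i> * of_real (pi * real CARD('d)))"
  have V: "small_reach V" unfolding V_def by (rule small_reach_comp[OF small_reach_modul small_reach_dil[OF m]])
  have iV: "isom V" using V by (simp add: small_reach_def)
  let ?Q = "P (l ^ 4, 0) ((\<theta> + 2 * pi) / l\<^sup>2)"
  have iA: "isom (aff l (0 :: real^'d))" by (rule isom_aff[OF l(1)])
  show "reach T (E s)"
  \<comment> \<open>The family does not depend on its parameter: the limit principle only extends an
    identity that holds up to a phase on wave packets to all of L2.\<close>
  proof (rule reach_limit[where W'="\<lambda>_ f. V (?Q (aff l 0 f))" and z="\<lambda>_. z", OF iE])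
    show "isom (\<lambda>f. V (?Q (aff l 0 f)))" by (rule isom_comp[OF iV isom_comp[OF isom_P iA]])
    show "cmod z = 1" by (simp add: z_def)
    have "reach (T / 4) (aff l 0)" "reach (T / 4) V"
      using small_reach_dil[OF l(1)] V T by (auto simp: small_reach_def)
    moreover have "reach (T / 4) ?Q" unfolding l(2) using T by (intro reach_P) simp
    ultimately have "reach (T / 4 + T / 4 + T / 4) (\<lambda>f. V (?Q (aff l 0 f)))"
      by (intro reach_comp[OF isom_comp[OF isom_P iA] reach_comp[OF iA _ isom_P] iV])
    then have "reach T (\<lambda>f. V (?Q (aff l 0 f)))" by (rule reach_mono) (use T in simp)
    then show "\<forall>\<^sub>F \<tau> in at_right (0::real). reach T (\<lambda>f. V (?Q (aff l 0 f)))" by simp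
    fix \<xi> :: "real^'d"
    \<comment> \<open>The logarithm of 1 + 2 i s, which has argument \<theta> and modulus 1 / cos
      \<theta>; it is the principal one because |\<theta>| < pi / 2.\<close>
    define w where "w = \<i> * of_real \<theta> - of_real (ln (cos \<theta>))"
    have expw: "exp w = 1 + 2 * \<i> * of_real s"
    proof -
      have "exp w = exp (\<i> * of_real \<theta>) / of_real (cos \<theta>)"
        using cos unfolding w_def exp_diff exp_of_real by simp
      also have "\<dots> = 1 + 2 * \<i> * of_real s"
        using cos tan unfolding cis_conv_exp[symmetric] by (simp add: complex_eq_iff field_simps)
      finally show ?thesis .
    qed
    have Lnw: "Ln (1 + 2 * \<i> * of_real s) = w"
      unfolding expw[symmetric] by (rule Ln_exp) (use \<theta>b pi_gt_zero in \<open>auto simp: w_def\<close>)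
    have inv: "1 / (1 + 2 * \<i> * of_real s) = of_real (cos \<theta>) * exp (- \<i> * of_real \<theta>)"
    proof -
      have "1 / (1 + 2 * \<i> * of_real s) = exp (of_real (ln (cos \<theta>)) + - \<i> * of_real \<theta>)"
        unfolding expw[symmetric] w_def by (simp add: exp_minus flip: exp_minus inverse_eq_divide)
      then show ?thesis unfolding exp_add exp_of_real using cos by simp
    qed
    define gE where "gE = gauss (- 1 / 2 / (1 + 2 * \<i> * of_real s)) (\<lambda>j. \<i> * of_real (\<xi> $ j) / (1 + 2 * \<i> * of_real s))
      (- \<i> * of_real ((norm \<xi>)\<^sup>2) * of_real s / (1 + 2 * \<i> * of_real s) - of_nat CARD('d) / 2 * Ln (1 + 2 * \<i> * of_real s))"
    define gP where "gP = gauss (of_real (- l\<^sup>2 / 2)) (\<lambda>j. \<i> * of_real (l * \<xi> $ j) * exp (- \<i> * of_real (\<theta> + 2 * pi)))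
      (of_real ((norm \<xi>)\<^sup>2 / 4) * (exp (- 2 * \<i> * of_real (\<theta> + 2 * pi)) - 1)
        - \<i> * of_real (real CARD('d) * (\<theta> + 2 * pi) / 2) + of_real (real CARD('d) / 2 * ln l))"
    have E0: "L2norm (\<lambda>x. E s (wave \<xi>) x - gE x) = 0" unfolding gE_def by (rule free_wave[OF gen])
    have P0: "L2norm (\<lambda>x. ?Q (aff l 0 (wave \<xi>)) x - gP x) = 0" unfolding gP_def by (rule oscillator_wave[OF l(1)])
    have LE: "L2 gE" unfolding gE_def
      by (rule L2_gauss) (simp add: Re_divide divide_neg_pos add_pos_nonneg)
    have LP: "L2 gP" unfolding gP_def by (rule L2_gauss) (use l in simp)
    have cis: "exp (- \<i> * of_real y) = cis (- y)" for y by (simp add: cis_conv_exp)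
    have per1: "exp (- \<i> * of_real (\<theta> + 2 * pi)) = exp (- \<i> * of_real \<theta>)"
      unfolding cis complex_eq_iff cis.sel cos_minus sin_minus by simp
    have "exp (- 2 * \<i> * of_real (\<theta> + 2 * pi)) = (exp (- \<i> * of_real (\<theta> + 2 * pi)))\<^sup>2"
      unfolding exp_double[symmetric] by (simp add: mult.assoc)
    then have per2: "exp (- 2 * \<i> * of_real (\<theta> + 2 * pi)) = (exp (- \<i> * of_real \<theta>))\<^sup>2"
      unfolding per1 .
    \<comment> \<open>This is exp (- 2 i \<theta>) - 1 = - 2 i sin \<theta> exp (- i \<theta>) with
      sin \<theta> = 2 s cos \<theta>; it matches the terms in |\<xi>|^2 of the two flows.\<close>
    have dbl: "(exp (- \<i> * of_real \<theta>))\<^sup>2 - 1 = - 4 * \<i> * of_real s * (of_real (cos \<theta>) * exp (- \<i> * of_real \<theta>))"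
    proof -
      have C: "cos \<theta> * cos \<theta> = 1 - sin \<theta> * sin \<theta>" using cos_squared_eq[of \<theta>] by (simp add: power2_eq_square)
      have "- 4 * \<i> * of_real s * (of_real (cos \<theta>) * exp (- \<i> * of_real \<theta>))
          = - (2 * \<i> * of_real (2 * s * cos \<theta>)) * exp (- \<i> * of_real \<theta>)" by simp
      also have "\<dots> = (exp (- \<i> * of_real \<theta>))\<^sup>2 - 1"
        unfolding tan cis by (simp add: complex_eq_iff power2_eq_square C)
      finally show ?thesis ..
    qed
    have Vg: "V gP = (\<lambda>x. z * gE x)"
    proof -
      have a: "(of_real m)\<^sup>2 * of_real (- l\<^sup>2 / 2) + \<i> * of_real (cos \<theta> * sin \<theta> / 2) = - 1 / 2 / (1 + 2 * \<i> * of_real s)"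
      proof -
        have "(of_real m)\<^sup>2 * of_real (- l\<^sup>2 / 2) = complex_of_real (- (cos \<theta>)\<^sup>2 / 2)"
          using l(1) by (simp add: m_def power_divide)
        moreover have "- 1 / 2 / (1 + 2 * \<i> * of_real s) = - 1 / 2 * (of_real (cos \<theta>) * exp (- \<i> * of_real \<theta>))"
          unfolding inv[symmetric] by simp
        ultimately show ?thesis unfolding cis by (simp add: complex_eq_iff power2_eq_square)
      qed
      have b: "of_real m * (\<i> * of_real (l * \<xi> $ j) * exp (- \<i> * of_real (\<theta> + 2 * pi))) + \<i> * of_real ((0 :: real^'d) $ j)
          = \<i> * of_real (\<xi> $ j) / (1 + 2 * \<i> * of_real s)" for j
      proof -
        have "\<i> * of_real (\<xi> $ j) / (1 + 2 * \<i> * of_real s) = \<i> * of_real (\<xi> $ j) * (of_real (cos \<theta>) * exp (- \<i> * of_real \<theta>))"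
          unfolding inv[symmetric] by simp
        then show ?thesis unfolding per1 using l(1) by (simp add: m_def)
      qed
      have c: "of_real ((norm \<xi>)\<^sup>2 / 4) * (exp (- 2 * \<i> * of_real (\<theta> + 2 * pi)) - 1)
        - \<i> * of_real (real CARD('d) * (\<theta> + 2 * pi) / 2) + of_real (real CARD('d) / 2 * ln l) + of_real (real CARD('d) / 2 * ln m)
        = - \<i> * of_real (pi * real CARD('d)) + (- \<i> * of_real ((norm \<xi>)\<^sup>2) * of_real s / (1 + 2 * \<i> * of_real s) - of_nat CARD('d) / 2 * Ln (1 + 2 * \<i> * of_real s))"
      proof -
        have "- \<i> * of_real ((norm \<xi>)\<^sup>2) * of_real s / (1 + 2 * \<i> * of_real s)
            = of_real ((norm \<xi>)\<^sup>2 / 4) * (- 4 * \<i> * of_real s * (of_real (cos \<theta>) * exp (- \<i> * of_real \<theta>)))"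
          unfolding inv[symmetric] by simp
        moreover have lnm: "ln m = ln (cos \<theta>) - ln l" using cos l(1) by (simp add: m_def ln_div)
        ultimately show ?thesis unfolding per2 dbl Lnw w_def lnm by (simp add: algebra_simps add_divide_distrib diff_divide_distrib)
      qed
      have zz: "gauss A B (- \<i> * of_real (pi * real CARD('d)) + C) x = z * gauss A B C x" for A B C x
        unfolding gauss_def z_def exp_add[symmetric] by (simp add: quad_def algebra_simps)
      show ?thesis unfolding V_def gP_def dil_gauss[OF m] modul_gauss a b c gE_def by (rule ext) (rule zz)
    qed
    have L: "L2 (?Q (aff l 0 (wave \<xi>)))" "L2 (E s (wave \<xi>))"
      by (intro isom_L2[OF isom_P] isom_L2[OF iA] isom_L2[OF iE] L2_wave)+
    have "L2norm (\<lambda>x. V (?Q (aff l 0 (wave \<xi>))) x - z * E s (wave \<xi>) x)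
        \<le> L2norm (\<lambda>x. V (?Q (aff l 0 (wave \<xi>))) x - V gP x) + L2norm (\<lambda>x. V gP x - z * E s (wave \<xi>) x)"
      by (intro L2norm_triangle3 L2_cmult L isom_L2[OF iV] LP)
    also have "L2norm (\<lambda>x. V (?Q (aff l 0 (wave \<xi>))) x - V gP x) = 0"
      using isom_norm_diff[OF iV L(1) LP] P0 by simp
    also have "L2norm (\<lambda>x. V gP x - z * E s (wave \<xi>) x) = cmod z * L2norm (\<lambda>x. gE x - E s (wave \<xi>) x)"
      unfolding Vg L2norm_cmult[symmetric] by (simp only: right_diff_distrib)
    also have "\<dots> = 0" using E0 by (simp add: L2norm_minus_commute[of gE])
    finally have "L2norm (\<lambda>x. V (?Q (aff l 0 (wave \<xi>))) x - z * E s (wave \<xi>) x) = 0"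
      using L2norm_nonneg by (simp add: order_antisym)
    then show "((\<lambda>\<tau>. L2norm (\<lambda>x. V (?Q (aff l 0 (wave \<xi>))) x - z * E s (wave \<xi>) x)) \<longlongrightarrow> 0) (at_right (0::real))"
      by simp
  qed
qed

section \<open>From operators to states, and the final composition\<close>

lemma small_reach_imp_small_time_reachable:
  assumes "small_reach W" "L2 f"
  shows "small_time_reachable P f (W f)"
  unfolding small_time_reachable_def
proof (intro allI impI)
  fix e :: real assume e: "e > 0"
  then have r: "reach e W" using assms(1) by (simp add: small_reach_def)
  obtain cs z where c: "\<forall>(t, c) \<in> set cs. 0 \<le> t" "sum_list (map fst cs) \<le> e" "cmod z = 1"
    "\<And>g. g \<in> {f} \<Longrightarrow> L2norm (\<lambda>x. evolve P cs g x - z * W g x) < e"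
    by (rule reachE[OF r, of "{f}" e]) (use assms e in auto)
  have "z = exp (\<i> * of_real (Arg2pi z))" using Arg2pi_eq[of z] c(3) by simp
  then show "\<exists>cs \<theta>. (\<forall>(t, c) \<in> set cs. 0 \<le> t) \<and> sum_list (map fst cs) \<le> e \<and> 0 \<le> \<theta> \<and> \<theta> < 2 * pi
      \<and> L2norm (\<lambda>x. evolve P cs f x - exp (\<i> * of_real \<theta>) * W f x) < e"
    using c Arg2pi_ge_0[of z] Arg2pi_lt_2pi[of z] by (intro exI[of _ cs] exI[of _ "Arg2pi z"]) auto
qed

end

theorem theorem2:
  fixes \<psi>0 :: "real^'d \<Rightarrow> complex"
    and P :: "real \<times> (real^'d) \<Rightarrow> real \<Rightarrow> (real^'d \<Rightarrow> complex) \<Rightarrow> (real^'d \<Rightarrow> complex)"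
    and E :: "real \<Rightarrow> (real^'d \<Rightarrow> complex) \<Rightarrow> (real^'d \<Rightarrow> complex)"
    and s \<alpha> \<sigma> :: real and p \<beta> :: "real^'d"
  assumes "L2 \<psi>0"
    and "\<forall>c. generates (P c) (\<lambda>\<phi> x. - \<i> * schrod_op c \<phi> x)"
    and "generates E (\<lambda>\<phi> x. \<i> * laplacian \<phi> x)"
    and "\<sigma> > 0"
  shows "small_time_reachable P \<psi>0
           (E s (\<lambda>x. exp (\<i> * complex_of_real (\<alpha> * (norm x)^2 + p \<bullet> x))
                      * complex_of_real (\<sigma> powr (real CARD('d) / 2)) * \<psi>0 (\<sigma> *\<^sub>R x + \<beta>)))"
proof -
  interpret schrodinger P by unfold_locales (use assms(2) in blast)
  \<comment> \<open>The translation acts first: dilating afterwards produces \<psi>0 (\<sigma> x +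
    \<beta>), whereas the other order would produce \<psi>0 (\<sigma> (x + \<beta>)).\<close>
  let ?W = "\<lambda>f. E s (modul \<alpha> p (aff \<sigma> 0 (aff 1 \<beta> f)))"
  have "small_reach ?W"
    by (intro small_reach_comp[OF small_reach_free[OF assms(3)] small_reach_comp[OF small_reach_modul
            small_reach_comp[OF small_reach_dil[OF assms(4)] small_reach_transl]]])
  moreover have "modul \<alpha> p (aff \<sigma> 0 (aff 1 \<beta> \<psi>0)) =
      (\<lambda>x. exp (\<i> * complex_of_real (\<alpha> * (norm x)^2 + p \<bullet> x))
        * complex_of_real (\<sigma> powr (real CARD('d) / 2)) * \<psi>0 (\<sigma> *\<^sub>R x + \<beta>))"
    by (simp add: modul_def aff_def fun_eq_iff mult.assoc)
  ultimately show ?thesis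
    using small_reach_imp_small_time_reachable[of ?W, OF _ assms(1)] by simp
qed

end
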